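(* Let $k$ be one of $\mathbb{Z}/2\mathbb{Z}$, $\mathbb{Z}$, $\mathbb{C}$, let $V=k[X]/(X^2)$, and let $D$ be an oriented virtual link diagram. With the partial differentials $\partial_\tau$ of the Khovanov complex of $D$ including the pre- and post-compositions induced by orientation (cut loci and the bar operation) and by order (local and global orders), as defined in the context, all faces of the Khovanov complex anti-commute: for every state $S$ of $D$ and every two distinct classical crossings $\tau\neq\tau'$ that are $A$-smoothed in $S$, $$\partial_{\tau'}\circ\partial_{\tau}=-\,\partial_{\tau}\circ\partial_{\tau'}$$ as maps from $V(S)$ to $V(S'')$, where $S''$ is obtained from $S$ by changing both $\tau$ and $\tau'$ to $B$-smoothings.
   Context: **Diagrams.** A virtual link diagram is a generic immersion of circles in the plane each of whose double points is either a classical crossing (with over/under information) or a virtual crossing. A semi-arc is a portion of the diagram running from one passage through a classical crossing to the next (passing freely through virtual crossings). The $A$-smoothing of a classical crossing joins the two regions swept out by rotating the over-strand counterclockwise; the $B$-smoothing is the other one (at a positive crossing the $A$-smoothing is the orientation-respecting smoothing). A state $S$ is a choice of $A$ or $B$ at every classical crossing; its cycles are the closed curves resulting from the smoothings (virtual crossings are ignored). **Canonical local convention.** Draw a classical crossing (of either sign) so that both oriented strands point up, with half-edges SW, SE incoming and NW, NE outgoing. Canonical source-sink orientation: SW and NE are oriented toward the crossing, SE and NW away from it. Canonical local order of the two strands at a smoothed crossing: for the vertical (orientation-respecting) smoothing the left strand is labelled 1 and the right strand 2; for the horizontal smoothing the top strand is labelled 1 and the bottom strand 2. **Cut loci.**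 A cut locus is placed on each semi-arc whose two ends carry disagreeing source-sink orientations. Every cycle of every state contains an even number of cut loci. **Algebra.** $V=k[X]/(X^2)$, with multiplication $m$, comultiplication $\Delta(1)=1\otimes X+X\otimes 1$, $\Delta(X)=X\otimes X$, the zero map $\eta=0:V\to V$, and the bar operation, the $k$-linear map with $\overline{1}=1$, $\overline{X}=-X$. **Complex.** For each state $S$ choose arbitrarily a total order of its cycles (global order) and a marked point, not a cut locus, on each cycle. $V(S)=\bigotimes_{\text{cycles of }S}V$, factors listed in the global order. Let $\tau$ be an $A$-smoothed crossing of $S$ and $S'$ the state with $\tau$ changed to $B$. If one cycle of $S$ becomes one cycle of $S'$ then $\partial_\tau=\eta=0$. Otherwise $\partial_\tau:V(S)\to V(S')$ is the composite of: (1) permute the factors from the global order to the local order and multiply by the sign of this permutation, where the local order lists first the cycle(s) through $\tau$ (if two, the one containing the strand labelled 1, then the one containing the strand labelled 2) and then the remaining cycles in their relative global order; (2) on each factor whose cycle passes through $\tau$ apply the bar operation as many times as the number of cut loci met travelling along that cycle from its marked point to $\tau$; (3) apply $m$ to the first two factors (if two cycles merge) or $\Delta$ to the first factor (if one cycle splits; the first, resp. second, output factor belongs to the cycle of $S'$ containing the strand labelled 1, resp. 2, at $\tau$); (4) on each resulting factor apply the bar operation once for each cut locus met travelling along its cycle from $\tau$ (for a cycle not affected by $\tau$: from its marked point in $S$) to its marked point in $S'$; (5) permute the factors to the global order of $S'$ and multiply by the sign of this permutation. A face of the complex is the square given by a state $S$ and two distinct $A$-smoothed crossings of $S$. *)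

theory Defs
  imports
    "HOL-Analysis.Analysis"
    "HOL-Combinatorics.Permutations"
    "HOL-Library.Poly_Mapping"
    "HOL-Library.Z2"
begin

section \<open>Oriented virtual link diagrams\<close>

text \<open>
  A diagram consists of closed plane curves of period 1, the set of those double points that are
  classical crossings (the other double points are the virtual crossings), and the choice of the
  over-strand at each classical crossing. The orientation is the direction of the parametrization.
  A strand is named by the pair of its component and its parameter in \<open>[0,1)\<close>.
\<close>

record vdiagram =
  ncomp :: nat
  curve :: "nat \<Rightarrow> real \<Rightarrow> complex"
  classical :: "complex set"
  over :: "complex \<Rightarrow> nat \<times> real"

definition strands :: "vdiagram \<Rightarrow> complex \<Rightarrow> (nat \<times> real) set" where
  "strands L z = {(i, t). i < ncomp L \<and> 0 \<le> t \<and> t < 1 \<and> curve L i t = z}"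

definition tangent :: "vdiagram \<Rightarrow> nat \<times> real \<Rightarrow> complex" where
  "tangent L p = vector_derivative (curve L (fst p)) (at (snd p))"

definition cdet :: "complex \<Rightarrow> complex \<Rightarrow> real" where
  "cdet v w = Re v * Im w - Im v * Re w"

definition double_points :: "vdiagram \<Rightarrow> complex set" where
  "double_points L = {z. card (strands L z) = 2}"

definition virtual_link_diagram :: "vdiagram \<Rightarrow> bool" where
  "virtual_link_diagram L \<longleftrightarrow>
     (\<forall>i<ncomp L. (\<forall>t. curve L i (t + 1) = curve L i t)
        \<and> curve L i C1_differentiable_on UNIV \<and> (\<forall>t. tangent L (i, t) \<noteq> 0))
   \<and> (\<forall>z. finite (strands L z) \<and> card (strands L z) \<le> 2)
   \<and> finite (double_points L)
   \<and> (\<forall>z. \<forall>p\<in>strands L z. \<forall>q\<in>strands L z. p \<noteq> q \<longrightarrow> cdet (tangent L p) (tangent L q) \<noteq> 0)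
   \<and> classical L \<subseteq> double_points L
   \<and> (\<forall>z\<in>classical L. over L z \<in> strands L z)"

text \<open>
  Turn a crossing so that both strands point up. The strand running from SW to NE is the one from
  which the other strand is reached by a counterclockwise turn by less than \<open>\<pi>\<close>; the crossing is
  positive iff this strand is the over-strand.
\<close>

datatype corner = SW | SE | NW | NE

definition rising :: "vdiagram \<Rightarrow> complex \<Rightarrow> nat \<times> real" where
  "rising L z =
     (THE p. p \<in> strands L z \<and> (\<exists>q\<in>strands L z. cdet (tangent L p) (tangent L q) > 0))"

definition strand_at :: "vdiagram \<Rightarrow> complex \<Rightarrow> corner \<Rightarrow> nat \<times> real" where
  "strand_at L z k =
     (if k \<in> {SW, NE} then rising L z else (THE p. p \<in> strands L z \<and> p \<noteq> rising L z))"

definition classical_params :: "vdiagram \<Rightarrow> nat \<Rightarrow> real set" where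
  "classical_params L i = {t. 0 \<le> t \<and> t < 1 \<and> curve L i t \<in> classical L}"

text \<open>The next passage of the component through a classical crossing, past the base point \<open>t = 0\<close>
  if need be; it is the same passage again if the component has no other one.\<close>

definition next_passage :: "vdiagram \<Rightarrow> nat \<times> real \<Rightarrow> nat \<times> real" where
  "next_passage L p = (case p of (i, t) \<Rightarrow>
     (i, if \<exists>s\<in>classical_params L i. t < s
         then Min {s \<in> classical_params L i. t < s}
         else Min (classical_params L i)))"

text \<open>
  What the chain complex depends on: the classical crossings and their signs, the semi-arcs (each
  leading from an outgoing to an incoming half-edge), and the components without classical
  crossings.
\<close>

record 'c gauss =
  crossings :: "'c set"
  positive :: "'c \<Rightarrow> bool"
  semiarcs :: "(('c \<times> corner) \<times> ('c \<times> corner)) set"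
  loops :: "nat set"

definition gauss_of :: "vdiagram \<Rightarrow> complex gauss" where
  "gauss_of L = \<lparr>
     crossings = classical L,
     positive = (\<lambda>z. over L z = rising L z),
     semiarcs = {((z, k), (z', k')). z \<in> classical L \<and> z' \<in> classical L
        \<and> k \<in> {NW, NE} \<and> k' \<in> {SW, SE}
        \<and> next_passage L (strand_at L z k) = strand_at L z' k'},
     loops = {i. i < ncomp L \<and> classical_params L i = {}}\<rparr>"

section \<open>States, cycles and cut loci\<close>

text \<open>
  \<open>Half c k\<close> is the half-edge at corner \<open>k\<close> of crossing \<open>c\<close>, and \<open>Free i\<close> is component \<open>i\<close> if it has
  no classical crossing. A half-edge ends at the cut locus of its semi-arc, if there is one; so a
  point of a cycle that is not a cut locus lies on some half-edge or on a free component, and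
  moving it within that half-edge meets no cut locus.
\<close>

datatype 'c point = Half 'c corner | Free nat

definition points :: "'c gauss \<Rightarrow> 'c point set" where
  "points G = {Half c k | c k. c \<in> crossings G} \<union> Free ` loops G"

text \<open>A state is given by the set \<open>S\<close> of its \<open>B\<close>-smoothed crossings. The vertical smoothing is the
  \<open>A\<close>-smoothing of a positive and the \<open>B\<close>-smoothing of a negative crossing.\<close>

definition vertical :: "'c gauss \<Rightarrow> 'c set \<Rightarrow> 'c \<Rightarrow> bool" where
  "vertical G S c \<longleftrightarrow> (positive G c \<longleftrightarrow> c \<notin> S)"

fun partner :: "bool \<Rightarrow> corner \<Rightarrow> corner" where
  "partner True SW = NW"
| "partner True NW = SW"
| "partner True SE = NE"
| "partner True NE = SE"
| "partner False SW = SE"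
| "partner False SE = SW"
| "partner False NW = NE"
| "partner False NE = NW"

text \<open>In the canonical source-sink orientation SW and NE point toward the crossing. The two ends of
  a semi-arc disagree iff both point toward, or both point away from, their crossings.\<close>

definition toward :: "corner \<Rightarrow> bool" where
  "toward k \<longleftrightarrow> k \<in> {SW, NE}"

definition has_cut :: "corner \<Rightarrow> corner \<Rightarrow> bool" where
  "has_cut k k' \<longleftrightarrow> (toward k \<longleftrightarrow> toward k')"

text \<open>\<open>travel G S p n q\<close>: one can travel along a cycle of \<open>S\<close> from \<open>p\<close> to \<open>q\<close> meeting \<open>n\<close> cut loci.\<close>

inductive travel :: "'c gauss \<Rightarrow> 'c set \<Rightarrow> 'c point \<Rightarrow> nat \<Rightarrow> 'c point \<Rightarrow> bool"
  for G S p where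
  start: "travel G S p 0 p"
| smoothing: "travel G S p n (Half c k) \<Longrightarrow> travel G S p n (Half c (partner (vertical G S c) k))"
| semiarc: "travel G S p n (Half c k)
    \<Longrightarrow> ((c, k), (c', k')) \<in> semiarcs G \<or> ((c', k'), (c, k)) \<in> semiarcs G
    \<Longrightarrow> travel G S p (n + (if has_cut k k' then 1 else 0)) (Half c' k')"

definition cycle_at :: "'c gauss \<Rightarrow> 'c set \<Rightarrow> 'c point \<Rightarrow> 'c point set" where
  "cycle_at G S p = {q. \<exists>n. travel G S p n q}"

definition cycles :: "'c gauss \<Rightarrow> 'c set \<Rightarrow> 'c point set set" where
  "cycles G S = cycle_at G S ` points G"

text \<open>
  Number of cut loci between \<open>P\<close> and \<open>Q\<close> along a cycle of \<open>S\<close>. There are two directions of travel, and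
  there may be two points of \<open>P\<close> or \<open>Q\<close> to choose from, namely when the cycle passes a crossing
  twice; the least count is taken. Only its parity matters, as the bar operation is an involution,
  and the parity does not depend on these choices.
\<close>

definition cuts :: "'c gauss \<Rightarrow> 'c set \<Rightarrow> 'c point set \<Rightarrow> 'c point set \<Rightarrow> nat" where
  "cuts G S P Q = (LEAST n. \<exists>p\<in>P. \<exists>q\<in>Q. travel G S p n q)"

section \<open>Tensor powers of \<open>V\<close>\<close>

text \<open>
  \<open>V\<close> is free on \<open>1\<close> and \<open>X\<close>, and the \<open>n\<close>-th tensor power of \<open>V\<close> is free on the words of length \<open>n\<close> in
  these letters. All tensor powers live in the tensor algebra, which is the monoid algebra of the
  free monoid of words: there \<open>*\<close> is the tensor product and \<open>single 0 a\<close> is the scalar \<open>a\<close>.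
\<close>

instantiation list :: (type) monoid_add
begin

definition zero_list :: "'a list" where "0 = []"

definition plus_list :: "'a list \<Rightarrow> 'a list \<Rightarrow> 'a list" where "xs + ys = xs @ ys"

instance by standard (simp_all add: zero_list_def plus_list_def)

end

datatype gen = One_V | X_V

type_synonym 'k tensor = "gen list \<Rightarrow>\<^sub>0 'k"

definition word :: "gen list \<Rightarrow> 'k::comm_ring_1 tensor" where
  "word w = Poly_Mapping.single w 1"

definition lin :: "(gen list \<Rightarrow> 'k tensor) \<Rightarrow> 'k::comm_ring_1 tensor \<Rightarrow> 'k tensor" where
  "lin f v = (\<Sum>w\<in>Poly_Mapping.keys v.
     Poly_Mapping.single 0 (Poly_Mapping.lookup v w) * f w)"

fun mult_V :: "gen \<Rightarrow> gen \<Rightarrow> 'k::comm_ring_1 tensor" where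
  "mult_V One_V b = word [b]"
| "mult_V X_V One_V = word [X_V]"
| "mult_V X_V X_V = 0"

fun comult_V :: "gen \<Rightarrow> 'k::comm_ring_1 tensor" where
  "comult_V One_V = word [One_V] * word [X_V] + word [X_V] * word [One_V]"
| "comult_V X_V = word [X_V] * word [X_V]"

definition bar_V :: "'k::comm_ring_1 tensor \<Rightarrow> 'k tensor" where
  "bar_V = lin (\<lambda>w. if w = [One_V] then word [One_V] else if w = [X_V] then - word [X_V] else 0)"

definition mult_first :: "'k::comm_ring_1 tensor \<Rightarrow> 'k tensor" where
  "mult_first = lin (\<lambda>w. case w of a # b # u \<Rightarrow> mult_V a b * word u | _ \<Rightarrow> 0)"

definition comult_first :: "'k::comm_ring_1 tensor \<Rightarrow> 'k tensor" where
  "comult_first = lin (\<lambda>w. case w of a # u \<Rightarrow> comult_V a * word u | _ \<Rightarrow> 0)"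

text \<open>The bar operation, applied \<open>ns ! i\<close> times to the \<open>i\<close>-th factor.\<close>

fun bars_word :: "nat list \<Rightarrow> gen list \<Rightarrow> 'k::comm_ring_1 tensor" where
  "bars_word [] [] = 1"
| "bars_word (n # ns) (a # w) = (bar_V ^^ n) (word [a]) * bars_word ns w"
| "bars_word _ _ = 0"

definition bars :: "nat list \<Rightarrow> 'k::comm_ring_1 tensor \<Rightarrow> 'k tensor" where
  "bars ns = lin (bars_word ns)"

text \<open>Passing from factors listed as in \<open>xs\<close> to factors listed as in \<open>ys\<close>, with the sign.\<close>

definition reordering :: "'a list \<Rightarrow> 'a list \<Rightarrow> nat \<Rightarrow> nat" where
  "reordering xs ys = (THE \<sigma>. \<sigma> permutes {..<length xs} \<and> permute_list \<sigma> xs = ys)"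

definition reorder :: "'a list \<Rightarrow> 'a list \<Rightarrow> 'k::comm_ring_1 tensor \<Rightarrow> 'k tensor" where
  "reorder xs ys = lin (\<lambda>w. of_int (sign (reordering xs ys))
                             * word (permute_list (reordering xs ys) w))"

section \<open>The Khovanov complex\<close>

definition chain_space :: "'c gauss \<Rightarrow> 'c set \<Rightarrow> 'k::comm_ring_1 tensor set" where
  "chain_space G S = {v. Poly_Mapping.keys v \<subseteq> {w. length w = card (cycles G S)}}"

definition is_global_order ::
    "'c gauss \<Rightarrow> ('c set \<Rightarrow> 'c point set list) \<Rightarrow> bool" where
  "is_global_order G ord \<longleftrightarrow>
     (\<forall>S. S \<subseteq> crossings G \<longrightarrow> distinct (ord S) \<and> set (ord S) = cycles G S)"

definition is_marking ::
    "'c gauss \<Rightarrow> ('c set \<Rightarrow> 'c point set \<Rightarrow> 'c point) \<Rightarrow> bool" where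
  "is_marking G mark \<longleftrightarrow>
     (\<forall>S. S \<subseteq> crossings G \<longrightarrow> (\<forall>C\<in>cycles G S. mark S C \<in> C))"

text \<open>Strand 1 is the left strand, through SW, of the vertical and the top strand, through NW, of the
  horizontal smoothing; strand 2 goes through SE in both cases.\<close>

definition cycles_through :: "'c gauss \<Rightarrow> 'c set \<Rightarrow> 'c \<Rightarrow> 'c point set list" where
  "cycles_through G S \<tau> = remdups
     [cycle_at G S (Half \<tau> (if vertical G S \<tau> then SW else NW)), cycle_at G S (Half \<tau> SE)]"

definition partial_differential ::
    "'c gauss \<Rightarrow> ('c set \<Rightarrow> 'c point set list) \<Rightarrow> ('c set \<Rightarrow> 'c point set \<Rightarrow> 'c point)
     \<Rightarrow> 'c set \<Rightarrow> 'c \<Rightarrow> 'k::comm_ring_1 tensor \<Rightarrow> 'k tensor" where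
  "partial_differential G ord mark S \<tau> v =
    (let S' = insert \<tau> S;
         at_\<tau> = range (Half \<tau>);
         Cs = cycles_through G S \<tau>;
         Cs' = cycles_through G S' \<tau>;
         rest = filter (\<lambda>C. C \<notin> set Cs) (ord S);
         pre = map (\<lambda>C. cuts G S {mark S C} at_\<tau>) Cs @ map (\<lambda>C. 0) rest;
         post = map (\<lambda>C. cuts G S' at_\<tau> {mark S' C}) Cs'
                @ map (\<lambda>C. cuts G S' {mark S C} {mark S' C}) rest
     in if length Cs = 1 \<and> length Cs' = 1 then 0
        else reorder (Cs' @ rest) (ord S')
              (bars post
                ((if length Cs = 2 then mult_first else comult_first)
                  (bars pre
                    (reorder (ord S) (Cs @ rest) v)))))"

end

theory Submission
  imports Defs
begin

text \<open>
  At a crossing, let the strand labelled 1 be represented by \<open>NW\<close> and the one labelled 2 by \<open>SE\<close>;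
  this is right for both smoothings. List the cycles of a state in any order, represent each of
  them by any of its points, and take the coordinates of a chain with respect to this choice. A
  change of the order multiplies the coordinates by its sign, and moving a point along its cycle
  changes the sign of \<open>X\<close> for each cut locus passed. In coordinates which begin at the half-edges \<open>NW\<close>
  and \<open>SE\<close> of the crossing, a partial differential is just \<open>m\<close>, \<open>\<Delta>\<close> or \<open>0\<close>, without signs and bars.

  This is well defined because the number of cut loci between two points of a cycle has a
  well-defined parity: a cycle alternates between smoothings and semi-arcs, and a word of odd
  length in two fixed-point-free involutions has no fixed points. For the same reason, the parity
  of the cut loci on an arc which joins two of the eight half-edges of a face outside its two
  crossings only depends on these half-edges. Hence a face only depends on the matching of its
  eight half-edges by such arcs, and the 105 matchings are checked by evaluation.
\<close>

section \<open>Alternating words of involutions\<close>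

text \<open>What the bars have to repair is a face with one side made of two surgeries from one
  cycle to one cycle. That side is 0, so the other, if it first splits and then merges, must vanish,
  whereas m(\<Delta>(1)) = 2X. With an odd number of bars between the two maps, the terms 1
  \<otimes> X and X \<otimes> 1 cancel.

  The definition counts cut loci up to any of the four half-edges of a crossing, while the
  coordinates use \<open>NW\<close> and \<open>SE\<close> only. The parities agree if
  \<open>NW\<close> and \<open>SE\<close>, when on one cycle, are an even number of cut loci apart.
  This fails only if the arcs outside the crossing join \<open>NW\<close> to \<open>SE\<close> and
  \<open>SW\<close> to \<open>NE\<close>: the ends of such an arc point the same way, so its number
  of cut loci is odd; but then one cycle becomes one cycle. Within a face this is confirmed by
  evaluation, along with the cancellation (\<open>admissible\<close>).

  The evaluation works with transposed maps: a coordinate of the image becomes a signed list of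
  coordinates of the chain. The lists of the two sides of a face cancel in pairs, whatever the ring
  is. Coordinates are 0 by convention if the listed points do not meet each cycle exactly
  once.\<close>

fun word_act :: "('a \<Rightarrow> 'a) \<Rightarrow> ('a \<Rightarrow> 'a) \<Rightarrow> bool list \<Rightarrow> 'a \<Rightarrow> 'a" where
  "word_act f g [] x = x"
| "word_act f g (b # w) x = (if b then f else g) (word_act f g w x)"

lemma word_act_append: "word_act f g (u @ w) x = word_act f g u (word_act f g w x)"
  by (induction u) auto

lemma hd_eq_last_if_alternating:
  fixes w :: "bool list"
  assumes "\<And>i. Suc i < length w \<Longrightarrow> w ! i \<noteq> w ! Suc i" "odd (length w)"
  shows "hd w = last w"
proof -
  have *: "i < length w \<Longrightarrow> w ! i = (w ! 0 = even i)" for i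
  proof (induction i)
    case (Suc i)
    then show ?case using assms(1)[of i] by auto
  qed auto
  have "w \<noteq> []" using assms(2) by auto
  then show ?thesis using *[of "length w - 1"] assms(2)
    by (auto simp: hd_conv_nth last_conv_nth)
qed

text \<open>An odd word reduces to a single letter, which fixes nothing: equal neighbours cancel,
  and if there are none, the first and the last letter agree and can be conjugated away, which moves
  the fixed point to its image under that letter. Both steps shorten the word by two.\<close>

lemma even_length_if_word_act_fixed:
  assumes f: "\<And>y. y \<in> H \<Longrightarrow> f y \<in> H \<and> f (f y) = y \<and> f y \<noteq> y"
    and g: "\<And>y. y \<in> H \<Longrightarrow> g y \<in> H \<and> g (g y) = y \<and> g y \<noteq> y"
    and "x \<in> H" "word_act f g w x = x"
  shows "even (length w)"
  using assms(3,4)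
proof (induction "length w" arbitrary: w x rule: less_induct)
  case less
  have closed: "y \<in> H \<Longrightarrow> word_act f g u y \<in> H" for u y
    by (induction u) (auto simp: f g)
  show ?case
  proof (rule ccontr)
    assume odd: "odd (length w)"
    show False
    proof (cases "\<exists>i. Suc i < length w \<and> w ! i = w ! Suc i")
      case True
      then obtain i where i: "Suc i < length w" "w ! i = w ! Suc i" by auto
      then have "drop i w = w ! i # w ! i # drop (Suc (Suc i)) w"
        using Cons_nth_drop_Suc[of i w] Cons_nth_drop_Suc[of "Suc i" w] by simp
      then have w: "w = take i w @ [w ! i, w ! i] @ drop (Suc (Suc i)) w"
        using append_take_drop_id[of i w] by simp
      define u where "u = take i w @ drop (Suc (Suc i)) w"
      have "word_act f g w x = word_act f g u x" unfolding u_def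
        using arg_cong[OF w, of "\<lambda>w. word_act f g w x"]
        f[OF closed[OF less.prems(1)]] g[OF closed[OF less.prems(1)]]
        by (cases "w ! i") (simp_all add: word_act_append)
      then have u: "word_act f g u x = x" using less.prems(2) by simp
      have len: "Suc (Suc (length u)) = length w"
        using i(1) by (simp add: u_def)
      then have "even (length u)" using less.hyps[OF _ less.prems(1) u] by linarith
      then show False using odd by (simp flip: len)
    next
      case False
      then have hl: "hd w = last w" using hd_eq_last_if_alternating[OF _ odd] by blast
      obtain b u where w: "w = b # u" using odd by (cases w) auto
      show False
      proof (cases u rule: rev_cases)
        case Nil
        then show False using less.prems w f g by (auto split: if_splits)
      next
        case (snoc v c)
        with hl w have c: "c = b" by auto
        let ?h = "if b then f else g"
        have h: "y \<in> H \<Longrightarrow> ?h y \<in> H \<and> ?h (?h y) = y" for y using f g by auto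
        have "?h (word_act f g v (?h x)) = x"
          using less.prems(2) unfolding w snoc c by (auto simp: word_act_append)
        then have "word_act f g v (?h x) = ?h x"
          using h[OF closed[of "?h x" v]] h[OF less.prems(1)] by metis
        from less.hyps[OF _ _ this] have "even (length v)" using h[OF less.prems(1)] w snoc by simp
        then show False using odd w snoc by simp
      qed
    qed
  qed
qed

fun alt :: "('a \<Rightarrow> 'a) \<Rightarrow> ('a \<Rightarrow> 'a) \<Rightarrow> 'a \<Rightarrow> nat \<Rightarrow> 'a" where
  "alt f g x 0 = x"
| "alt f g x (Suc k) = (if even k then f else g) (alt f g x k)"

text \<open>In the orbit of a fixed point of the involution \<open>g\<close> under the dihedral group generated by \<open>f\<close>
  and \<open>g\<close>, alternate application of \<open>f\<close> and \<open>g\<close> runs through a path which ends at the next fixed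
  point of \<open>g\<close>.\<close>

lemma alternating_path:
  assumes f: "\<And>y. f (f y) = y" and g: "\<And>y. g (g y) = y"
    and H: "finite H" "x \<in> H" "f ` H \<subseteq> H" "g ` H \<subseteq> H" and x: "g x = x"
  obtains k where "odd k" "g (alt f g x k) = alt f g x k"
    "\<And>j. 0 < j \<Longrightarrow> j < k \<Longrightarrow> g (alt f g x j) \<noteq> alt f g x j"
    "f ` alt f g x ` {..k} \<subseteq> alt f g x ` {..k}"
    "g ` alt f g x ` {..k} \<subseteq> alt f g x ` {..k}"
proof -
  let ?a = "alt f g x"
  have inH: "((g \<circ> f) ^^ n) x \<in> H" for n using H by (induction n) auto
  have fin: "finite {y. \<exists>n. y = ((g \<circ> f) ^^ n) x}"
    by (rule finite_subset[OF _ H(1)]) (use inH in auto)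
  \<comment> \<open>The orbit of \<open>x\<close> under the injective map \<open>g \<circ> f\<close>
    stays in the finite set \<open>H\<close>, so it returns to \<open>x\<close>, which
    \<open>g\<close> fixes. Hence some positive index qualifies for the choice of
    \<open>k\<close>.\<close>
  have "inj (g \<circ> f)" using f g by (metis inj_compose injI)
  then obtain n where n: "n > 0" "((g \<circ> f) ^^ n) x = x"
    using funpow_inj_finite[OF _ fin] by metis
  have "?a (2 * n) = ((g \<circ> f) ^^ n) x" for n by (induction n) auto
  then have "?a (2 * n) = x" using n by auto
  then have ex: "0 < 2 * n \<and> g (?a (2 * n)) = ?a (2 * n)" using n x by auto
  define k where "k = (LEAST k. 0 < k \<and> g (?a k) = ?a k)"
  have k: "0 < k" "g (?a k) = ?a k"
    using LeastI[of "\<lambda>k. 0 < k \<and> g (?a k) = ?a k", OF ex] unfolding k_def by auto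
  have least: "g (?a j) \<noteq> ?a j" if "0 < j" "j < k" for j
    using not_less_Least[of j "\<lambda>k. 0 < k \<and> g (?a k) = ?a k"] that unfolding k_def by auto
  \<comment> \<open>A point of positive even index is the \<open>g\<close>-image of its predecessor.
    If \<open>g\<close> fixes it, then \<open>g\<close> also fixes the predecessor, against the
    minimality of \<open>k\<close>.\<close>
  have "odd k"
  proof
    assume "even k"
    then obtain j where j: "k = Suc j" "odd j" using k(1) by (cases k) auto
    then have "?a k = g (?a j)" by simp
    then have "g (?a j) = ?a j" using k(2) g by metis
    then show False using least[of j] j by (cases j) auto
  qed
  have "f (?a j) \<in> ?a ` {..k}" if "j \<le> k" for j
  proof (cases "even j")
    case True
    then have "f (?a j) = ?a (Suc j)" by simp
    moreover have "Suc j \<le> k" using that True \<open>odd k\<close> by (metis Suc_leI le_neq_implies_less)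
    ultimately show ?thesis by blast
  next
    case False
    then obtain i where "j = Suc i" "even i" by (cases j) auto
    then have "f (?a j) = ?a i" using f by simp
    then show ?thesis using that \<open>j = Suc i\<close> by auto
  qed
  moreover have "g (?a j) \<in> ?a ` {..k}" if "j \<le> k" for j
  proof (cases "odd j")
    case True
    show ?thesis
    proof (cases "j = k")
      case False
      then have "Suc j \<le> k" using that by auto
      moreover have "g (?a j) = ?a (Suc j)" using True by simp
      ultimately show ?thesis by blast
    qed (use k in auto)
  next
    case False
    show ?thesis
    proof (cases j)
      case 0
      then show ?thesis using x that by (auto intro!: image_eqI[of _ _ 0])
    next
      case (Suc i)
      then have "g (?a j) = ?a i" using g False by simp
      then show ?thesis using that Suc by auto
    qed
  qed
  ultimately show ?thesis using that[OF \<open>odd k\<close> k(2) least] by blast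
qed

section \<open>Parity of the number of cut loci\<close>

lemma partner_partner [simp]: "partner v (partner v k) = k"
  by (cases v; cases k) auto

lemma partner_neq [simp]: "partner v k \<noteq> k"
  by (cases v; cases k) auto

lemma toward_partner [simp]: "toward (partner v k) \<longleftrightarrow> \<not> toward k"
  by (cases v; cases k) (auto simp: toward_def)

lemma has_cut_commute: "has_cut k k' = has_cut k' k"
  by (auto simp: has_cut_def)

lemma travel_trans:
  "travel G S q m r \<Longrightarrow> travel G S p n q \<Longrightarrow> travel G S p (n + m) r"
proof (induction rule: travel.induct)
  case (semiarc m c k c' k')
  show ?case using travel.semiarc[OF semiarc(3)[OF semiarc(4)] semiarc(2)] by (simp add: add.assoc)
qed (auto intro: travel.intros)

lemma travel_sym: "travel G S p n q \<Longrightarrow> travel G S q n p"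
proof (induction rule: travel.induct)
  case (smoothing n c k)
  have "travel G S (Half c (partner (vertical G S c) k)) 0 (Half c k)"
    using travel.smoothing[OF travel.start, of G S c "partner (vertical G S c) k"] by simp
  from travel_trans[OF smoothing(2) this] show ?case by simp
next
  case (semiarc n c k c' k')
  have "travel G S (Half c' k') (0 + (if has_cut k' k then 1 else 0)) (Half c k)"
    using travel.semiarc[OF travel.start, of c' k' c k G S] semiarc(2) by blast
  from travel_trans[OF semiarc(3) this] show ?case by (simp add: has_cut_commute add.commute)
qed (auto intro: travel.intros)

section \<open>Points on a common cycle, with the parity of the cut loci between them\<close>

definition conn :: "'c gauss \<Rightarrow> 'c set \<Rightarrow> 'c point \<Rightarrow> 'c point \<Rightarrow> bool \<Rightarrow> bool" where
  "conn G S p q e \<longleftrightarrow> (\<exists>n. travel G S p n q \<and> even n = e)"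

lemma conn_refl: "conn G S p p True"
  using travel.start unfolding conn_def by force

lemma conn_sym: "conn G S p q e \<Longrightarrow> conn G S q p e"
  unfolding conn_def using travel_sym by blast

lemma conn_trans: "conn G S p q e \<Longrightarrow> conn G S q r e' \<Longrightarrow> conn G S p r (e = e')"
  unfolding conn_def using travel_trans even_add by metis

lemma conn_smoothing: "conn G S (Half c k) (Half c (partner (vertical G S c) k)) True"
  using travel.smoothing[OF travel.start] unfolding conn_def by force

lemma mem_cycle_at_iff: "q \<in> cycle_at G S p \<longleftrightarrow> (\<exists>e. conn G S p q e)"
  unfolding cycle_at_def conn_def by auto

lemma cycle_at_eq_iff: "cycle_at G S p = cycle_at G S q \<longleftrightarrow> (\<exists>e. conn G S p q e)"
proof
  assume "cycle_at G S p = cycle_at G S q"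
  then show "\<exists>e. conn G S p q e" using mem_cycle_at_iff conn_refl by metis
next
  assume "\<exists>e. conn G S p q e"
  then show "cycle_at G S p = cycle_at G S q"
    unfolding set_eq_iff mem_cycle_at_iff using conn_trans conn_sym by metis
qed

lemma travel_change_state:
  assumes "travel G S p n q"
    and "\<And>c k. Half c k \<in> cycle_at G S p \<Longrightarrow> vertical G S c = vertical G S' c"
  shows "travel G S' p n q"
  using assms(1)
proof (induction rule: travel.induct)
  case (smoothing n c k)
  then have "vertical G S c = vertical G S' c" using assms(2) by (auto simp: cycle_at_def)
  then show ?case using travel.smoothing[OF smoothing(2)] by simp
next
  case (semiarc n c k c' k')
  then show ?case by (intro travel.semiarc)
qed (rule travel.start)

text \<open>Now the condition is on the cycle of the target state \<open>S'\<close>. It applies at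
  each smoothing because the induction hypothesis has already carried the trip so far over to
  \<open>S'\<close>. With both versions, a condition on one state gives both directions in
  \<open>conn_away\<close>.\<close>

lemma travel_change_state':
  assumes "travel G S p n q"
    and "\<And>c k. Half c k \<in> cycle_at G S' p \<Longrightarrow> vertical G S c = vertical G S' c"
  shows "travel G S' p n q"
  using assms(1)
proof (induction rule: travel.induct)
  case (smoothing n c k)
  then have "vertical G S c = vertical G S' c" using assms(2) by (auto simp: cycle_at_def)
  then show ?case using travel.smoothing[OF smoothing(2)] by simp
next
  case (semiarc n c k c' k')
  then show ?case by (intro travel.semiarc)
qed (rule travel.start)

lemma travel_cuts:
  assumes "p \<in> P" "q \<in> Q" "travel G S p n q"
  shows "\<exists>p\<in>P. \<exists>q\<in>Q. travel G S p (cuts G S P Q) q"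
  unfolding cuts_def
  by (rule LeastI[where P = "\<lambda>n. \<exists>p\<in>P. \<exists>q\<in>Q. travel G S p n q"]) (use assms in blast)

fun toward_pt :: "'c point \<Rightarrow> bool" where
  "toward_pt (Half c k) = toward k"
| "toward_pt (Free i) = False"

definition half_edges :: "'c gauss \<Rightarrow> 'c point set" where
  "half_edges G = {Half c k | c k. c \<in> crossings G}"

fun smooth :: "'c gauss \<Rightarrow> 'c set \<Rightarrow> 'c point \<Rightarrow> 'c point" where
  "smooth G S (Half c k) = Half c (partner (vertical G S c) k)"
| "smooth G S (Free i) = Free i"

lemma smooth_smooth [simp]: "smooth G S (smooth G S x) = x"
  by (cases x) auto

text \<open>Each half-edge is an end of exactly one semi-arc, which leads to a different half-edge.
  Forgetting directions, the semi-arcs are therefore a fixed-point-free involution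
  \<open>arc\<close> of the half-edges, extended to the other points by any involution.\<close>

locale matched_gauss =
  fixes G :: "'c gauss" and arc :: "'c point \<Rightarrow> 'c point"
  assumes finite_crossings: "finite (crossings G)"
    and semiarc_iff: "c \<in> crossings G \<Longrightarrow>
      ((c, k), (c', k')) \<in> semiarcs G \<or> ((c', k'), (c, k)) \<in> semiarcs G \<longleftrightarrow>
      arc (Half c k) = Half c' k'"
    and arc_half_edge: "x \<in> half_edges G \<Longrightarrow> arc x \<in> half_edges G"
    and arc_arc [simp]: "arc (arc x) = x"
    and arc_neq: "x \<in> half_edges G \<Longrightarrow> arc x \<noteq> x"
begin

lemma finite_half_edges: "finite (half_edges G)"
proof -
  have "finite (UNIV :: corner set)"
    by (rule finite_subset[of _ "{SW, SE, NW, NE}"]) (auto, metis corner.exhaust)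
  moreover have "half_edges G = (\<lambda>(c, k). Half c k) ` (crossings G \<times> UNIV)"
    by (auto simp: half_edges_def)
  ultimately show ?thesis using finite_crossings by auto
qed

lemma travel_arc:
  assumes "travel G S p n x" "x \<in> half_edges G"
  shows "\<exists>m. travel G S p m (arc x) \<and> (even (m + n) \<longleftrightarrow> toward_pt x \<noteq> toward_pt (arc x))"
proof -
  obtain c k where x: "x = Half c k" "c \<in> crossings G" using assms(2) by (auto simp: half_edges_def)
  obtain c' k' where y: "arc x = Half c' k'" using arc_half_edge[OF assms(2)] by (auto simp: half_edges_def)
  then have "((c, k), (c', k')) \<in> semiarcs G \<or> ((c', k'), (c, k)) \<in> semiarcs G"
    using semiarc_iff x by metis
  from travel.semiarc[OF assms(1)[unfolded x] this]
  have "travel G S p (n + (if has_cut k k' then 1 else 0)) (arc x)" unfolding y .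
  then show ?thesis by (intro exI conjI, assumption) (auto simp: has_cut_def x(1) y[unfolded x(1)])
qed

lemma smooth_half_edge: "x \<in> half_edges G \<Longrightarrow> smooth G S x \<in> half_edges G \<and> smooth G S x \<noteq> x"
  by (auto simp: half_edges_def)

text \<open>A smoothing exchanges pointing toward the crossing with pointing away and meets no cut
  locus; a semi-arc either does the same or meets a cut locus. So each letter of the word changes
  exactly one of the two parities, that of the direction or that of the count.\<close>

lemma travel_word_act:
  assumes "travel G S p n q" "p \<in> half_edges G"
  shows "q \<in> half_edges G \<and> (\<exists>w. q = word_act (smooth G S) arc w p \<and>
    (even (n + length w) \<longleftrightarrow> toward_pt p = toward_pt q))"
  using assms(1)
proof (induction rule: travel.induct)
  case start
  then show ?case using assms(2) by (auto intro!: exI[of _ "[]"])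
next
  case (smoothing n c k)
  then obtain w where w: "Half c k = word_act (smooth G S) arc w p"
    "even (n + length w) \<longleftrightarrow> toward_pt p = toward k" by auto
  have "Half c (partner (vertical G S c) k) = word_act (smooth G S) arc (True # w) p"
    using w(1)[symmetric] by simp
  moreover have "even (n + length (True # w)) \<longleftrightarrow>
      toward_pt p = toward_pt (Half c (partner (vertical G S c) k))"
    using w(2) by auto
  moreover have "Half c (partner (vertical G S c) k) \<in> half_edges G"
    using smoothing(2) by (auto simp: half_edges_def)
  ultimately show ?case by blast
next
  case (semiarc n c k c' k')
  then obtain w where w: "Half c k = word_act (smooth G S) arc w p"
    "even (n + length w) \<longleftrightarrow> toward_pt p = toward k" by auto
  have arc: "arc (Half c k) = Half c' k'" using semiarc semiarc_iff by (auto simp: half_edges_def)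
  then have "Half c' k' = word_act (smooth G S) arc (False # w) p"
    using w(1)[symmetric] by simp
  moreover have "even (n + (if has_cut k k' then 1 else 0) + length (False # w)) \<longleftrightarrow>
      toward_pt p = toward_pt (Half c' k')"
    using w(2) by (auto simp: has_cut_def)
  moreover have "Half c' k' \<in> half_edges G"
    using semiarc(3) arc arc_half_edge by metis
  ultimately show ?case by blast
qed

lemma travel_Free: "travel G S p n q \<Longrightarrow> p = Free i \<Longrightarrow> q = Free i \<and> n = 0"
  by (induction rule: travel.induct) auto

text \<open>The word of a closed trip fixes its first half-edge, so its length is even, and the
  count has the parity of the length.\<close>

lemma even_travel_loop:
  assumes "p \<in> points G" "travel G S p n p"
  shows "even n"
proof (cases "p \<in> half_edges G")
  case True
  obtain w where w: "p = word_act (smooth G S) arc w p" "even (n + length w)"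
    using travel_word_act[OF assms(2) True] by blast
  have "even (length w)"
    by (rule even_length_if_word_act_fixed[OF _ _ True w(1)[symmetric]])
      (simp_all add: arc_half_edge arc_neq smooth_half_edge)
  then show ?thesis using w(2) by auto
next
  case False
  then obtain i where "p = Free i" using assms(1) by (auto simp: points_def half_edges_def)
  then show ?thesis using travel_Free[OF assms(2)] by auto
qed

lemma conn_unique:
  assumes "p \<in> points G" "conn G S p q e" "conn G S p q e'"
  shows "e = e'"
proof -
  have "conn G S p p (e = e')" using conn_trans[OF assms(2) conn_sym[OF assms(3)]] .
  then obtain n where "travel G S p n p" "even n = (e = e')" unfolding conn_def by auto
  then show ?thesis using even_travel_loop[OF assms(1)] by blast
qed

lemma even_cuts:
  assumes "p \<in> points G" "conn G S p q e"
  shows "even (cuts G S {p} {q}) = e"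
proof -
  obtain n where n: "travel G S p n q" using assms(2) by (auto simp: conn_def)
  have "travel G S p (cuts G S {p} {q}) q"
    using LeastI[of "\<lambda>n. \<exists>p\<in>{p}. \<exists>q\<in>{q}. travel G S p n q" n] n unfolding cuts_def by auto
  then show ?thesis using conn_unique[OF assms] unfolding conn_def by metis
qed

text \<open>The half-edges at the crossings in \<open>T\<close> are matched by the arcs which join them outside \<open>T\<close>.
  Such an arc alternates between semi-arcs and smoothings, and it begins and ends with a
  semi-arc; so the parity of its cut loci only depends on its ends.\<close>

definition nodes :: "'c set \<Rightarrow> 'c point set" where
  "nodes T = {Half c k | c k. c \<in> T}"

text \<open>Such sets replace explicit paths: the outer arc that starts at a half-edge
  \<open>x\<close> of \<open>T\<close> is the least of them around \<open>x\<close>.\<close>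

definition outer_closed :: "'c set \<Rightarrow> 'c set \<Rightarrow> 'c point set \<Rightarrow> bool" where
  "outer_closed S T A \<longleftrightarrow> (\<forall>x\<in>A. arc x \<in> A \<and> (x \<notin> nodes T \<longrightarrow> smooth G S x \<in> A))"

text \<open>The parity is required in every state that smooths the crossings outside
  \<open>T\<close> like \<open>S\<close>, because all four states of a face share one matching. The
  last two clauses enclose the arc from both sides: some closed set around \<open>x\<close> has no
  nodes but \<open>x\<close> and \<open>y\<close>, and every closed set around \<open>x\<close>
  contains \<open>y\<close>.\<close>

definition outer_mate :: "'c set \<Rightarrow> 'c set \<Rightarrow> 'c point \<Rightarrow> 'c point \<Rightarrow> bool" where
  "outer_mate S T x y \<longleftrightarrow> x \<in> nodes T \<and> y \<in> nodes T \<and> y \<noteq> x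
     \<and> (\<forall>S'. (\<forall>c. c \<notin> T \<longrightarrow> vertical G S' c = vertical G S c)
           \<longrightarrow> conn G S' x y (toward_pt x \<noteq> toward_pt y))
     \<and> (\<exists>A. outer_closed S T A \<and> x \<in> A \<and> A \<subseteq> half_edges G \<and> A \<inter> nodes T = {x, y})
     \<and> (\<forall>A. outer_closed S T A \<longrightarrow> x \<in> A \<longrightarrow> y \<in> A)"

text \<open>\<open>\<nu>\<close> is the smoothing involution suspended at \<open>T\<close>, so the
  half-edges it fixes are those at \<open>T\<close>. Alternating it with \<open>arc\<close>, one
  follows the outer arc from \<open>x\<close> to its other end in an odd number of steps.\<close>

lemma outer_mate_exists:
  assumes "T \<subseteq> crossings G" "x \<in> nodes T"
  shows "\<exists>y. outer_mate S T x y"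
proof -
  define \<nu> where "\<nu> y = (if y \<in> nodes T then y else smooth G S y)" for y
  have smooth_nodes: "smooth G S y \<in> nodes T \<longleftrightarrow> y \<in> nodes T" for y S
    by (cases y) (auto simp: nodes_def)
  have \<nu>: "\<nu> (\<nu> y) = y" for y by (auto simp: \<nu>_def smooth_nodes)
  have \<nu>_fix: "\<nu> y = y \<longleftrightarrow> y \<in> nodes T" if "y \<in> half_edges G" for y
    using smooth_half_edge[OF that] by (auto simp: \<nu>_def)
  have x: "x \<in> half_edges G" "\<nu> x = x" using assms by (auto simp: nodes_def half_edges_def \<nu>_def)
  have \<nu>_half: "\<nu> ` half_edges G \<subseteq> half_edges G" using smooth_half_edge by (auto simp: \<nu>_def)
  have arc_half: "arc ` half_edges G \<subseteq> half_edges G" using arc_half_edge by auto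
  obtain k where k: "odd k" "\<nu> (alt arc \<nu> x k) = alt arc \<nu> x k"
    "\<And>j. 0 < j \<Longrightarrow> j < k \<Longrightarrow> \<nu> (alt arc \<nu> x j) \<noteq> alt arc \<nu> x j"
    "arc ` alt arc \<nu> x ` {..k} \<subseteq> alt arc \<nu> x ` {..k}"
    "\<nu> ` alt arc \<nu> x ` {..k} \<subseteq> alt arc \<nu> x ` {..k}"
    using alternating_path[OF arc_arc \<nu> finite_half_edges x(1) arc_half _ x(2)] \<nu>_half by blast
  let ?a = "alt arc \<nu> x"
  have half: "?a j \<in> half_edges G" for j
    using x \<nu>_half arc_half_edge by (induction j) auto
  have conn: "conn G S' x (?a k) (toward_pt x \<noteq> toward_pt (?a k))"
    if S': "\<forall>c. c \<notin> T \<longrightarrow> vertical G S' c = vertical G S c" for S'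
  proof -
    have "\<exists>n. travel G S' x n (?a j) \<and> (even (n + j) \<longleftrightarrow> toward_pt x = toward_pt (?a j))"
      if "j \<le> k" for j
      using that
    proof (induction j)
      case 0
      then show ?case using travel.start by force
    next
      case (Suc j)
      then obtain n where n: "travel G S' x n (?a j)"
        "even (n + j) \<longleftrightarrow> toward_pt x = toward_pt (?a j)" by auto
      show ?case
      proof (cases "even j")
        case True
        from travel_arc[OF n(1) half] obtain m where "travel G S' x m (arc (?a j))"
          "even (m + n) \<longleftrightarrow> toward_pt (?a j) \<noteq> toward_pt (arc (?a j))" by auto
        then show ?thesis using n(2) True by (intro exI[of _ m]) auto
      next
        case False
        then have "0 < j" by (cases j) auto
        then have nn: "?a j \<notin> nodes T" using k(3)[of j] Suc.prems \<nu>_fix[OF half] by auto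
        obtain c r where cr: "?a j = Half c r" "c \<notin> T"
          using half[of j] nn by (auto simp: half_edges_def nodes_def)
        have "?a (Suc j) = Half c (partner (vertical G S' c) r)"
          using False nn cr S' by (simp add: \<nu>_def)
        then show ?thesis using travel.smoothing[OF n(1)[unfolded cr(1)]] n(2) cr
          by (intro exI[of _ n]) auto
      qed
    qed
    from this[of k] show ?thesis using k(1) unfolding conn_def by auto
  qed
  have y: "?a k \<in> nodes T" using k(2) \<nu>_fix[OF half] by auto
  \<comment> \<open>Otherwise the arc would be a closed trip with an odd number of cut loci.\<close>
  have "?a k \<noteq> x"
  proof
    assume "?a k = x"
    then have "conn G S x x False" using conn[of S] by auto
    moreover have "x \<in> points G" using x(1) by (auto simp: half_edges_def points_def)
    ultimately show False using conn_unique[OF _ conn_refl] by metis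
  qed
  moreover have "outer_closed S T (?a ` {..k})"
    unfolding outer_closed_def using k(4,5) by (auto simp: \<nu>_def image_subset_iff split: if_splits)
  moreover have "?a ` {..k} \<inter> nodes T = {x, ?a k}"
  proof -
    have "?a j \<in> nodes T \<Longrightarrow> j \<le> k \<Longrightarrow> j = 0 \<or> j = k" for j
      using k(3)[of j] \<nu>_fix[OF half] by (metis le_neq_implies_less not_gr_zero)
    then have "?a ` {..k} \<inter> nodes T \<subseteq> {?a 0, ?a k}" by blast
    moreover have "?a 0 \<in> ?a ` {..k}" "?a k \<in> ?a ` {..k}" by blast+
    ultimately show ?thesis using y assms(2) by (intro equalityI) simp_all
  qed
  moreover have "?a k \<in> A" if "outer_closed S T A" "x \<in> A" for A
  proof -
    have "?a j \<in> A" for j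
      using that by (induction j) (auto simp: outer_closed_def \<nu>_def)
    then show ?thesis .
  qed
  moreover have "x \<in> ?a ` {..k}" by (rule image_eqI[of _ _ 0]) auto
  moreover have "?a ` {..k} \<subseteq> half_edges G" using half by auto
  ultimately have "outer_mate S T x (?a k)"
    unfolding outer_mate_def
    by (intro conjI allI impI exI[of _ "?a ` {..k}"]) (use assms(2) y conn in simp_all)
  then show ?thesis ..
qed

lemma outer_mate_unique:
  assumes "outer_mate S T x y" "outer_mate S T x z"
  shows "y = z"
proof -
  obtain A where A: "outer_closed S T A" "x \<in> A" "A \<inter> nodes T = {x, y}"
    using assms(1) unfolding outer_mate_def by auto
  then have "z \<in> A" "z \<in> nodes T" "z \<noteq> x" using assms(2) unfolding outer_mate_def by auto
  then show ?thesis using A(3) by auto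
qed

text \<open>The mate of \<open>y\<close> lies in every closed set around \<open>y\<close>, in
  particular in the one which certifies \<open>y\<close> as the mate of \<open>x\<close>; its only
  node other than \<open>y\<close> is \<open>x\<close>.\<close>

lemma outer_mate_sym:
  assumes "T \<subseteq> crossings G" "outer_mate S T x y"
  shows "outer_mate S T y x"
proof -
  have "y \<in> nodes T" using assms(2) unfolding outer_mate_def by auto
  then obtain z where z: "outer_mate S T y z" using outer_mate_exists[OF assms(1)] by blast
  obtain A where A: "outer_closed S T A" "x \<in> A" "A \<inter> nodes T = {x, y}"
    using assms(2) unfolding outer_mate_def by auto
  then have "z \<in> A" "z \<in> nodes T" "z \<noteq> y" using z unfolding outer_mate_def by auto
  then show ?thesis using A(3) z by auto
qed

end

section \<open>Coefficients of tensors\<close>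

lemma lookup_scale: "Poly_Mapping.lookup (Poly_Mapping.single 0 a * p) w = a * Poly_Mapping.lookup p w"
  for p :: "'k::comm_ring_1 tensor"
  by (simp flip: mult_map_scale_conv_mult add: map.rep_eq when_def)

lemma lookup_lin:
  "Poly_Mapping.lookup (lin f v) w =
    (\<Sum>u\<in>Poly_Mapping.keys v. Poly_Mapping.lookup v u * Poly_Mapping.lookup (f u) w)"
  by (simp add: lin_def lookup_sum lookup_scale)

lemma lin_single: "lin f (Poly_Mapping.single w c) = Poly_Mapping.single 0 c * f w"
  by (cases "c = 0") (auto simp: lin_def)

lemma sum_keys_delta:
  "(\<Sum>u\<in>Poly_Mapping.keys v. Poly_Mapping.lookup v u * (if u = a then c else 0)) =
    Poly_Mapping.lookup v a * c"
  for c :: "'k::comm_ring_1"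
proof -
  have "Poly_Mapping.lookup v u * (if u = a then c else 0) =
      (if u = a then Poly_Mapping.lookup v a * c else 0)" for u by auto
  then show ?thesis by (simp add: in_keys_iff)
qed

lemma lookup_word: "Poly_Mapping.lookup (word u) w = (if u = w then 1 else 0)"
  by (auto simp: word_def lookup_single when_def)

lemma word_mult: "word u * word w = word (u @ w)"
  by (simp add: word_def mult_single plus_list_def)

definition homogeneous :: "nat \<Rightarrow> 'k::comm_ring_1 tensor \<Rightarrow> bool" where
  "homogeneous n v \<longleftrightarrow> (\<forall>w\<in>Poly_Mapping.keys v. length w = n)"

lemma homogeneous_lin:
  assumes "\<And>w. w \<in> Poly_Mapping.keys v \<Longrightarrow> homogeneous n (f w)"
  shows "homogeneous n (lin f v)"
  unfolding homogeneous_def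
proof
  fix w assume w: "w \<in> Poly_Mapping.keys (lin f v)"
  then have "Poly_Mapping.lookup (lin f v) w \<noteq> 0" by (simp add: in_keys_iff)
  then obtain u where u: "u \<in> Poly_Mapping.keys v" "Poly_Mapping.lookup v u * Poly_Mapping.lookup (f u) w \<noteq> 0"
    unfolding lookup_lin by (meson sum.not_neutral_contains_not_neutral)
  then have "w \<in> Poly_Mapping.keys (f u)" by (auto simp: in_keys_iff)
  then show "length w = n" using assms[OF u(1)] by (auto simp: homogeneous_def)
qed

lemma homogeneous_simps [simp]:
  "homogeneous n 0"
  "homogeneous n (word w) \<longleftrightarrow> length w = n"
  "homogeneous n (Poly_Mapping.single w c) \<longleftrightarrow> c = 0 \<or> length w = n"
  by (simp_all add: homogeneous_def word_def)

lemma homogeneous_add: "homogeneous n u \<Longrightarrow> homogeneous n v \<Longrightarrow> homogeneous n (u + v)"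
  unfolding homogeneous_def by (meson Un_iff keys_add subsetD)

definition bar_sign :: "nat \<Rightarrow> gen \<Rightarrow> 'k::comm_ring_1" where
  "bar_sign n g = (if g = X_V \<and> odd n then -1 else 1)"

lemma bar_V_single:
  "bar_V (Poly_Mapping.single [g] c) = Poly_Mapping.single [g] (bar_sign 1 g * c)"
  by (cases g) (simp_all add: bar_V_def lin_single word_def bar_sign_def mult_single single_uminus flip: single_uminus)

lemma bar_V_power: "(bar_V ^^ n) (word [g]) = Poly_Mapping.single [g] (bar_sign n g)"
proof (induction n)
  case 0
  then show ?case by (simp add: word_def bar_sign_def)
next
  case (Suc n)
  then show ?case by (simp add: bar_V_single) (simp add: bar_sign_def)
qed

lemma bars_word_eq:
  "bars_word ns w = (if length ns = length w
     then Poly_Mapping.single w (prod_list (map2 bar_sign ns w)) else 0)"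
  by (induction ns w rule: bars_word.induct)
    (auto simp: bar_V_power mult_single plus_list_def single_one[symmetric] zero_list_def)

lemma lookup_bars:
  fixes v :: "'k::comm_ring_1 tensor"
  assumes "length w = length ns"
  shows "Poly_Mapping.lookup (bars ns v) w = prod_list (map2 bar_sign ns w) * Poly_Mapping.lookup v w"
proof -
  have "Poly_Mapping.lookup (bars_word ns u :: 'k tensor) w = (if u = w then prod_list (map2 bar_sign ns w) else 0)"
    for u using assms by (auto simp: bars_word_eq lookup_single when_def)
  then show ?thesis by (simp only: bars_def lookup_lin sum_keys_delta mult.commute)
qed

lemma homogeneous_bars: "homogeneous (length ns) (bars ns v)"
  unfolding bars_def by (rule homogeneous_lin) (auto simp: bars_word_eq)

text \<open>The transpose of \<Delta> in the basis 1, X: each c \<otimes> d occurs in at most one of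
  \<Delta>(1) and \<Delta>(X), and then with coefficient 1.\<close>

fun dual_comult :: "gen \<Rightarrow> gen \<Rightarrow> gen option" where
  "dual_comult One_V One_V = None"
| "dual_comult One_V X_V = Some One_V"
| "dual_comult X_V One_V = Some One_V"
| "dual_comult X_V X_V = Some X_V"

lemma lookup_mult_first:
  "Poly_Mapping.lookup (mult_first v) (c # u) = (case c of
      One_V \<Rightarrow> Poly_Mapping.lookup v (One_V # One_V # u)
    | X_V \<Rightarrow> Poly_Mapping.lookup v (One_V # X_V # u) + Poly_Mapping.lookup v (X_V # One_V # u))"
proof -
  let ?f = "\<lambda>w. case w of a # b # u \<Rightarrow> mult_V a b * word u | _ \<Rightarrow> 0"
  have *: "Poly_Mapping.lookup (?f w) (c # u) = (if w = One_V # c # u then 1 else 0) +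
      (if w = X_V # One_V # u then (if c = X_V then 1 else 0) else 0)" for w
  proof (cases w rule: remdups_adj.cases)
    case (3 a b r)
    then show ?thesis by (cases a; cases b) (auto simp: word_mult lookup_word)
  qed auto
  show ?thesis
    unfolding mult_first_def lookup_lin *
    by (cases c) (simp_all add: distrib_left sum.distrib sum_keys_delta)
qed

lemma lookup_comult_first:
  "Poly_Mapping.lookup (comult_first v) (c # d # u) =
    (case dual_comult c d of None \<Rightarrow> 0 | Some g \<Rightarrow> Poly_Mapping.lookup v (g # u))"
proof -
  let ?f = "\<lambda>w. case w of a # u \<Rightarrow> comult_V a * word u | _ \<Rightarrow> 0"
  have *: "Poly_Mapping.lookup (?f w) (c # d # u) =
      (case dual_comult c d of None \<Rightarrow> 0 | Some g \<Rightarrow> if w = g # u then 1 else 0)" for w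
  proof (cases w)
    case (Cons a r)
    then show ?thesis
      by (cases a; cases c; cases d) (auto simp: word_mult lookup_word lookup_add distrib_right)
  qed (auto split: option.split)
  show ?thesis
    unfolding comult_first_def lookup_lin *
    by (cases "dual_comult c d") (simp_all add: sum_keys_delta)
qed

section \<open>Reordering\<close>

lemma reordering_unique:
  assumes "distinct xs" "\<sigma> permutes {..<length xs}" "permute_list \<sigma> xs = ys"
  shows "reordering xs ys = \<sigma>"
  unfolding reordering_def
proof (rule the_equality)
  fix \<tau> assume \<tau>: "\<tau> permutes {..<length xs} \<and> permute_list \<tau> xs = ys"
  show "\<tau> = \<sigma>"
  proof
    fix i
    show "\<tau> i = \<sigma> i"
    proof (cases "i < length xs")
      case True
      then have "xs ! \<tau> i = xs ! \<sigma> i"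
        using permute_list_nth[of \<tau> xs i] permute_list_nth[of \<sigma> xs i] \<tau> assms by auto
      then show ?thesis using assms(1,2) \<tau> True
        by (metis lessThan_iff nth_eq_iff_index_eq permutes_in_image)
    next
      case False
      then show ?thesis using \<tau> assms(2) by (auto simp: permutes_def)
    qed
  qed
qed (use assms in auto)

lemma reordering:
  assumes "distinct xs" "distinct ys" "set xs = set ys"
  shows "reordering xs ys permutes {..<length xs}" "permute_list (reordering xs ys) xs = ys"
proof -
  have "mset xs = mset ys" using assms set_eq_iff_mset_eq_distinct by blast
  then obtain \<sigma> where "\<sigma> permutes {..<length xs}" "permute_list \<sigma> xs = ys"
    by (metis mset_eq_permutation)
  then show "reordering xs ys permutes {..<length xs}" "permute_list (reordering xs ys) xs = ys"
    using reordering_unique[OF assms(1)] by auto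
qed

definition reorder_sign :: "'a list \<Rightarrow> 'a list \<Rightarrow> int" where
  "reorder_sign xs ys = sign (reordering xs ys)"

lemma reorder_sign_refl: "distinct xs \<Longrightarrow> reorder_sign xs xs = 1"
  using reordering_unique[of xs id xs] by (simp add: reorder_sign_def permutes_id sign_id)

lemma reorder_sign_trans:
  assumes "distinct xs" "distinct ys" "distinct zs" "set xs = set ys" "set ys = set zs"
  shows "reorder_sign xs ys * reorder_sign ys zs = reorder_sign xs zs"
proof -
  note a = reordering[OF assms(1,2,4)] and b = reordering[OF assms(2,3,5)]
  have len: "length ys = length xs" using arg_cong[OF a(2), of length] by simp
  have "permute_list (reordering xs ys \<circ> reordering ys zs) xs = zs"
    using permute_list_compose[of "reordering ys zs" xs "reordering xs ys"] b(1)
    by (simp only: a(2) b(2) len)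
  moreover have "(reordering xs ys \<circ> reordering ys zs) permutes {..<length xs}"
    using permutes_compose[of "reordering ys zs" _ "reordering xs ys"] a(1) b(1) by (simp only: len)
  ultimately have "reordering xs zs = reordering xs ys \<circ> reordering ys zs"
    using reordering_unique[OF assms(1)] by simp
  then show ?thesis
    using permutes_imp_permutation[OF finite_lessThan a(1)] permutes_imp_permutation[OF finite_lessThan b(1)]
    by (simp add: reorder_sign_def sign_compose)
qed

lemma reorder_sign_sym:
  assumes "distinct xs" "distinct ys" "set xs = set ys"
  shows "reorder_sign xs ys = reorder_sign ys xs"
proof -
  have "reorder_sign xs ys * reorder_sign ys xs = 1"
    using reorder_sign_trans[OF assms(1,2,1,3) assms(3)[symmetric]]
    unfolding reorder_sign_refl[OF assms(1)] .
  then show ?thesis by (auto simp: zmult_eq_1_iff)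
qed

lemma reorder_sign_Cons:
  assumes "distinct (x # xs)" "distinct (x # ys)" "set xs = set ys"
  shows "reorder_sign (x # xs) (x # ys) = reorder_sign xs ys"
proof -
  let ?\<sigma> = "reordering xs ys"
  let ?n = "length xs"
  have \<sigma>: "?\<sigma> permutes {..<?n}" "permute_list ?\<sigma> xs = ys" using reordering assms by auto
  \<comment> \<open>The permutation of the tails, shifted by one so that it fixes the position 0 of
    the common head.\<close>
  let ?\<tau> = "map_permutation {..<?n} Suc ?\<sigma>"
  have "?\<tau> permutes Suc ` {..<?n}" using \<sigma> by (intro map_permutation_permutes) auto
  then have \<tau>: "?\<tau> permutes {..<length (x # xs)}"
    by (rule permutes_subset) auto
  have "?\<tau> 0 = 0" using \<open>?\<tau> permutes Suc ` {..<?n}\<close> by (auto simp: permutes_def)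
  moreover have "?\<tau> (Suc i) = Suc (?\<sigma> i)" if "i < ?n" for i
    using that by (simp add: map_permutation_apply)
  ultimately have "permute_list ?\<tau> (x # xs) = x # permute_list ?\<sigma> xs"
    unfolding permute_list_def by (simp add: upt_conv_Cons map_Suc_upt[symmetric] del: upt_Suc)
  then have "reordering (x # xs) (x # ys) = ?\<tau>"
    using reordering_unique[OF assms(1) \<tau>] \<sigma> by simp
  moreover have "sign ?\<tau> = sign ?\<sigma>" using \<sigma>(1) by (intro sign_map_permutation) auto
  ultimately show ?thesis by (simp add: reorder_sign_def)
qed

lemma reorder_sign_append:
  assumes "distinct (us @ xs)" "distinct (us @ ys)" "set xs = set ys"
  shows "reorder_sign (us @ xs) (us @ ys) = reorder_sign xs ys"
  using assms by (induction us) (auto simp: reorder_sign_Cons)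

lemma reorder_sign_swap:
  assumes "distinct (us @ x # y # xs)"
  shows "reorder_sign (us @ x # y # xs) (us @ y # x # xs) = -1"
proof -
  have "reorder_sign (us @ x # y # xs) (us @ y # x # xs) = reorder_sign (x # y # xs) (y # x # xs)"
    using assms by (intro reorder_sign_append) auto
  moreover have "reordering (x # y # xs) (y # x # xs) = Transposition.transpose 0 1"
  proof (rule reordering_unique)
    show *: "Transposition.transpose 0 1 permutes {..<length (x # y # xs)}"
      by (rule permutes_swap_id) simp_all
    show "permute_list (Transposition.transpose 0 1) (x # y # xs) = y # x # xs"
    proof (rule nth_equalityI)
      fix i assume "i < length (permute_list (Transposition.transpose 0 1) (x # y # xs))"
      then have i: "i < length (x # y # xs)" by simp
      consider "i = 0" | "i = 1" | j where "i = Suc (Suc j)"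
        by (metis One_nat_def not0_implies_Suc)
      then show "permute_list (Transposition.transpose 0 1) (x # y # xs) ! i = (y # x # xs) ! i"
        unfolding permute_list_nth[OF * i] by cases (simp_all add: Transposition.transpose_def)
    qed simp
  qed (use assms in auto)
  ultimately show ?thesis by (simp add: reorder_sign_def sign_swap_id)
qed

lemma of_int_mult_word: "of_int s * word u = Poly_Mapping.single u (of_int s)"
  by (rule poly_mapping_eqI)
    (simp add: lookup_scale lookup_word lookup_single when_def flip: single_of_int)

text \<open>Words are written as a labelling \<open>\<gamma>\<close> of the cycles, mapped over the
  list of the cycles. In this form a change of the list moves no letters by hand, and only its sign
  is left.\<close>

lemma lookup_reorder:
  assumes "distinct xs" "distinct ys" "set xs = set ys" "homogeneous (length xs) v"
  shows "Poly_Mapping.lookup (reorder xs ys v) (map \<gamma> ys) =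
    of_int (reorder_sign xs ys) * Poly_Mapping.lookup v (map \<gamma> xs)"
proof -
  note r = reordering[OF assms(1-3)]
  have inj: "permute_list (reordering xs ys) u = map \<gamma> ys \<longleftrightarrow> u = map \<gamma> xs"
    if "length u = length xs" for u
  proof
    assume *: "permute_list (reordering xs ys) u = map \<gamma> ys"
    then have "permute_list (reordering xs ys) u = permute_list (reordering xs ys) (map \<gamma> xs)"
      using permute_list_map[of "reordering xs ys" xs \<gamma>] r by auto
    then have "permute_list (inv (reordering xs ys)) (permute_list (reordering xs ys) u) =
        permute_list (inv (reordering xs ys)) (permute_list (reordering xs ys) (map \<gamma> xs))" by simp
    then show "u = map \<gamma> xs"
      using permute_list_compose[of "inv (reordering xs ys)" u "reordering xs ys"]
        permute_list_compose[of "inv (reordering xs ys)" "map \<gamma> xs" "reordering xs ys"]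
        permutes_inv[OF r(1)] permutes_inv_o[OF r(1)] that by simp
  next
    assume "u = map \<gamma> xs"
    then show "permute_list (reordering xs ys) u = map \<gamma> ys"
      using permute_list_map[of "reordering xs ys" xs \<gamma>] r by auto
  qed
  have "Poly_Mapping.lookup (reorder xs ys v) (map \<gamma> ys) = (\<Sum>u\<in>Poly_Mapping.keys v. Poly_Mapping.lookup v u *
      (if u = map \<gamma> xs then of_int (reorder_sign xs ys) else 0))"
    unfolding reorder_def lookup_lin
    using assms(4) inj
    by (intro sum.cong refl)
      (simp add: of_int_mult_word lookup_single when_def homogeneous_def reorder_sign_def)
  then show ?thesis by (simp add: sum_keys_delta)
qed

lemma homogeneous_reorder:
  assumes "homogeneous n v"
  shows "homogeneous n (reorder xs ys v)"
  unfolding reorder_def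
  using assms by (intro homogeneous_lin) (auto simp: of_int_mult_word homogeneous_def[of _ v])

lemma bar_sign_cong: "even n = even m \<Longrightarrow> bar_sign n g = bar_sign m g"
  by (simp add: bar_sign_def)

lemma bar_sign_square: "bar_sign n g * bar_sign n g = 1"
  by (simp add: bar_sign_def)

lemma of_int_reorder_sign_square:
  "of_int (reorder_sign xs ys) * of_int (reorder_sign xs ys) = (1 :: 'k::comm_ring_1)"
  by (simp add: reorder_sign_def flip: of_int_mult)

lemma unit_mult_eq_0:
  fixes a b x :: "'k::comm_ring_1"
  assumes "a * a = 1" "b * b = 1" "a * b * x = 0"
  shows "x = 0"
proof -
  have "x = (a * a) * (b * b) * x" using assms(1,2) by simp
  also have "\<dots> = a * b * (a * b * x)" by (simp only: mult_ac)
  finally show ?thesis using assms(3) by simp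
qed

section \<open>Coordinates on the chain spaces\<close>

locale khovanov = matched_gauss G arc
  for G :: "'c gauss" and arc +
  fixes ord :: "'c set \<Rightarrow> 'c point set list" and mark :: "'c set \<Rightarrow> 'c point set \<Rightarrow> 'c point"
  assumes global_order: "is_global_order G ord" and marking: "is_marking G mark"
begin

lemma set_ord: "S \<subseteq> crossings G \<Longrightarrow> set (ord S) = cycles G S"
  and distinct_ord: "S \<subseteq> crossings G \<Longrightarrow> distinct (ord S)"
  using global_order by (auto simp: is_global_order_def)

lemma points_closed:
  assumes "p \<in> points G" "conn G S p q e"
  shows "q \<in> points G"
proof (cases "p \<in> half_edges G")
  case True
  then show ?thesis
    using assms(2) travel_word_act[OF _ True] by (auto simp: conn_def points_def half_edges_def)
next
  case False
  then obtain i where "p = Free i" using assms(1) by (auto simp: points_def half_edges_def)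
  then show ?thesis using travel_Free assms by (metis conn_def)
qed

lemma conn_mark:
  assumes "S \<subseteq> crossings G" "p \<in> points G"
  obtains e where "conn G S (mark S (cycle_at G S p)) p e" "mark S (cycle_at G S p) \<in> points G"
proof -
  have "mark S (cycle_at G S p) \<in> cycle_at G S p"
    using marking assms by (auto simp: is_marking_def cycles_def)
  then obtain e where "conn G S p (mark S (cycle_at G S p)) e" by (auto simp: mem_cycle_at_iff)
  then show ?thesis using that conn_sym points_closed[OF assms(2)] by metis
qed

definition transversal :: "'c set \<Rightarrow> 'c point list \<Rightarrow> bool" where
  "transversal S ps \<longleftrightarrow> set ps \<subseteq> points G \<and> distinct (map (cycle_at G S) ps)
     \<and> cycle_at G S ` set ps = cycles G S"

definition label :: "'c set \<Rightarrow> ('c point \<times> gen) list \<Rightarrow> 'c point set \<Rightarrow> gen" where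
  "label S L C = the (map_of (map (\<lambda>(p, g). (cycle_at G S p, g)) L) C)"

definition mark_sign :: "'c set \<Rightarrow> 'c point \<times> gen \<Rightarrow> 'k::comm_ring_1" where
  "mark_sign S = (\<lambda>(p, g). bar_sign (cuts G S {mark S (cycle_at G S p)} {p}) g)"

text \<open>The coordinates of \<open>v\<close> if the cycles are listed in the order of, and marked at, the points
  of \<open>L\<close>.\<close>

definition coord :: "'c set \<Rightarrow> 'k::comm_ring_1 tensor \<Rightarrow> ('c point \<times> gen) list \<Rightarrow> 'k" where
  "coord S v L = (if transversal S (map fst L)
     then of_int (reorder_sign (map (cycle_at G S \<circ> fst) L) (ord S)) * prod_list (map (mark_sign S) L)
        * Poly_Mapping.lookup v (map (label S L) (ord S))
     else 0)"

lemma label_eq: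
  assumes "distinct (map (cycle_at G S \<circ> fst) L)" "(p, g) \<in> set L"
  shows "label S L (cycle_at G S p) = g"
proof -
  have "map_of (map (\<lambda>(p, g). (cycle_at G S p, g)) L) (cycle_at G S p) = Some g"
  proof (rule map_of_is_SomeI)
    show "distinct (map fst (map (\<lambda>(p, g). (cycle_at G S p, g)) L))"
      using assms(1) by (simp add: comp_def case_prod_beta)
  qed (use assms(2) in force)
  then show ?thesis by (simp add: label_def)
qed

lemma coord_eq:
  assumes S: "S \<subseteq> crossings G" and tr: "transversal S (map fst L)"
    and \<gamma>: "\<And>p g. (p, g) \<in> set L \<Longrightarrow> \<gamma> (cycle_at G S p) = g"
  shows "coord S v L = of_int (reorder_sign (map (cycle_at G S \<circ> fst) L) (ord S))
     * prod_list (map (mark_sign S) L) * Poly_Mapping.lookup v (map \<gamma> (ord S))"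
proof -
  have "label S L C = \<gamma> C" if "C \<in> set (ord S)" for C
  proof -
    have "C \<in> cycle_at G S ` set (map fst L)"
      using that tr set_ord[OF S] by (simp add: transversal_def)
    then obtain p where "p \<in> set (map fst L)" "C = cycle_at G S p" by blast
    then obtain g where "(p, g) \<in> set L" by auto
    then show ?thesis using label_eq[of S L p g] \<gamma> tr \<open>C = _\<close> by (auto simp: transversal_def)
  qed
  then have "map (label S L) (ord S) = map \<gamma> (ord S)" by simp
  then show ?thesis using tr by (simp add: coord_def del: map_eq_conv)
qed

lemma mark_sign_square: "mark_sign S x * mark_sign S x = 1"
  by (simp add: mark_sign_def bar_sign_square split: prod.split)

lemma prod_mark_sign_square:
  "prod_list (map (mark_sign S) L) * prod_list (map (mark_sign S) L) = (1 :: 'k::comm_ring_1)"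
proof (induction L)
  case (Cons x L)
  have "prod_list (map (mark_sign S) (x # L)) * prod_list (map (mark_sign S) (x # L)) =
    (mark_sign S x * mark_sign S x)
      * (prod_list (map (mark_sign S) L) * prod_list (map (mark_sign S) L) :: 'k)"
    by (simp add: mult_ac)
  then show ?case using Cons by (simp only: mark_sign_square mult_1)
qed simp

lemma transversal_mset_cong:
  assumes "mset ps = mset qs"
  shows "transversal S ps \<longleftrightarrow> transversal S qs"
proof -
  have "mset (map (cycle_at G S) ps) = mset (map (cycle_at G S) qs)" using assms by simp
  then show ?thesis
    using mset_eq_setD[OF assms] mset_eq_imp_distinct_iff by (simp only: transversal_def) blast
qed

lemma coord_add: "coord S (u + v) L = coord S u L + coord S v L"
  by (simp add: coord_def lookup_add distrib_left)

lemma transversal_cycles: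
  "transversal S ps \<Longrightarrow> S \<subseteq> crossings G \<Longrightarrow>
    distinct (map (cycle_at G S) ps) \<and> set (map (cycle_at G S) ps) = set (ord S)"
  by (auto simp: transversal_def set_ord)

text \<open>Labels and bar signs belong to the cycles and not to their positions, so exchanging
  neighbours affects only the sign of the order. If the points are no transversal, both sides are
  0.\<close>

lemma coord_swap:
  assumes "S \<subseteq> crossings G"
  shows "coord S v (A @ x # y # B) = - coord S v (A @ y # x # B)"
proof (cases "transversal S (map fst (A @ x # y # B))")
  case True
  let ?c = "cycle_at G S \<circ> fst"
  have tr: "transversal S (map fst (A @ y # x # B))"
    using True transversal_mset_cong[of "map fst (A @ x # y # B)" "map fst (A @ y # x # B)"] by simp
  have d: "distinct (map ?c (A @ x # y # B))" "set (map ?c (A @ x # y # B)) = set (ord S)"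
    using transversal_cycles[OF True assms] by auto
  have d': "distinct (map ?c (A @ y # x # B))" "set (map ?c (A @ y # x # B)) = set (ord S)"
    using transversal_cycles[OF tr assms] by auto
  have lab: "label S (A @ x # y # B) (cycle_at G S p) = g" if "(p, g) \<in> set (A @ y # x # B)" for p g
    by (rule label_eq[OF d(1)]) (use that in auto)
  have "coord S v (A @ y # x # B) = of_int (reorder_sign (map ?c (A @ y # x # B)) (ord S))
     * prod_list (map (mark_sign S) (A @ y # x # B))
     * Poly_Mapping.lookup v (map (label S (A @ x # y # B)) (ord S))"
    by (rule coord_eq[OF assms tr]) (rule lab)
  moreover have "reorder_sign (map ?c (A @ x # y # B)) (ord S)
      = - reorder_sign (map ?c (A @ y # x # B)) (ord S)"
  proof -
    have "reorder_sign (map ?c (A @ x # y # B)) (ord S) =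
        reorder_sign (map ?c (A @ x # y # B)) (map ?c (A @ y # x # B)) *
        reorder_sign (map ?c (A @ y # x # B)) (ord S)"
      by (rule reorder_sign_trans[symmetric])
        (use d d' distinct_ord[OF assms] in \<open>simp_all only: refl\<close>)
    then show ?thesis
      using reorder_sign_swap[of "map ?c A" "?c x" "?c y" "map ?c B"] d(1) by simp
  qed
  ultimately show ?thesis using True by (simp add: coord_def mult_ac)
next
  case False
  moreover have "\<not> transversal S (map fst (A @ y # x # B))"
    using False transversal_mset_cong[of "map fst (A @ x # y # B)" "map fst (A @ y # x # B)"] by simp
  ultimately show ?thesis by (simp add: coord_def)
qed

lemma mark_sign_move:
  assumes "S \<subseteq> crossings G" "p \<in> points G" "conn G S p q e"
  shows "mark_sign S (p, g) = bar_sign (if e then 0 else 1) g * mark_sign S (q, g)"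
proof -
  have C: "cycle_at G S q = cycle_at G S p" using cycle_at_eq_iff conn_sym[OF assms(3)] by metis
  obtain e1 where e1: "conn G S (mark S (cycle_at G S p)) p e1" "mark S (cycle_at G S p) \<in> points G"
    using conn_mark[OF assms(1,2)] .
  have "conn G S (mark S (cycle_at G S p)) q (e1 = e)" using conn_trans[OF e1(1) assms(3)] .
  then have "even (cuts G S {mark S (cycle_at G S p)} {q}) = (e1 = e)" using even_cuts[OF e1(2)] by blast
  moreover have "even (cuts G S {mark S (cycle_at G S p)} {p}) = e1" using even_cuts[OF e1(2,1)] .
  ultimately show ?thesis
    by (auto simp: mark_sign_def C bar_sign_def)
qed

lemma coord_move:
  assumes "S \<subseteq> crossings G" "p \<in> points G" "conn G S p q e"
  shows "coord S v (A @ (p, g) # B) = bar_sign (if e then 0 else 1) g * coord S v (A @ (q, g) # B)"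
proof -
  have C: "cycle_at G S q = cycle_at G S p" using cycle_at_eq_iff conn_sym[OF assms(3)] by metis
  have "q \<in> points G" using points_closed assms(2,3) by blast
  then have "transversal S (map fst (A @ (p, g) # B)) = transversal S (map fst (A @ (q, g) # B))"
    using assms(2) by (simp add: transversal_def C)
  moreover have "label S (A @ (p, g) # B) = label S (A @ (q, g) # B)"
    by (rule ext) (simp add: label_def C)
  ultimately show ?thesis
    by (simp add: coord_def C mark_sign_move[OF assms] mult_ac)
qed

text \<open>Each word of a chain is a labelling of its cycles and is thus seen by some
  \<open>gs\<close>. The coordinates are the coefficients up to signs, which are invertible in any
  ring.\<close>

lemma coord_0_imp_0:
  assumes S: "S \<subseteq> crossings G" and v: "v \<in> chain_space G S" and ps: "transversal S ps"
    and 0: "\<And>gs. length gs = length ps \<Longrightarrow> coord S v (zip ps gs) = 0"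
  shows "v = 0"
proof (rule poly_mapping_eqI)
  fix w
  show "Poly_Mapping.lookup v w = Poly_Mapping.lookup 0 w"
  proof (cases "w \<in> Poly_Mapping.keys v")
    case True
    then have len: "length w = length (ord S)"
      using v set_ord[OF S] distinct_card[OF distinct_ord[OF S]] by (auto simp: chain_space_def)
    define \<gamma> where "\<gamma> C = the (map_of (zip (ord S) w) C)" for C
    have w: "map \<gamma> (ord S) = w"
    proof (rule nth_equalityI)
      fix i assume "i < length (map \<gamma> (ord S))"
      then show "map \<gamma> (ord S) ! i = w ! i"
        using len distinct_ord[OF S] by (simp add: \<gamma>_def map_of_zip_nth)
    qed (simp add: len)
    let ?L = "zip ps (map (\<lambda>p. \<gamma> (cycle_at G S p)) ps)"
    have e: "coord S v ?L = of_int (reorder_sign (map (cycle_at G S \<circ> fst) ?L) (ord S))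
       * prod_list (map (mark_sign S) ?L) * Poly_Mapping.lookup v (map \<gamma> (ord S))"
      by (rule coord_eq[OF S]) (auto simp: ps in_set_zip)
    have z: "coord S v ?L = 0" using 0 by simp
    have "Poly_Mapping.lookup v (map \<gamma> (ord S)) = 0"
      by (rule unit_mult_eq_0[OF of_int_reorder_sign_square prod_mark_sign_square e[unfolded z, symmetric]])
    then show ?thesis by (simp only: w lookup_zero)
  qed (simp add: in_keys_iff)
qed

end

section \<open>Partial differentials in coordinates\<close>

text \<open>For \<open>f\<close> the cycle of a point and \<open>W\<close> the cycles away from a
  crossing: two points at the crossing are split off from a transversal.\<close>

lemma complement_image2:
  fixes f :: "'a \<Rightarrow> 'b"
  assumes "f x \<notin> W" "f y \<notin> W" "f x \<noteq> f y" "x \<in> P" "y \<in> P"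
  shows "set (x # y # ps) \<subseteq> P \<and> distinct (map f (x # y # ps)) \<and> f ` set (x # y # ps) = {f x, f y} \<union> W
    \<longleftrightarrow> set ps \<subseteq> P \<and> distinct (map f ps) \<and> f ` set ps = W"
proof -
  have "a \<notin> X \<and> b \<notin> X \<and> insert a (insert b X) = {a, b} \<union> W \<longleftrightarrow> X = W"
    if "a \<notin> W" "b \<notin> W" for a b :: 'b and X W
  proof
    assume *: "a \<notin> X \<and> b \<notin> X \<and> insert a (insert b X) = {a, b} \<union> W"
    then have "X = insert a (insert b X) - {a, b}" by blast
    also have "\<dots> = ({a, b} \<union> W) - {a, b}" using * by simp
    also have "\<dots> = W" using that by blast
    finally show "X = W" .
  qed (use that in blast)
  note * = this[OF assms(1,2), of "f ` set ps"]
  have "set (x # y # ps) \<subseteq> P \<longleftrightarrow> set ps \<subseteq> P" using assms(4,5) by simp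
  moreover have "distinct (map f (x # y # ps)) \<longleftrightarrow>
      f x \<notin> f ` set ps \<and> f y \<notin> f ` set ps \<and> distinct (map f ps)" using assms(3) by simp
  moreover have "f ` set (x # y # ps) = insert (f x) (insert (f y) (f ` set ps))" by simp
  ultimately show ?thesis using * by argo
qed

text \<open>The doubled \<open>{f x, f x}\<close> is the form that \<open>cycles_eq\<close> takes if
  \<open>NW\<close> and \<open>SE\<close> lie on one cycle.\<close>

lemma complement_image1:
  fixes f :: "'a \<Rightarrow> 'b"
  assumes "f x \<notin> W" "x \<in> P"
  shows "set (x # ps) \<subseteq> P \<and> distinct (map f (x # ps)) \<and> f ` set (x # ps) = {f x, f x} \<union> W
    \<longleftrightarrow> set ps \<subseteq> P \<and> distinct (map f ps) \<and> f ` set ps = W"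
proof -
  have "a \<notin> X \<and> insert a X = {a, a} \<union> W \<longleftrightarrow> X = W" if "a \<notin> W" for a :: 'b and X W
  proof
    assume *: "a \<notin> X \<and> insert a X = {a, a} \<union> W"
    then have "X = insert a X - {a}" by blast
    also have "\<dots> = ({a, a} \<union> W) - {a}" using * by simp
    also have "\<dots> = W" using that by blast
    finally show "X = W" .
  qed (use that in blast)
  note * = this[OF assms(1), of "f ` set ps"]
  have "set (x # ps) \<subseteq> P \<longleftrightarrow> set ps \<subseteq> P" using assms(2) by simp
  moreover have "distinct (map f (x # ps)) \<longleftrightarrow> f x \<notin> f ` set ps \<and> distinct (map f ps)" by simp
  moreover have "f ` set (x # ps) = insert (f x) (f ` set ps)" by simp
  ultimately show ?thesis using * by argo
qed

section \<open>Cycles through and cycles away from one crossing\<close>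

context khovanov begin

lemma node_point: "\<tau> \<in> crossings G \<Longrightarrow> Half \<tau> k \<in> points G"
  by (auto simp: points_def)

lemma conn_node:
  "conn G S (Half \<tau> k) (Half \<tau> NW) True \<or> conn G S (Half \<tau> k) (Half \<tau> SE) True"
proof -
  have "partner (vertical G S \<tau>) k \<in> {NW, SE} \<or> k \<in> {NW, SE}"
    by (cases "vertical G S \<tau>"; cases k) auto
  then show ?thesis using conn_smoothing[of G S \<tau> k] conn_refl[of G S] by auto
qed

definition agree :: "'c \<Rightarrow> 'c set \<Rightarrow> 'c set \<Rightarrow> bool" where
  "agree \<tau> S S' \<longleftrightarrow> (\<forall>c. c \<noteq> \<tau> \<longrightarrow> vertical G S c = vertical G S' c)"

definition away :: "'c \<Rightarrow> 'c set \<Rightarrow> 'c point set set" where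
  "away \<tau> S = {C \<in> cycles G S. C \<inter> range (Half \<tau>) = {}}"

lemma agree_sym: "agree \<tau> S S' \<Longrightarrow> agree \<tau> S' S"
  by (auto simp: agree_def)

lemma conn_away:
  assumes "agree \<tau> S S'" "cycle_at G S p \<inter> range (Half \<tau>) = {}"
  shows "conn G S p q e \<longleftrightarrow> conn G S' p q e"
proof
  assume "conn G S p q e"
  then show "conn G S' p q e"
    using assms travel_change_state[of G S p _ q S'] unfolding conn_def agree_def by blast
next
  assume "conn G S' p q e"
  then show "conn G S p q e"
    using assms travel_change_state'[of G S' p _ q S] unfolding conn_def agree_def by blast
qed

lemma cycle_at_away:
  assumes "agree \<tau> S S'" "cycle_at G S p \<inter> range (Half \<tau>) = {}"
  shows "cycle_at G S' p = cycle_at G S p"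
  using conn_away[OF assms] by (auto simp: mem_cycle_at_iff)

lemma away_subset: "agree \<tau> S S' \<Longrightarrow> away \<tau> S \<subseteq> away \<tau> S'"
  using cycle_at_away unfolding away_def cycles_def by fastforce

lemma away_eq: "agree \<tau> S S' \<Longrightarrow> away \<tau> S = away \<tau> S'"
  using away_subset agree_sym by blast

lemma cycle_at_meets_node:
  assumes "cycle_at G S p \<inter> range (Half \<tau>) \<noteq> {}"
  shows "cycle_at G S p = cycle_at G S (Half \<tau> NW) \<or> cycle_at G S p = cycle_at G S (Half \<tau> SE)"
proof -
  obtain k e where "conn G S p (Half \<tau> k) e" using assms by (auto simp: mem_cycle_at_iff)
  then show ?thesis using conn_node[of S \<tau> k] cycle_at_eq_iff by metis
qed

lemma cycle_at_node: "Half \<tau> k \<in> cycle_at G S (Half \<tau> k)"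
  using conn_refl by (auto simp: mem_cycle_at_iff)

lemma cycles_eq:
  assumes "\<tau> \<in> crossings G"
  shows "cycles G S = {cycle_at G S (Half \<tau> NW), cycle_at G S (Half \<tau> SE)} \<union> away \<tau> S"
    and "cycle_at G S (Half \<tau> k) \<notin> away \<tau> S"
proof -
  show "cycle_at G S (Half \<tau> k) \<notin> away \<tau> S" using cycle_at_node[of \<tau> k S] by (auto simp: away_def)
  show "cycles G S = {cycle_at G S (Half \<tau> NW), cycle_at G S (Half \<tau> SE)} \<union> away \<tau> S"
  proof (intro equalityI subsetI)
    fix C assume C: "C \<in> cycles G S"
    then obtain p where "C = cycle_at G S p" by (auto simp: cycles_def)
    then show "C \<in> {cycle_at G S (Half \<tau> NW), cycle_at G S (Half \<tau> SE)} \<union> away \<tau> S"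
      using cycle_at_meets_node[of S p \<tau>] C by (auto simp: away_def)
  next
    fix C assume "C \<in> {cycle_at G S (Half \<tau> NW), cycle_at G S (Half \<tau> SE)} \<union> away \<tau> S"
    then show "C \<in> cycles G S" using node_point[OF assms] by (auto simp: away_def cycles_def)
  qed
qed

definition away_transversal :: "'c \<Rightarrow> 'c set \<Rightarrow> 'c point list \<Rightarrow> bool" where
  "away_transversal \<tau> S ps \<longleftrightarrow> set ps \<subseteq> points G \<and> distinct (map (cycle_at G S) ps)
     \<and> cycle_at G S ` set ps = away \<tau> S"

lemma away_transversalD:
  assumes "away_transversal \<tau> S ps" "p \<in> set ps"
  shows "p \<in> points G" "cycle_at G S p \<inter> range (Half \<tau>) = {}" "cycle_at G S p \<in> away \<tau> S"
  using assms by (auto simp: away_transversal_def away_def)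

lemma away_transversal_imp:
  assumes "agree \<tau> S S'" "away_transversal \<tau> S ps"
  shows "away_transversal \<tau> S' ps"
proof -
  have "cycle_at G S' p = cycle_at G S p" if "p \<in> set ps" for p
    using cycle_at_away[OF assms(1)] away_transversalD(2)[OF assms(2) that] .
  then have "map (cycle_at G S') ps = map (cycle_at G S) ps"
    "cycle_at G S' ` set ps = cycle_at G S ` set ps" by auto
  then show ?thesis using assms(2) away_eq[OF assms(1)]
    by (simp add: away_transversal_def del: map_eq_conv)
qed

lemma transversal_node2:
  assumes "\<tau> \<in> crossings G" "cycle_at G S (Half \<tau> NW) \<noteq> cycle_at G S (Half \<tau> SE)"
  shows "transversal S (Half \<tau> NW # Half \<tau> SE # ps) \<longleftrightarrow> away_transversal \<tau> S ps"
  unfolding transversal_def away_transversal_def cycles_eq(1)[OF assms(1)]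
  using cycles_eq(2)[OF assms(1)] assms(2) node_point[OF assms(1)] by (intro complement_image2)

lemma transversal_node1:
  assumes "\<tau> \<in> crossings G" "cycle_at G S (Half \<tau> NW) = cycle_at G S (Half \<tau> SE)"
  shows "transversal S (Half \<tau> NW # ps) \<longleftrightarrow> away_transversal \<tau> S ps"
  unfolding transversal_def away_transversal_def cycles_eq(1)[OF assms(1)] assms(2)[symmetric]
  using cycles_eq(2)[OF assms(1)] node_point[OF assms(1)] by (intro complement_image1)

text \<open>\<open>cuts\<close> minimises over all four half-edges of the crossing, so there is no
  control over the end at which the minimum is attained. Each of the four is \<open>NW\<close> or
  \<open>SE\<close> or is joined to one of them by the smoothing, without cut loci; the first
  assumption makes \<open>NW\<close> and \<open>SE\<close> interchangeable.\<close>

lemma even_cuts_node: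
  assumes "\<And>e. conn G S (Half \<tau> NW) (Half \<tau> SE) e \<Longrightarrow> e"
    and "p \<in> points G" "x \<in> {Half \<tau> NW, Half \<tau> SE}" "conn G S p x e"
  shows "even (cuts G S {p} (range (Half \<tau>))) = e" "even (cuts G S (range (Half \<tau>)) {p}) = e"
proof -
  have *: "e' = e" if "conn G S p (Half \<tau> k) e'" for k e'
  proof -
    obtain y where y: "y \<in> {Half \<tau> NW, Half \<tau> SE}" "conn G S (Half \<tau> k) y True"
      using conn_node by blast
    have py: "conn G S p y e'" using conn_trans[OF that y(2)] by simp
    have "conn G S x y (e = e')" using conn_trans[OF conn_sym[OF assms(4)] py] by (simp add: eq_commute)
    moreover have "conn G S y x (e = e')" using conn_sym calculation by blast
    moreover have "x = y \<Longrightarrow> e = e'" using conn_unique[OF assms(2,4)] py by blast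
    ultimately have "e = e'" using y(1) assms(1,3) by auto
    then show ?thesis by simp
  qed
  obtain n where n: "travel G S p n x" using assms(4) by (auto simp: conn_def)
  have x: "x \<in> range (Half \<tau>)" using assms(3) by auto
  have "\<exists>p'\<in>{p}. \<exists>q\<in>range (Half \<tau>). travel G S p' (cuts G S {p} (range (Half \<tau>))) q"
    by (rule travel_cuts[OF singletonI x n])
  then show "even (cuts G S {p} (range (Half \<tau>))) = e" using * by (auto simp: conn_def)
  have "\<exists>q\<in>range (Half \<tau>). \<exists>p'\<in>{p}. travel G S q (cuts G S (range (Half \<tau>)) {p}) p'"
    by (rule travel_cuts[OF x singletonI travel_sym[OF n]])
  then show "even (cuts G S (range (Half \<tau>)) {p}) = e" using * travel_sym by (fastforce simp: conn_def)
qed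

lemma mark_sign_node:
  assumes "S \<subseteq> crossings G" "\<tau> \<in> crossings G" "\<And>e. conn G S (Half \<tau> NW) (Half \<tau> SE) e \<Longrightarrow> e"
    and "h \<in> {Half \<tau> NW, Half \<tau> SE}" "C = cycle_at G S h"
  shows "bar_sign (cuts G S {mark S C} (range (Half \<tau>))) g = mark_sign S (h, g)"
    "bar_sign (cuts G S (range (Half \<tau>)) {mark S C}) g = mark_sign S (h, g)"
proof -
  have "h \<in> points G" using assms(2,4) node_point by auto
  then obtain e where e: "conn G S (mark S C) h e" "mark S C \<in> points G"
    using conn_mark[OF assms(1)] assms(5) by metis
  note even_cuts_node[OF assms(3) e(2) assms(4) e(1)] even_cuts[OF e(2,1)]
  then show "bar_sign (cuts G S {mark S C} (range (Half \<tau>))) g = mark_sign S (h, g)"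
    "bar_sign (cuts G S (range (Half \<tau>)) {mark S C}) g = mark_sign S (h, g)"
    unfolding mark_sign_def using assms(5) by (auto intro!: bar_sign_cong)
qed

text \<open>A cycle away from \<open>\<tau>\<close> may be marked differently in the two states. The
  bars put on it after the surgery are just the change of coordinates between the two marks.\<close>

lemma mark_sign_away:
  assumes "S \<subseteq> crossings G" "S' \<subseteq> crossings G" "agree \<tau> S S'"
    and "p \<in> points G" "cycle_at G S p \<inter> range (Half \<tau>) = {}"
  shows "mark_sign S' (p, g) * bar_sign (cuts G S' {mark S (cycle_at G S p)} {mark S' (cycle_at G S p)}) g
    = mark_sign S (p, g)"
proof -
  let ?C = "cycle_at G S p"
  have C: "cycle_at G S' p = ?C" using cycle_at_away[OF assms(3,5)] .
  obtain e where e: "conn G S (mark S ?C) p e" "mark S ?C \<in> points G"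
    using conn_mark[OF assms(1,4)] .
  obtain e' where e': "conn G S' (mark S' ?C) p e'" "mark S' ?C \<in> points G"
    using conn_mark[OF assms(2,4)] C by metis
  have "cycle_at G S (mark S ?C) = ?C" using e(1) cycle_at_eq_iff by blast
  then have e1: "conn G S' (mark S ?C) p e" using conn_away[OF assms(3)] assms(5) e(1) by metis
  have "conn G S' (mark S ?C) (mark S' ?C) (e = e')" using conn_trans[OF e1 conn_sym[OF e'(1)]] .
  from even_cuts[OF e(2) this] even_cuts[OF e(2,1)] even_cuts[OF e'(2,1)]
  show ?thesis unfolding mark_sign_def by (auto simp: bar_sign_def C)
qed

lemma cycles_through_eq:
  "cycles_through G S \<tau> = remdups [cycle_at G S (Half \<tau> NW), cycle_at G S (Half \<tau> SE)]"
proof -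
  have "cycle_at G S (Half \<tau> SW) = cycle_at G S (Half \<tau> NW)" if "vertical G S \<tau>"
    using conn_smoothing[of G S \<tau> SW] that cycle_at_eq_iff by force
  then show ?thesis unfolding cycles_through_def by simp
qed

end

lemma prod_list_mset_cong:
  fixes f :: "'a \<Rightarrow> 'b::comm_monoid_mult"
  assumes "mset xs = mset ys"
  shows "prod_list (map f xs) = prod_list (map f ys)"
  using assms by (metis mset_map prod_mset_prod_list)

lemma prod_list_map_mult:
  fixes f g :: "'a \<Rightarrow> 'b::comm_monoid_mult"
  shows "prod_list (map f xs) * prod_list (map g xs) = prod_list (map (\<lambda>x. f x * g x) xs)"
  by (induction xs) (auto simp: mult_ac)

lemma map2_map_map: "map2 h (map f xs) (map g xs) = map (\<lambda>x. h (f x) (g x)) xs"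
  by (induction xs) auto

lemma mult_square_1:
  fixes a b :: "'k::comm_ring_1"
  assumes "a * a = 1" "b * b = 1"
  shows "a * b * (a * b) = 1"
proof -
  have "a * b * (a * b) = (a * a) * (b * b)" by (simp only: mult_ac)
  then show ?thesis by (simp add: assms)
qed

lemma Un_doubleton_Diff: "a \<notin> W \<Longrightarrow> b \<notin> W \<Longrightarrow> {a, b} \<union> W - {a, b} = W"
  by blast

context khovanov begin

lemma length_ord: "S \<subseteq> crossings G \<Longrightarrow> length (ord S) = card (cycles G S)"
  using distinct_card[OF distinct_ord] set_ord by metis

lemma chain_space_iff: "S \<subseteq> crossings G \<Longrightarrow> v \<in> chain_space G S \<longleftrightarrow> homogeneous (length (ord S)) v"
  by (auto simp: chain_space_def homogeneous_def length_ord)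

text \<open>\<open>T\<close> is the source or the target of a differential at \<open>\<tau>\<close>.
  \<open>H\<close> holds the labels of the cycles through \<open>\<tau>\<close>, at
  \<open>NW\<close> or \<open>SE\<close>; \<open>L\<close> holds those of the other cycles, at
  arbitrary points, and \<open>rest\<close> is another listing of these other cycles.
  \<open>consistent\<close> is what \<open>even_cuts_node\<close> asks for.\<close>

context
  fixes T :: "'c set" and \<tau> :: 'c and H L :: "('c point \<times> gen) list" and rest :: "'c point set list"
    and \<gamma> :: "'c point set \<Rightarrow> gen"
  assumes T: "T \<subseteq> crossings G" and \<tau>: "\<tau> \<in> crossings G"
    and consistent: "\<And>e. conn G T (Half \<tau> NW) (Half \<tau> SE) e \<Longrightarrow> e"
    and H: "fst ` set H \<subseteq> {Half \<tau> NW, Half \<tau> SE}"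
    and tr: "transversal T (map fst (H @ L))" and L: "away_transversal \<tau> T (map fst L)"
    and rest: "distinct rest" "set rest = away \<tau> T"
    and \<gamma>: "\<And>p g. (p, g) \<in> set L \<Longrightarrow> \<gamma> (cycle_at G T p) = g"
begin

abbreviation (input) "cyc \<equiv> cycle_at G T \<circ> fst"

lemma transversal_facts:
  shows "distinct (map cyc H @ map cyc L)" "set (map cyc H @ map cyc L) = set (ord T)"
    "distinct (map cyc H @ rest)" "set (map cyc H @ rest) = set (ord T)"
    "set (map cyc L) = set rest" "mset (map cyc L) = mset rest"
proof -
  show 1: "distinct (map cyc H @ map cyc L)" and 2: "set (map cyc H @ map cyc L) = set (ord T)"
    using transversal_cycles[OF tr T] by (simp_all add: comp_def)
  show 3: "set (map cyc L) = set rest"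
    using L rest(2) by (simp add: away_transversal_def image_comp)
  show "distinct (map cyc H @ rest)" using 1 rest(1) by (simp only: distinct_append 3)
  show "set (map cyc H @ rest) = set (ord T)" using 2 by (simp only: set_append 3)
  have "distinct (map cyc L)" using 1 by simp
  then show "mset (map cyc L) = mset rest" using 3 rest(1) set_eq_iff_mset_eq_distinct by blast
qed

definition "\<delta> = label T (H @ L)"

lemma label_facts:
  shows "\<And>p g. (p, g) \<in> set (H @ L) \<Longrightarrow> \<delta> (cycle_at G T p) = g"
    "map \<delta> (map cyc H) = map snd H" "map \<delta> rest = map \<gamma> rest"
proof -
  show *: "\<And>p g. (p, g) \<in> set (H @ L) \<Longrightarrow> \<delta> (cycle_at G T p) = g"
    unfolding \<delta>_def by (rule label_eq) (use transversal_facts(1) in simp_all)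
  then show "map \<delta> (map cyc H) = map snd H" by auto
  have "\<delta> C = \<gamma> C" if "C \<in> set rest" for C
  proof -
    have "C \<in> cyc ` set L" using that transversal_facts(5) by simp
    then obtain p g where "(p, g) \<in> set L" "C = cycle_at G T p" by auto
    then show ?thesis using *[of p g] \<gamma>[of p g] by simp
  qed
  then show "map \<delta> rest = map \<gamma> rest" by simp
qed

lemma coord_eq': "coord T v (H @ L) =
    of_int (reorder_sign (map cyc H @ map cyc L) (ord T)) *
    (prod_list (map (mark_sign T) H) * prod_list (map (mark_sign T) L)) *
    Poly_Mapping.lookup v (map \<delta> (ord T))"
  using coord_eq[of T "H @ L" \<delta> v, OF T tr] label_facts(1) by simp

text \<open>Both lists begin with \<open>map cyc H\<close>, so the remaining sign only concerns the
  cycles away from \<open>\<tau>\<close>. It is therefore the same before and after the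
  surgery.\<close>

lemma reorder_sign_rest:
  "reorder_sign (map cyc H @ map cyc L) (ord T) * reorder_sign (map cyc H @ rest) (ord T)
    = reorder_sign (map cyc L) rest"
proof -
  note f = transversal_facts
  have "reorder_sign (map cyc H @ rest) (ord T) = reorder_sign (ord T) (map cyc H @ rest)"
    by (rule reorder_sign_sym[OF f(3) distinct_ord[OF T] f(4)])
  moreover have "reorder_sign (map cyc H @ map cyc L) (ord T) * reorder_sign (ord T) (map cyc H @ rest)
      = reorder_sign (map cyc H @ map cyc L) (map cyc H @ rest)"
    by (rule reorder_sign_trans[OF f(1) distinct_ord[OF T] f(3) f(2) f(4)[symmetric]])
  moreover have "\<dots> = reorder_sign (map cyc L) rest"
    by (rule reorder_sign_append[OF f(1,3,5)])
  ultimately show ?thesis by simp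
qed

text \<open>For the target \<open>T\<close>: the bars at the crossing cancel the mark signs of
  \<open>H\<close>, and those on the other cycles turn the mark signs of \<open>T\<close> into the
  ones of the source \<open>S\<close>. So the factor left over is the one that
  \<open>lookup_bars_reorder\<close> yields for \<open>S\<close>.\<close>

lemma coord_reorder_bars:
  fixes Z :: "'k::comm_ring_1 tensor"
  assumes S: "S \<subseteq> crossings G" and agree: "agree \<tau> S T"
  shows "coord T (reorder (map cyc H @ rest) (ord T)
      (bars (map (\<lambda>C. cuts G T (range (Half \<tau>)) {mark T C}) (map cyc H)
        @ map (\<lambda>C. cuts G T {mark S C} {mark T C}) rest) Z)) (H @ L) =
    of_int (reorder_sign (map cyc L) rest) * prod_list (map (mark_sign S) L) *
      Poly_Mapping.lookup Z (map snd H @ map \<gamma> rest)" (is "coord T (reorder _ _ (bars ?post Z)) _ = _")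
proof -
  note f = transversal_facts and l = label_facts
  let ?b = "\<lambda>C. cuts G T {mark S C} {mark T C}"
  have h: "homogeneous (length (map cyc H @ rest)) (bars ?post Z)"
    using homogeneous_bars[of ?post Z] by simp
  have e1: "Poly_Mapping.lookup (reorder (map cyc H @ rest) (ord T) (bars ?post Z)) (map \<delta> (ord T)) =
      of_int (reorder_sign (map cyc H @ rest) (ord T)) * Poly_Mapping.lookup (bars ?post Z) (map \<delta> (map cyc H @ rest))"
    by (rule lookup_reorder[OF f(3) distinct_ord[OF T] f(4) h])
  have e2: "Poly_Mapping.lookup (bars ?post Z) (map \<delta> (map cyc H @ rest)) =
      prod_list (map2 bar_sign ?post (map \<delta> (map cyc H @ rest))) *
      Poly_Mapping.lookup Z (map \<delta> (map cyc H @ rest))"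
    by (rule lookup_bars) simp
  have e3: "prod_list (map2 bar_sign ?post (map \<delta> (map cyc H @ rest))) =
      (prod_list (map (mark_sign T) H) * prod_list (map (\<lambda>C. bar_sign (?b C) (\<delta> C)) rest) :: 'k)"
  proof -
    have e: "(map (mark_sign T) H :: 'k list) = map2 bar_sign (map (\<lambda>C. cuts G T (range (Half \<tau>)) {mark T C}) (map cyc H)) (map \<delta> (map cyc H))"
      unfolding map_map map2_map_map
    proof (rule map_cong[OF refl])
      fix x assume x: "x \<in> set H"
      obtain h g where hg: "x = (h, g)" "h \<in> {Half \<tau> NW, Half \<tau> SE}"
        using subsetD[OF H imageI[OF x]] by (cases x) simp
      have "\<delta> (cycle_at G T h) = g" using l(1)[of h g] x hg(1) by simp
      then show "(mark_sign T x :: 'k) = bar_sign (((\<lambda>C. cuts G T (range (Half \<tau>)) {mark T C}) \<circ> cyc) x) ((\<delta> \<circ> cyc) x)"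
        by (simp add: mark_sign_node(2)[OF T \<tau> consistent hg(2) refl, of g] hg(1))
    qed
    show ?thesis unfolding e by (simp add: map2_map_map[of _ _ rest] del: map_map)
  qed
  have e4: "prod_list (map (\<lambda>C. bar_sign (?b C) (\<delta> C)) rest) =
      (prod_list (map (\<lambda>x. bar_sign (?b (cyc x)) (snd x)) L) :: 'k)"
  proof -
    have "prod_list (map (\<lambda>C. bar_sign (?b C) (\<delta> C)) rest) =
        (prod_list (map (\<lambda>C. bar_sign (?b C) (\<delta> C)) (map cyc L)) :: 'k)"
      by (rule prod_list_mset_cong) (use f(6) in simp)
    also have "map (\<lambda>C. bar_sign (?b C) (\<delta> C)) (map cyc L) = (map (\<lambda>x. bar_sign (?b (cyc x)) (snd x)) L :: 'k list)"
    proof -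
      have "\<delta> (cyc x) = snd x" if "x \<in> set L" for x using l(1)[of "fst x" "snd x"] that by simp
      then show ?thesis by simp
    qed
    finally show ?thesis .
  qed
  have e5: "prod_list (map (mark_sign T) L) * prod_list (map (\<lambda>x. bar_sign (?b (cyc x)) (snd x)) L) =
      (prod_list (map (mark_sign S) L) :: 'k)"
  proof -
    have "mark_sign T x * bar_sign (?b (cyc x)) (snd x) = (mark_sign S x :: 'k)" if x: "x \<in> set L" for x
    proof -
      have p: "fst x \<in> set (map fst L)" using x by simp
      note d = away_transversalD(1,2)[OF L p]
      have c: "cycle_at G S (fst x) = cycle_at G T (fst x)"
        using cycle_at_away[OF agree_sym[OF agree] d(2)] .
      show ?thesis
        using d(2) unfolding comp_apply
        by (intro mark_sign_away[OF S T agree d(1), of "snd x", unfolded c prod.collapse])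
    qed
    then show ?thesis unfolding prod_list_map_mult by (metis (no_types, lifting) map_cong)
  qed
  have "coord T (reorder (map cyc H @ rest) (ord T) (bars ?post Z)) (H @ L) =
    of_int (reorder_sign (map cyc H @ map cyc L) (ord T) * reorder_sign (map cyc H @ rest) (ord T))
     * (prod_list (map (mark_sign T) H) * prod_list (map (mark_sign T) H))
     * prod_list (map (mark_sign S) L) * Poly_Mapping.lookup Z (map \<delta> (map cyc H @ rest))"
    unfolding coord_eq' e1 e2 e3 e4 e5[symmetric] of_int_mult by (simp only: mult_ac)
  then show ?thesis
    by (simp only: prod_mark_sign_square reorder_sign_rest mult_1_right map_append l(2,3))
qed

text \<open>For the source \<open>T\<close>: reordering and bars amount to taking coordinates that
  begin at the half-edges in \<open>H\<close>, up to a factor from the cycles away from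
  \<open>\<tau>\<close>.\<close>

lemma lookup_bars_reorder:
  fixes v :: "'k::comm_ring_1 tensor"
  assumes v: "homogeneous (length (ord T)) v"
  shows "Poly_Mapping.lookup (bars (map (\<lambda>C. cuts G T {mark T C} (range (Half \<tau>))) (map cyc H) @ map (\<lambda>C. 0) rest)
      (reorder (ord T) (map cyc H @ rest) v)) (map snd H @ map \<gamma> rest) =
    of_int (reorder_sign (map cyc L) rest) * prod_list (map (mark_sign T) L) * coord T v (H @ L)"
    (is "Poly_Mapping.lookup (bars ?pre _) _ = _")
proof -
  note f = transversal_facts and l = label_facts
  have e1: "Poly_Mapping.lookup (bars ?pre (reorder (ord T) (map cyc H @ rest) v)) (map \<delta> (map cyc H @ rest)) =
     prod_list (map2 bar_sign ?pre (map \<delta> (map cyc H @ rest))) *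
     Poly_Mapping.lookup (reorder (ord T) (map cyc H @ rest) v) (map \<delta> (map cyc H @ rest))"
    by (rule lookup_bars) simp
  have e2: "prod_list (map2 bar_sign ?pre (map \<delta> (map cyc H @ rest))) = (prod_list (map (mark_sign T) H) :: 'k)"
  proof -
    have e: "(map (mark_sign T) H :: 'k list) = map2 bar_sign (map (\<lambda>C. cuts G T {mark T C} (range (Half \<tau>))) (map cyc H)) (map \<delta> (map cyc H))"
      unfolding map_map map2_map_map
    proof (rule map_cong[OF refl])
      fix x assume x: "x \<in> set H"
      obtain h g where hg: "x = (h, g)" "h \<in> {Half \<tau> NW, Half \<tau> SE}"
        using subsetD[OF H imageI[OF x]] by (cases x) simp
      have "\<delta> (cycle_at G T h) = g" using l(1)[of h g] x hg(1) by simp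
      then show "(mark_sign T x :: 'k) = bar_sign (((\<lambda>C. cuts G T {mark T C} (range (Half \<tau>))) \<circ> cyc) x) ((\<delta> \<circ> cyc) x)"
        by (simp add: mark_sign_node(1)[OF T \<tau> consistent hg(2) refl, of g] hg(1))
    qed
    have "prod_list (map2 bar_sign (map (\<lambda>C. 0) rest) (map \<delta> rest)) = (1 :: 'k)"
      unfolding map2_map_map by (induction rest) (simp_all add: bar_sign_def)
    then show ?thesis unfolding e by (simp del: map_map)
  qed
  have e3: "Poly_Mapping.lookup (reorder (ord T) (map cyc H @ rest) v) (map \<delta> (map cyc H @ rest)) =
      of_int (reorder_sign (ord T) (map cyc H @ rest)) * Poly_Mapping.lookup v (map \<delta> (ord T))"
    by (rule lookup_reorder[OF distinct_ord[OF T] f(3) f(4)[symmetric] v])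
  have e4: "reorder_sign (ord T) (map cyc H @ rest) =
      reorder_sign (map cyc L) rest * reorder_sign (map cyc H @ map cyc L) (ord T)"
  proof -
    have "reorder_sign (ord T) (map cyc H @ rest) = reorder_sign (map cyc H @ rest) (ord T)"
      by (rule reorder_sign_sym[OF distinct_ord[OF T] f(3) f(4)[symmetric]])
    then show ?thesis
      unfolding reorder_sign_rest[symmetric] by (simp add: reorder_sign_def)
  qed
  have "Poly_Mapping.lookup (bars ?pre (reorder (ord T) (map cyc H @ rest) v)) (map \<delta> (map cyc H @ rest)) =
    of_int (reorder_sign (map cyc L) rest * reorder_sign (map cyc H @ map cyc L) (ord T))
      * prod_list (map (mark_sign T) H) * Poly_Mapping.lookup v (map \<delta> (ord T))"
    unfolding e1 e2 e3 e4 of_int_mult by (simp only: mult_ac)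
  \<comment> \<open>One copy of the inserted square completes the mark signs of \<open>H\<close> to
    those of \<open>H @ L\<close>; the other copy belongs to the factor.\<close>
  also have "\<dots> = of_int (reorder_sign (map cyc L) rest) * (prod_list (map (mark_sign T) L) * prod_list (map (mark_sign T) L))
      * of_int (reorder_sign (map cyc H @ map cyc L) (ord T))
      * prod_list (map (mark_sign T) H) * Poly_Mapping.lookup v (map \<delta> (ord T))"
    by (simp only: prod_mark_sign_square) simp
  also have "\<dots> = of_int (reorder_sign (map cyc L) rest) * prod_list (map (mark_sign T) L) * coord T v (H @ L)"
    unfolding coord_eq' by (simp only: mult_ac)
  finally show ?thesis by (simp only: map_append l(2,3))
qed

end

text \<open>Besides the number of cycles, this asks for evenness in the state in which
  \<open>NW\<close> and \<open>SE\<close> share a cycle. That every surgery of a face falls under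
  \<open>merges\<close>, \<open>splits\<close> or \<open>one_to_one\<close> is later read off its
  tables.\<close>

definition merges :: "'c set \<Rightarrow> 'c \<Rightarrow> bool" where
  "merges S \<tau> \<longleftrightarrow> cycle_at G S (Half \<tau> NW) \<noteq> cycle_at G S (Half \<tau> SE)
     \<and> conn G (insert \<tau> S) (Half \<tau> NW) (Half \<tau> SE) True"

definition splits :: "'c set \<Rightarrow> 'c \<Rightarrow> bool" where
  "splits S \<tau> \<longleftrightarrow> cycle_at G (insert \<tau> S) (Half \<tau> NW) \<noteq> cycle_at G (insert \<tau> S) (Half \<tau> SE)
     \<and> conn G S (Half \<tau> NW) (Half \<tau> SE) True"

definition one_to_one :: "'c set \<Rightarrow> 'c \<Rightarrow> bool" where
  "one_to_one S \<tau> \<longleftrightarrow> cycle_at G S (Half \<tau> NW) = cycle_at G S (Half \<tau> SE)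
     \<and> cycle_at G (insert \<tau> S) (Half \<tau> NW) = cycle_at G (insert \<tau> S) (Half \<tau> SE)"

abbreviation "diff S \<tau> \<equiv> partial_differential G ord mark S \<tau>"

lemma agree_insert: "agree \<tau> S (insert \<tau> S)"
  by (auto simp: agree_def vertical_def)

lemma filter_rest:
  assumes "S \<subseteq> crossings G" "\<tau> \<in> crossings G"
  defines "rest \<equiv> filter (\<lambda>C. C \<notin> set (cycles_through G S \<tau>)) (ord S)"
  shows "distinct rest" "set rest = away \<tau> S" "set rest = away \<tau> (insert \<tau> S)"
proof -
  show "distinct rest" unfolding rest_def using distinct_ord[OF assms(1)] by simp
  have "set rest = set (ord S) - set (cycles_through G S \<tau>)"
    unfolding rest_def by (simp add: set_diff_eq)
  also have "\<dots> = {cycle_at G S (Half \<tau> NW), cycle_at G S (Half \<tau> SE)} \<union> away \<tau> S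
      - {cycle_at G S (Half \<tau> NW), cycle_at G S (Half \<tau> SE)}"
    by (simp only: set_ord[OF assms(1)] cycles_eq(1)[OF assms(2)] cycles_through_eq set_remdups list.set)
  also have "\<dots> = away \<tau> S"
    by (rule Un_doubleton_Diff) (rule cycles_eq(2)[OF assms(2)])+
  finally show "set rest = away \<tau> S" .
  then show "set rest = away \<tau> (insert \<tau> S)" using away_eq[OF agree_insert] by simp
qed

lemma partial_merges:
  assumes "merges S \<tau>"
  shows "diff S \<tau> v =
    (let a = cycle_at G S (Half \<tau> NW); b = cycle_at G S (Half \<tau> SE);
         a' = cycle_at G (insert \<tau> S) (Half \<tau> NW); t = range (Half \<tau>);
         rest = filter (\<lambda>C. C \<notin> set (cycles_through G S \<tau>)) (ord S)
     in reorder ([a'] @ rest) (ord (insert \<tau> S))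
      (bars (map (\<lambda>C. cuts G (insert \<tau> S) t {mark (insert \<tau> S) C}) [a']
          @ map (\<lambda>C. cuts G (insert \<tau> S) {mark S C} {mark (insert \<tau> S) C}) rest)
        (mult_first (bars (map (\<lambda>C. cuts G S {mark S C} t) [a, b] @ map (\<lambda>C. 0) rest)
          (reorder (ord S) ([a, b] @ rest) v)))))"
proof -
  have "cycle_at G (insert \<tau> S) (Half \<tau> NW) = cycle_at G (insert \<tau> S) (Half \<tau> SE)"
    using assms by (auto simp: merges_def cycle_at_eq_iff)
  then show ?thesis using assms
    by (simp add: merges_def partial_differential_def cycles_through_eq Let_def)
qed

lemma partial_splits:
  assumes "splits S \<tau>"
  shows "diff S \<tau> v =
    (let a = cycle_at G S (Half \<tau> NW); a' = cycle_at G (insert \<tau> S) (Half \<tau> NW);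
         b' = cycle_at G (insert \<tau> S) (Half \<tau> SE); t = range (Half \<tau>);
         rest = filter (\<lambda>C. C \<notin> set (cycles_through G S \<tau>)) (ord S)
     in reorder ([a', b'] @ rest) (ord (insert \<tau> S))
      (bars (map (\<lambda>C. cuts G (insert \<tau> S) t {mark (insert \<tau> S) C}) [a', b']
          @ map (\<lambda>C. cuts G (insert \<tau> S) {mark S C} {mark (insert \<tau> S) C}) rest)
        (comult_first (bars (map (\<lambda>C. cuts G S {mark S C} t) [a] @ map (\<lambda>C. 0) rest)
          (reorder (ord S) ([a] @ rest) v)))))"
proof -
  have "cycle_at G S (Half \<tau> NW) = cycle_at G S (Half \<tau> SE)"
    using assms by (auto simp: splits_def cycle_at_eq_iff)
  then show ?thesis using assms
    by (simp add: splits_def partial_differential_def cycles_through_eq Let_def)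
qed

lemma partial_one_to_one: "one_to_one S \<tau> \<Longrightarrow> diff S \<tau> v = 0"
  by (simp add: one_to_one_def partial_differential_def cycles_through_eq Let_def)

context
  fixes S :: "'c set" and \<tau> :: 'c
  assumes S: "S \<subseteq> crossings G" and \<tau>: "\<tau> \<in> crossings G"
begin

lemma S': "insert \<tau> S \<subseteq> crossings G"
  using S \<tau> by simp

lemma conn_consistent:
  assumes "conn G T (Half \<tau> NW) (Half \<tau> SE) True \<or> cycle_at G T (Half \<tau> NW) \<noteq> cycle_at G T (Half \<tau> SE)"
    and "conn G T (Half \<tau> NW) (Half \<tau> SE) e"
  shows e
proof -
  have "conn G T (Half \<tau> NW) (Half \<tau> SE) True" using assms cycle_at_eq_iff by metis
  then show e using conn_unique[OF node_point[OF \<tau>] _ assms(2)] by blast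
qed

lemma partial_chain_space:
  assumes "merges S \<tau> \<or> splits S \<tau> \<or> one_to_one S \<tau>"
  shows "diff S \<tau> v \<in> chain_space G (insert \<tau> S)"
proof -
  note r = filter_rest[OF S \<tau>]
  note c = cycles_eq[OF \<tau>, of "insert \<tau> S"] set_ord[OF S'] distinct_ord[OF S']
  let ?rest = "filter (\<lambda>C. C \<notin> set (cycles_through G S \<tau>)) (ord S)"
  \<comment> \<open>The degree can be read off \<open>ns\<close>, because \<open>bars ns\<close>
    kills all words of other lengths.\<close>
  have hom: "homogeneous (length (ord (insert \<tau> S))) (reorder xs ys (bars ns w))"
    if "length ns = length (zs @ ?rest)" "distinct zs" "set zs = set (cycles_through G (insert \<tau> S) \<tau>)"
    for xs ys ns zs and w :: "'b::comm_ring_1 tensor"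
  proof -
    have "distinct (zs @ ?rest)" "set (zs @ ?rest) = set (ord (insert \<tau> S))"
      using that r c by (auto simp: cycles_through_eq)
    then have "length (zs @ ?rest) = length (ord (insert \<tau> S))"
      using distinct_card[of "zs @ ?rest"] distinct_card[OF c(4)] by simp
    then show ?thesis using homogeneous_reorder[OF homogeneous_bars[of ns w]] that(1) by simp
  qed
  from assms show ?thesis
  proof (elim disjE)
    assume m: "merges S \<tau>"
    then have "cycle_at G (insert \<tau> S) (Half \<tau> NW) = cycle_at G (insert \<tau> S) (Half \<tau> SE)"
      by (auto simp: merges_def cycle_at_eq_iff)
    then show ?thesis unfolding partial_merges[OF m] chain_space_iff[OF S'] Let_def
      by (intro hom[of _ "[cycle_at G (insert \<tau> S) (Half \<tau> NW)]"]) (simp_all add: cycles_through_eq)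
  next
    assume m: "splits S \<tau>"
    then show ?thesis unfolding partial_splits[OF m] chain_space_iff[OF S'] Let_def
      by (intro hom[of _ "[cycle_at G (insert \<tau> S) (Half \<tau> NW), cycle_at G (insert \<tau> S) (Half \<tau> SE)]"])
        (auto simp: splits_def cycles_through_eq)
  next
    assume "one_to_one S \<tau>"
    then show ?thesis unfolding chain_space_iff[OF S'] by (simp add: partial_one_to_one)
  qed
qed

text \<open>The factor \<open>s\<close> of the cycles away from \<open>\<tau>\<close> enters once
  before and once after the surgery, and its square is 1. The tail \<open>L\<close> is arbitrary: if
  it is no transversal of these cycles, both sides are 0 by convention.\<close>

lemma coord_partial_merges:
  fixes v :: "'k::comm_ring_1 tensor"
  assumes v: "v \<in> chain_space G S" and m: "merges S \<tau>"
  shows "coord (insert \<tau> S) (diff S \<tau> v) ((Half \<tau> NW, g) # L) = (case g of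
      One_V \<Rightarrow> coord S v ((Half \<tau> NW, One_V) # (Half \<tau> SE, One_V) # L)
    | X_V \<Rightarrow> coord S v ((Half \<tau> NW, One_V) # (Half \<tau> SE, X_V) # L)
        + coord S v ((Half \<tau> NW, X_V) # (Half \<tau> SE, One_V) # L))"
proof -
  let ?S' = "insert \<tau> S"
  have hv: "homogeneous (length (ord S)) v" using v by (simp only: chain_space_iff[OF S])
  have ne: "cycle_at G S (Half \<tau> NW) \<noteq> cycle_at G S (Half \<tau> SE)"
    and eq: "cycle_at G ?S' (Half \<tau> NW) = cycle_at G ?S' (Half \<tau> SE)"
    using m by (auto simp: merges_def cycle_at_eq_iff)
  have con: "\<And>e. conn G S (Half \<tau> NW) (Half \<tau> SE) e \<Longrightarrow> e"
    "\<And>e. conn G ?S' (Half \<tau> NW) (Half \<tau> SE) e \<Longrightarrow> e"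
    using conn_consistent[of S] conn_consistent[of ?S'] m by (auto simp: merges_def)
  show ?thesis
  proof (cases "away_transversal \<tau> S (map fst L)")
    case True
    then have True': "away_transversal \<tau> ?S' (map fst L)" using away_transversal_imp[OF agree_insert] by blast
    let ?rest = "filter (\<lambda>C. C \<notin> set (cycles_through G S \<tau>)) (ord S)"
    note r = filter_rest[OF S \<tau>]
    define \<gamma> where "\<gamma> = label S L"
    have L: "cycle_at G ?S' (fst x) = cycle_at G S (fst x)" if "x \<in> set L" for x
      using cycle_at_away[OF agree_insert] away_transversalD(2)[OF True, of "fst x"] that by simp
    have \<gamma>: "\<gamma> (cycle_at G S p) = g" if "(p, g) \<in> set L" for p g
      unfolding \<gamma>_def by (rule label_eq[OF _ that]) (use True in \<open>simp add: away_transversal_def\<close>)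
    have \<gamma>': "\<gamma> (cycle_at G ?S' p) = g" if "(p, g) \<in> set L" for p g
      using \<gamma>[OF that] L[OF that] by simp
    have cyc: "map (cycle_at G ?S' \<circ> fst) L = map (cycle_at G S \<circ> fst) L" using L by simp
    define Y where "Y = bars (map (\<lambda>C. cuts G S {mark S C} (range (Half \<tau>)))
        [cycle_at G S (Half \<tau> NW), cycle_at G S (Half \<tau> SE)] @ map (\<lambda>C. 0) ?rest)
          (reorder (ord S) ([cycle_at G S (Half \<tau> NW), cycle_at G S (Half \<tau> SE)] @ ?rest) v)"
    define s where "s = (of_int (reorder_sign (map (cycle_at G S \<circ> fst) L) ?rest) * prod_list (map (mark_sign S) L) :: 'k)"
    have s: "s * s = 1"
      unfolding s_def by (rule mult_square_1[OF of_int_reorder_sign_square prod_mark_sign_square])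
    have Y: "Poly_Mapping.lookup Y (g1 # g2 # map \<gamma> ?rest) = s * coord S v ((Half \<tau> NW, g1) # (Half \<tau> SE, g2) # L)" for g1 g2
      using lookup_bars_reorder[where T = S and H = "[(Half \<tau> NW, g1), (Half \<tau> SE, g2)]"
          and L = L and \<gamma> = \<gamma> and rest = ?rest and v = v, OF S \<tau> con(1) _ _ True r(1,2) \<gamma> hv]
        True transversal_node2[OF \<tau> ne]
      by (simp add: Y_def s_def)
    have "coord ?S' (diff S \<tau> v) ((Half \<tau> NW, g) # L) = s * Poly_Mapping.lookup (mult_first Y) (g # map \<gamma> ?rest)"
      using coord_reorder_bars[where T = ?S' and H = "[(Half \<tau> NW, g)]" and L = L and \<gamma> = \<gamma>
          and rest = ?rest and Z = "mult_first Y", OF S' \<tau> con(2) _ _ True' r(1,3) \<gamma>' S agree_insert]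
        True' transversal_node1[OF \<tau> eq] cyc
      by (simp add: partial_merges[OF m] Y_def s_def Let_def)
    then show ?thesis
      by (cases g) (simp_all add: lookup_mult_first Y distrib_left s flip: mult.assoc)
  next
    case False
    then have "\<not> away_transversal \<tau> ?S' (map fst L)"
      using away_transversal_imp[OF agree_sym[OF agree_insert]] by blast
    then show ?thesis using False
      by (cases g) (simp_all add: coord_def transversal_node1[OF \<tau> eq] transversal_node2[OF \<tau> ne])
  qed
qed

lemma coord_partial_splits:
  fixes v :: "'k::comm_ring_1 tensor"
  assumes v: "v \<in> chain_space G S" and m: "splits S \<tau>"
  shows "coord (insert \<tau> S) (diff S \<tau> v) ((Half \<tau> NW, g1) # (Half \<tau> SE, g2) # L) =
    (case dual_comult g1 g2 of None \<Rightarrow> 0 | Some g \<Rightarrow> coord S v ((Half \<tau> NW, g) # L))"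
proof -
  let ?S' = "insert \<tau> S"
  have hv: "homogeneous (length (ord S)) v" using v by (simp only: chain_space_iff[OF S])
  have ne: "cycle_at G ?S' (Half \<tau> NW) \<noteq> cycle_at G ?S' (Half \<tau> SE)"
    and eq: "cycle_at G S (Half \<tau> NW) = cycle_at G S (Half \<tau> SE)"
    using m by (auto simp: splits_def cycle_at_eq_iff)
  have con: "\<And>e. conn G S (Half \<tau> NW) (Half \<tau> SE) e \<Longrightarrow> e"
    "\<And>e. conn G ?S' (Half \<tau> NW) (Half \<tau> SE) e \<Longrightarrow> e"
    using conn_consistent[of S] conn_consistent[of ?S'] m by (auto simp: splits_def)
  show ?thesis
  proof (cases "away_transversal \<tau> S (map fst L)")
    case True
    then have True': "away_transversal \<tau> ?S' (map fst L)" using away_transversal_imp[OF agree_insert] by blast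
    let ?rest = "filter (\<lambda>C. C \<notin> set (cycles_through G S \<tau>)) (ord S)"
    note r = filter_rest[OF S \<tau>]
    define \<gamma> where "\<gamma> = label S L"
    have L: "cycle_at G ?S' (fst x) = cycle_at G S (fst x)" if "x \<in> set L" for x
      using cycle_at_away[OF agree_insert] away_transversalD(2)[OF True, of "fst x"] that by simp
    have \<gamma>: "\<gamma> (cycle_at G S p) = g" if "(p, g) \<in> set L" for p g
      unfolding \<gamma>_def by (rule label_eq[OF _ that]) (use True in \<open>simp add: away_transversal_def\<close>)
    have \<gamma>': "\<gamma> (cycle_at G ?S' p) = g" if "(p, g) \<in> set L" for p g
      using \<gamma>[OF that] L[OF that] by simp
    have cyc: "map (cycle_at G ?S' \<circ> fst) L = map (cycle_at G S \<circ> fst) L" using L by simp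
    define Y where "Y = bars (map (\<lambda>C. cuts G S {mark S C} (range (Half \<tau>)))
        [cycle_at G S (Half \<tau> NW)] @ map (\<lambda>C. 0) ?rest)
          (reorder (ord S) ([cycle_at G S (Half \<tau> NW)] @ ?rest) v)"
    define s where "s = (of_int (reorder_sign (map (cycle_at G S \<circ> fst) L) ?rest) * prod_list (map (mark_sign S) L) :: 'k)"
    have s: "s * s = 1"
      unfolding s_def by (rule mult_square_1[OF of_int_reorder_sign_square prod_mark_sign_square])
    have Y: "Poly_Mapping.lookup Y (g # map \<gamma> ?rest) = s * coord S v ((Half \<tau> NW, g) # L)" for g
      using lookup_bars_reorder[where T = S and H = "[(Half \<tau> NW, g)]"
          and L = L and \<gamma> = \<gamma> and rest = ?rest and v = v, OF S \<tau> con(1) _ _ True r(1,2) \<gamma> hv]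
        True transversal_node1[OF \<tau> eq]
      by (simp add: Y_def s_def)
    have "coord ?S' (diff S \<tau> v) ((Half \<tau> NW, g1) # (Half \<tau> SE, g2) # L) =
        s * Poly_Mapping.lookup (comult_first Y) (g1 # g2 # map \<gamma> ?rest)"
      using coord_reorder_bars[where T = ?S' and H = "[(Half \<tau> NW, g1), (Half \<tau> SE, g2)]" and L = L
          and \<gamma> = \<gamma> and rest = ?rest and Z = "comult_first Y",
          OF S' \<tau> con(2) _ _ True' r(1,3) \<gamma>' S agree_insert]
        True' transversal_node2[OF \<tau> ne] cyc
      by (simp add: partial_splits[OF m] Y_def s_def Let_def)
    then show ?thesis
      by (cases "dual_comult g1 g2") (simp_all add: lookup_comult_first Y s flip: mult.assoc)
  next
    case False
    then have "\<not> away_transversal \<tau> ?S' (map fst L)"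
      using away_transversal_imp[OF agree_sym[OF agree_insert]] by blast
    then show ?thesis using False
      by (simp add: coord_def transversal_node1[OF \<tau> eq] transversal_node2[OF \<tau> ne] split: option.split)
  qed
qed

end

end

section \<open>The finite model of a face\<close>

text \<open>The half-edges at the two crossings of a face. The corners \<open>SW\<close> and \<open>NE\<close> of a negative
  crossing are exchanged here, which turns its smoothings into those of a positive crossing.\<close>

type_synonym half = "bool \<times> corner"

definition all_halves :: "half list" where
  "all_halves = [(False, NW), (False, SE), (False, SW), (False, NE),
     (True, NW), (True, SE), (True, SW), (True, NE)]"

text \<open>\<open>s\<close> and \<open>s'\<close> tell whether the two crossings are
  \<open>B\<close>-smoothed; a positive crossing is vertical iff it is not.\<close>

fun turn :: "bool \<times> bool \<Rightarrow> half \<Rightarrow> half" where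
  "turn (s, s') (False, k) = (False, partner (\<not> s) k)"
| "turn (s, s') (True, k) = (True, partner (\<not> s') k)"

fun mate :: "(half \<times> half) list \<Rightarrow> half \<Rightarrow> half" where
  "mate [] h = h"
| "mate ((p, q) # m) h = (if h = p then q else if h = q then p else mate m h)"

text \<open>A table assigns to a half-edge a representative of its cycle, and whether the number of cut
  loci between them is even.\<close>

type_synonym table = "(half \<times> half \<times> bool) list"

fun walk :: "(half \<times> half) list \<Rightarrow> bool \<times> bool \<Rightarrow> nat \<Rightarrow> half \<Rightarrow> half \<Rightarrow> bool \<Rightarrow> table" where
  "walk m s 0 r h e = []"
| "walk m s (Suc n) r h e = (h, r, e) # (turn s h, r, e) #
     walk m s n r (mate m (turn s h)) (e \<noteq> has_cut (snd (turn s h)) (snd (mate m (turn s h))))"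

text \<open>Each step of \<open>walk\<close> covers two of the eight half-edges, so four steps run
  through any cycle. On a shorter cycle they go round again, and \<open>map_of\<close> keeps the
  first entries.\<close>

fun build :: "(half \<times> half) list \<Rightarrow> bool \<times> bool \<Rightarrow> half list \<Rightarrow> table \<Rightarrow> table" where
  "build m s [] t = t"
| "build m s (h # hs) t =
     (if map_of t h = None then build m s hs (walk m s 4 h h True @ t) else build m s hs t)"

definition table :: "(half \<times> half) list \<Rightarrow> bool \<times> bool \<Rightarrow> table" where
  "table m s = build m s all_halves []"

definition related :: "table \<Rightarrow> half \<Rightarrow> half \<Rightarrow> bool option" where
  "related t p q = (case map_of t p of None \<Rightarrow> None | Some (r, e) \<Rightarrow>
     (case map_of t q of None \<Rightarrow> None | Some (r', e') \<Rightarrow> if r = r' then Some (e = e') else None))"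

fun own_rep :: "half \<Rightarrow> (half \<times> bool) option \<Rightarrow> bool" where
  "own_rep h None = False"
| "own_rep h (Some (r, e)) = (r = h)"

fun reps_in :: "table \<Rightarrow> half list \<Rightarrow> half list" where
  "reps_in t [] = []"
| "reps_in t (h # hs) = (if own_rep h (map_of t h) then h # reps_in t hs else reps_in t hs)"

definition reps :: "table \<Rightarrow> half list" where
  "reps t = reps_in t all_halves"

text \<open>This certifies the negative information. That related half-edges lie on one cycle holds
  by construction of the tables; that unrelated ones do not follows because the classes are closed
  under \<open>turn\<close> and \<open>mate\<close>.\<close>

fun closed_in :: "(half \<times> half) list \<Rightarrow> bool \<times> bool \<Rightarrow> table \<Rightarrow> half list \<Rightarrow> bool" where
  "closed_in m s t [] = True"
| "closed_in m s t (h # hs) = ((case map_of t h of None \<Rightarrow> False | Some (r, e) \<Rightarrow>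
     own_rep r (map_of t r) \<and> own_rep r (map_of t (turn s h)) \<and> own_rep r (map_of t (mate m h)))
       \<and> closed_in m s t hs)"

type_synonym labelling = "(half \<times> gen) list"

fun skip :: "half \<times> gen \<Rightarrow> (bool \<times> gen \<times> labelling) option \<Rightarrow> (bool \<times> gen \<times> labelling) option" where
  "skip x None = None"
| "skip x (Some (e, g, l)) = Some (\<not> e, g, x # l)"

text \<open>\<open>bring t h l\<close> moves the label of the cycle through \<open>h\<close> to the front and to \<open>h\<close>. Here and below,
  a Boolean stands for a sign.\<close>

fun bring :: "table \<Rightarrow> half \<Rightarrow> labelling \<Rightarrow> (bool \<times> gen \<times> labelling) option" where
  "bring t h [] = None"
| "bring t h ((p, g) # l) = (case related t p h of
     Some e \<Rightarrow> Some (g = X_V \<longrightarrow> e, g, l)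
   | None \<Rightarrow> skip (p, g) (bring t h l))"

text \<open>\<open>pull t t' b\<close> is the transpose of the partial differential at the crossing \<open>b\<close> from the state
  with table \<open>t\<close> to the one with table \<open>t'\<close>.\<close>

fun pull :: "table \<Rightarrow> table \<Rightarrow> bool \<Rightarrow> bool \<times> labelling \<Rightarrow> (bool \<times> labelling) list option" where
  "pull t t' b (e, l) =
    (case bring t' (b, NW) l of None \<Rightarrow> None | Some (e1, g1, l1) \<Rightarrow>
      if related t (b, NW) (b, SE) = None then
        (if related t' (b, NW) (b, SE) = Some True then
         Some (case g1 of One_V \<Rightarrow> [(e = e1, ((b, NW), One_V) # ((b, SE), One_V) # l1)]
          | X_V \<Rightarrow> [(e = e1, ((b, NW), One_V) # ((b, SE), X_V) # l1),
              (e = e1, ((b, NW), X_V) # ((b, SE), One_V) # l1)])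
          else None)
      else if related t' (b, NW) (b, SE) = None then
        (if related t (b, NW) (b, SE) = Some True then
         (case bring t' (b, SE) l1 of None \<Rightarrow> None | Some (e2, g2, l2) \<Rightarrow>
          (case dual_comult g1 g2 of None \<Rightarrow> Some []
           | Some g \<Rightarrow> Some [((e = e1) = e2, ((b, NW), g) # l2)])) else None)
      else Some [])"

fun pulls :: "table \<Rightarrow> table \<Rightarrow> bool \<Rightarrow> (bool \<times> labelling) list \<Rightarrow> (bool \<times> labelling) list option" where
  "pulls t t' b [] = Some []"
| "pulls t t' b (x # xs) = (case pull t t' b x of None \<Rightarrow> None | Some ys \<Rightarrow>
      (case pulls t t' b xs of None \<Rightarrow> None | Some zs \<Rightarrow> Some (ys @ zs)))"

text \<open>Normal form of a labelling: its labels in the order of the representatives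
  \<open>hs\<close>, accumulated in reverse, with the sign for getting there.\<close>

fun to_word :: "table \<Rightarrow> half list \<Rightarrow> bool \<Rightarrow> gen list \<Rightarrow> labelling \<Rightarrow> (bool \<times> gen list) option" where
  "to_word t [] e w l = (if l = [] then Some (e, w) else None)"
| "to_word t (h # hs) e w l = (case bring t h l of None \<Rightarrow> None
     | Some (e1, g, l') \<Rightarrow> to_word t hs (e = e1) (g # w) l')"

fun to_words :: "table \<Rightarrow> half list \<Rightarrow> (bool \<times> labelling) list \<Rightarrow> (bool \<times> gen list) list option" where
  "to_words t hs [] = Some []"
| "to_words t hs (x # xs) = (case to_word t hs (fst x) [] (snd x) of None \<Rightarrow> None
     | Some y \<Rightarrow> (case to_words t hs xs of None \<Rightarrow> None | Some ys \<Rightarrow> Some (y # ys)))"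

text \<open>One coordinate of the image is pulled back along a side of the face, so the differential
  at \<open>\<not> b\<close>, which is applied last, is undone first.\<close>

definition transport :: "table \<Rightarrow> table \<Rightarrow> table \<Rightarrow> bool \<Rightarrow> gen list \<Rightarrow> (bool \<times> gen list) list option" where
  "transport t t' t'' b w = (case pull t' t'' (\<not> b) (True, zip (reps t'') w) of None \<Rightarrow> None | Some xs \<Rightarrow>
     (case pulls t t' b xs of None \<Rightarrow> None | Some ys \<Rightarrow> to_words t (reps t) ys))"

function cancelling :: "(bool \<times> gen list) list \<Rightarrow> bool" where
  "cancelling [] = True"
| "cancelling ((e, w) # ys) = ((\<not> e, w) \<in> set ys \<and> cancelling (remove1 (\<not> e, w) ys))"
  by pat_completeness auto
termination
  by (relation "Wellfounded.measure length") (auto simp: length_remove1)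

fun words :: "'a list \<Rightarrow> gen list list" where
  "words [] = [[]]"
| "words (x # xs) = map ((#) One_V) (words xs) @ map ((#) X_V) (words xs)"

fun anticommuting_on :: "table \<Rightarrow> table \<Rightarrow> table \<Rightarrow> table \<Rightarrow> gen list list \<Rightarrow> bool" where
  "anticommuting_on t t1 t2 t12 [] = True"
| "anticommuting_on t t1 t2 t12 (w # ws) = ((case transport t t1 t12 False w of None \<Rightarrow> False
     | Some xs \<Rightarrow> (case transport t t2 t12 True w of None \<Rightarrow> False
     | Some ys \<Rightarrow> cancelling (xs @ ys))) \<and> anticommuting_on t t1 t2 t12 ws)"

definition anticommuting :: "table \<Rightarrow> table \<Rightarrow> table \<Rightarrow> table \<Rightarrow> bool" where
  "anticommuting t t1 t2 t12 \<longleftrightarrow> anticommuting_on t t1 t2 t12 (words (reps t12))"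

definition admissible :: "table \<Rightarrow> table \<Rightarrow> bool \<Rightarrow> bool" where
  "admissible t t' b \<longleftrightarrow>
     (related t (b, NW) (b, SE) = None \<longrightarrow> related t' (b, NW) (b, SE) = Some True) \<and>
     (related t' (b, NW) (b, SE) = None \<longrightarrow> related t (b, NW) (b, SE) = Some True)"

definition check_tables :: "table \<Rightarrow> table \<Rightarrow> table \<Rightarrow> table \<Rightarrow> bool" where
  "check_tables t t1 t2 t12 \<longleftrightarrow> anticommuting t t1 t2 t12 \<and> admissible t t1 False \<and>
     admissible t t2 True \<and> admissible t1 t12 True \<and> admissible t2 t12 False"

definition check :: "(half \<times> half) list \<Rightarrow> bool" where
  "check m \<longleftrightarrow>
     check_tables (table m (False, False)) (table m (True, False)) (table m (False, True))
       (table m (True, True)) \<and>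
     closed_in m (False, False) (table m (False, False)) all_halves \<and>
     closed_in m (True, False) (table m (True, False)) all_halves \<and>
     closed_in m (False, True) (table m (False, True)) all_halves \<and>
     closed_in m (True, True) (table m (True, True)) all_halves"

text \<open>The first element is paired in all possible ways; for eight half-edges this gives 7 * 5
  * 3 * 1 = 105 matchings.\<close>

function matchings :: "'a list \<Rightarrow> ('a \<times> 'a) list list" where
  "matchings [] = [[]]"
| "matchings (x # xs) = concat (map (\<lambda>y. map ((#) (x, y)) (matchings (remove1 y xs))) xs)"
  by pat_completeness auto
termination
  by (relation "Wellfounded.measure length") (auto simp: length_remove1)

lemma matchings_complete:
  assumes "distinct xs" "\<And>x. x \<in> set xs \<Longrightarrow> \<mu> x \<in> set xs \<and> \<mu> x \<noteq> x \<and> \<mu> (\<mu> x) = x"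
  shows "\<exists>m\<in>set (matchings xs). \<forall>x\<in>set xs. mate m x = \<mu> x"
  using assms
proof (induction xs rule: matchings.induct)
  case (2 x xs)
  let ?y = "\<mu> x"
  have y: "?y \<in> set xs" "?y \<noteq> x" "\<mu> ?y = x" using 2(3)[of x] by auto
  have d: "distinct (remove1 ?y xs)" and s: "set (remove1 ?y xs) = set xs - {?y}"
    using 2(2) by auto
  have "\<mu> z \<in> set (remove1 ?y xs) \<and> \<mu> z \<noteq> z \<and> \<mu> (\<mu> z) = z" if "z \<in> set (remove1 ?y xs)" for z
  proof -
    have z: "z \<in> set xs" "z \<noteq> ?y" "z \<noteq> x" using that s 2(2) by auto
    have "\<mu> z \<in> set (x # xs)" "\<mu> z \<noteq> z" "\<mu> (\<mu> z) = z" using 2(3)[of z] z by auto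
    moreover have "\<mu> z \<noteq> x" "\<mu> z \<noteq> ?y" using calculation(3) z y by metis+
    ultimately show ?thesis using s by auto
  qed
  then obtain m where m: "m \<in> set (matchings (remove1 ?y xs))"
    "\<forall>z\<in>set (remove1 ?y xs). mate m z = \<mu> z"
    using 2(1)[OF y(1) d] by blast
  have "(x, ?y) # m \<in> set (matchings (x # xs))" using m(1) y(1) by auto
  moreover have "mate ((x, ?y) # m) z = \<mu> z" if "z \<in> set (x # xs)" for z
    using that m(2) y s by auto
  ultimately show ?case by blast
qed auto

section \<open>Soundness of the evaluation for abstract coordinates\<close>

definition sgn_of :: "bool \<Rightarrow> 'k::comm_ring_1" where
  "sgn_of e = (if e then 1 else -1)"

lemma sgn_of_eq: "sgn_of (e = e') = sgn_of e * sgn_of e'"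
  and sgn_of_not: "sgn_of (\<not> e) = - sgn_of e"
  by (auto simp: sgn_of_def)

text \<open>The two laws of coordinates on which \<open>bring\<close> rests, exchanging neighbours
  and moving a point. Soundness is shown for any function that obeys them, so the complex itself
  enters only through \<open>face_coord\<close>.\<close>

definition alternating :: "table \<Rightarrow> (labelling \<Rightarrow> 'k::comm_ring_1) \<Rightarrow> bool" where
  "alternating t \<Phi> \<longleftrightarrow> (\<forall>A x y B. \<Phi> (A @ x # y # B) = - \<Phi> (A @ y # x # B)) \<and>
     (\<forall>A p h e g B. related t p h = Some e \<longrightarrow>
        \<Phi> (A @ (p, g) # B) = sgn_of (g = X_V \<longrightarrow> e) * \<Phi> (A @ (h, g) # B))"

lemma alternating_swap: "alternating t \<Phi> \<Longrightarrow> \<Phi> (A @ x # y # B) = - \<Phi> (A @ y # x # B)"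
  unfolding alternating_def by blast

text \<open>The prefix \<open>A\<close> is general because the recursion shifts each skipped label
  into it; taking the found label back past that one costs a sign.\<close>

lemma bring_sound:
  assumes "alternating t \<Phi>"
  shows "bring t h l = Some (e, g, l') \<Longrightarrow> \<Phi> (A @ l) = sgn_of e * \<Phi> (A @ (h, g) # l')"
proof (induction l arbitrary: A e g l')
  case (Cons x l)
  obtain p g0 where x: "x = (p, g0)" by (cases x)
  show ?case
  proof (cases "related t p h")
    case (Some e0)
    then have "e = (g0 = X_V \<longrightarrow> e0)" "g = g0" "l' = l" using Cons.prems x by auto
    then show ?thesis using assms Some x unfolding alternating_def by blast
  next
    case None
    then obtain e1 l1 where b: "bring t h l = Some (e1, g, l1)" "e = (\<not> e1)" "l' = x # l1"
      using Cons.prems x by (cases "bring t h l") auto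
    have "\<Phi> (A @ x # l) = \<Phi> ((A @ [x]) @ l)" by simp
    also have "\<dots> = sgn_of e1 * \<Phi> ((A @ [x]) @ (h, g) # l1)" using Cons.IH[OF b(1)] .
    also have "\<Phi> ((A @ [x]) @ (h, g) # l1) = - \<Phi> (A @ (h, g) # x # l1)"
      using alternating_swap[OF assms, of A x "(h, g)" l1] by simp
    finally show ?thesis using b by (simp add: sgn_of_not)
  qed
qed simp

text \<open>\<open>\<Phi>\<close> and \<open>\<Phi>'\<close> are the coordinates of a chain and of
  its image, so differentials act on them by their transposes. In the combinations of relations that
  are left out here, \<open>pull\<close> returns \<open>None\<close>.\<close>

definition transpose_differential ::
    "table \<Rightarrow> table \<Rightarrow> bool \<Rightarrow> (labelling \<Rightarrow> 'k::comm_ring_1) \<Rightarrow> (labelling \<Rightarrow> 'k) \<Rightarrow> bool" where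
  "transpose_differential t t' b \<Phi> \<Phi>' \<longleftrightarrow>
     (related t (b, NW) (b, SE) = None \<longrightarrow> related t' (b, NW) (b, SE) = Some True \<longrightarrow>
       (\<forall>g l. \<Phi>' (((b, NW), g) # l) = (case g of
          One_V \<Rightarrow> \<Phi> (((b, NW), One_V) # ((b, SE), One_V) # l)
        | X_V \<Rightarrow> \<Phi> (((b, NW), One_V) # ((b, SE), X_V) # l)
            + \<Phi> (((b, NW), X_V) # ((b, SE), One_V) # l)))) \<and>
     (related t (b, NW) (b, SE) = Some True \<longrightarrow> related t' (b, NW) (b, SE) = None \<longrightarrow>
       (\<forall>g1 g2 l. \<Phi>' (((b, NW), g1) # ((b, SE), g2) # l) =
          (case dual_comult g1 g2 of None \<Rightarrow> 0 | Some g \<Rightarrow> \<Phi> (((b, NW), g) # l)))) \<and>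
     (related t (b, NW) (b, SE) \<noteq> None \<longrightarrow> related t' (b, NW) (b, SE) \<noteq> None \<longrightarrow>
       (\<forall>l. \<Phi>' l = 0))"

definition signed_sum :: "('a \<Rightarrow> 'k::comm_ring_1) \<Rightarrow> (bool \<times> 'a) list \<Rightarrow> 'k" where
  "signed_sum \<Phi> xs = (\<Sum>(e, l)\<leftarrow>xs. sgn_of e * \<Phi> l)"

lemma signed_sum_simps [simp]:
  "signed_sum \<Phi> [] = 0"
  "signed_sum \<Phi> ((e, l) # xs) = sgn_of e * \<Phi> l + signed_sum \<Phi> xs"
  "signed_sum \<Phi> (xs @ ys) = signed_sum \<Phi> xs + signed_sum \<Phi> ys"
  by (simp_all add: signed_sum_def)

lemma pull_sound:
  assumes alt: "alternating t' \<Phi>'" and d: "transpose_differential t t' b \<Phi> \<Phi>'"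
    and p: "pull t t' b (e, l) = Some xs"
  shows "sgn_of e * \<Phi>' l = signed_sum \<Phi> xs"
proof -
  obtain e1 g1 l1 where b1: "bring t' (b, NW) l = Some (e1, g1, l1)"
    using p by (cases "bring t' (b, NW) l") auto
  have 1: "\<Phi>' l = sgn_of e1 * \<Phi>' (((b, NW), g1) # l1)"
    using bring_sound[OF alt b1, of "[]"] by simp
  consider "related t (b, NW) (b, SE) = None" "related t' (b, NW) (b, SE) = Some True"
    | "related t (b, NW) (b, SE) = Some True" "related t' (b, NW) (b, SE) = None"
    | "related t (b, NW) (b, SE) \<noteq> None" "related t' (b, NW) (b, SE) \<noteq> None"
    using p b1 by (auto split: if_splits)
  then show ?thesis
  proof cases
    case 1
    then show ?thesis using d p b1 \<open>\<Phi>' l = _\<close>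
      by (cases g1) (auto simp: transpose_differential_def sgn_of_eq algebra_simps)
  next
    case 2
    obtain e2 g2 l2 where b2: "bring t' (b, SE) l1 = Some (e2, g2, l2)"
      using p b1 2 by (cases "bring t' (b, SE) l1") auto
    have "\<Phi>' (((b, NW), g1) # l1) = sgn_of e2 * \<Phi>' (((b, NW), g1) # ((b, SE), g2) # l2)"
      using bring_sound[OF alt b2, of "[((b, NW), g1)]"] by simp
    also have "\<Phi>' (((b, NW), g1) # ((b, SE), g2) # l2) =
        (case dual_comult g1 g2 of None \<Rightarrow> 0 | Some g \<Rightarrow> \<Phi> (((b, NW), g) # l2))"
      using d 2 unfolding transpose_differential_def by simp
    finally show ?thesis using p b1 b2 2 1
      by (cases "dual_comult g1 g2") (auto simp: sgn_of_eq mult_ac)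
  next
    case 3
    then have "\<Phi>' l = 0" using d unfolding transpose_differential_def by blast
    moreover have "xs = []" using p b1 3 by auto
    ultimately show ?thesis by simp
  qed
qed

lemma pulls_sound:
  assumes alt: "alternating t' \<Phi>'" and d: "transpose_differential t t' b \<Phi> \<Phi>'"
  shows "pulls t t' b xs = Some ys \<Longrightarrow> signed_sum \<Phi>' xs = signed_sum \<Phi> ys"
proof (induction xs arbitrary: ys)
  case (Cons x xs)
  obtain e l where x: "x = (e, l)" by (cases x)
  obtain us vs where "pull t t' b (e, l) = Some us" "pulls t t' b xs = Some vs" "ys = us @ vs"
    using Cons.prems x by (auto simp del: pull.simps split: option.splits)
  then show ?case using pull_sound[OF alt d] Cons.IH x by simp
qed simp

text \<open>\<open>ds\<close> are the representatives already treated, with their labels reversed in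
  \<open>w\<close>. The next label is brought not to the very front but just behind them.\<close>

lemma to_word_sound:
  assumes "alternating t \<Phi>"
  shows "to_word t hs e w l = Some (e', w') \<Longrightarrow> length ds = length w \<Longrightarrow>
    sgn_of e * \<Phi> (zip ds (rev w) @ l) = sgn_of e' * \<Phi> (zip (ds @ hs) (rev w'))"
proof (induction hs arbitrary: e w l ds)
  case Nil
  then show ?case by (auto split: if_splits)
next
  case (Cons h hs)
  obtain e1 g l' where b: "bring t h l = Some (e1, g, l')" "to_word t hs (e = e1) (g # w) l' = Some (e', w')"
    using Cons.prems(1) by (auto split: option.splits)
  have 1: "\<Phi> (zip ds (rev w) @ l) = sgn_of e1 * \<Phi> (zip ds (rev w) @ (h, g) # l')"
    using bring_sound[OF assms b(1)] .
  have 2: "zip ds (rev w) @ (h, g) # l' = zip (ds @ [h]) (rev (g # w)) @ l'"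
    using Cons.prems(2) by simp
  have "length (ds @ [h]) = length (g # w)" using Cons.prems(2) by simp
  note 3 = Cons.IH[OF b(2) this]
  have "sgn_of e * \<Phi> (zip ds (rev w) @ l) =
      sgn_of (e = e1) * \<Phi> (zip (ds @ [h]) (rev (g # w)) @ l')"
    unfolding 1 2 sgn_of_eq by (simp only: mult.assoc)
  then show ?case unfolding 3 by (simp only: append_assoc append.simps)
qed

lemma to_words_sound:
  assumes "alternating t \<Phi>"
  shows "to_words t hs xs = Some ys \<Longrightarrow> signed_sum \<Phi> xs = signed_sum (\<lambda>w. \<Phi> (zip hs (rev w))) ys"
proof (induction xs arbitrary: ys)
  case (Cons x xs)
  obtain e w zs where y: "to_word t hs (fst x) [] (snd x) = Some (e, w)" "to_words t hs xs = Some zs" "ys = (e, w) # zs"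
    using Cons.prems by (auto split: option.splits)
  have "sgn_of (fst x) * \<Phi> (snd x) = sgn_of e * \<Phi> (zip hs (rev w))"
    using to_word_sound[OF assms y(1), of "[]"] by simp
  then show ?case using Cons.IH[OF y(2)] y(3) by (cases x) simp
qed simp

lemma transport_sound:
  assumes "alternating t \<Phi>" "alternating t' \<Phi>'" "alternating t'' \<Phi>''"
    and "transpose_differential t t' b \<Phi> \<Phi>'" "transpose_differential t' t'' (\<not> b) \<Phi>' \<Phi>''"
    and "transport t t' t'' b w = Some ys"
  shows "\<Phi>'' (zip (reps t'') w) = signed_sum (\<lambda>w. \<Phi> (zip (reps t) (rev w))) ys"
proof -
  obtain xs zs where "pull t' t'' (\<not> b) (True, zip (reps t'') w) = Some xs" "pulls t t' b xs = Some zs"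
    "to_words t (reps t) zs = Some ys"
    using assms(6) unfolding transport_def by (auto simp del: pull.simps split: option.splits)
  then show ?thesis
    using pull_sound[OF assms(3,5)] pulls_sound[OF assms(2,4)] to_words_sound[OF assms(1)]
    by (fastforce simp: sgn_of_def)
qed

lemma signed_sum_remove1: "(e, w) \<in> set ys \<Longrightarrow> signed_sum f ys = sgn_of e * f w + signed_sum f (remove1 (e, w) ys)"
  unfolding signed_sum_def by (subst sum_list_map_remove1) auto

lemma signed_sum_cancelling: "cancelling xs \<Longrightarrow> signed_sum f xs = 0"
  by (induction xs rule: cancelling.induct) (auto simp: signed_sum_remove1 sgn_of_not)

lemma anticommuting_on_sound:
  assumes "alternating t \<Phi>" "alternating t1 \<Phi>1" "alternating t2 \<Phi>2"
    and "alternating t12 \<Phi>12" "alternating t12 \<Phi>21"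
    and "transpose_differential t t1 False \<Phi> \<Phi>1" "transpose_differential t1 t12 True \<Phi>1 \<Phi>12"
    and "transpose_differential t t2 True \<Phi> \<Phi>2" "transpose_differential t2 t12 False \<Phi>2 \<Phi>21"
  shows "anticommuting_on t t1 t2 t12 ws \<Longrightarrow> w \<in> set ws \<Longrightarrow>
    \<Phi>12 (zip (reps t12) w) + \<Phi>21 (zip (reps t12) w) = 0"
proof (induction ws)
  case (Cons v ws)
  show ?case
  proof (cases "w = v")
    case True
    then obtain xs ys where xs: "transport t t1 t12 False w = Some xs" and ys: "transport t t2 t12 True w = Some ys"
      and c: "cancelling (xs @ ys)"
      using Cons.prems(1) by (auto split: option.splits)
    show ?thesis
      using transport_sound[OF assms(1,2,4,6) _ xs] transport_sound[OF assms(1,3,5,8) _ ys] assms(7,9)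
        signed_sum_cancelling[OF c] by simp
  qed (use Cons in auto)
qed simp

lemma set_words: "set (words xs) = {w. length w = length xs}"
proof (induction xs)
  case (Cons x xs)
  show ?case
  proof (intro set_eqI iffI)
    fix w :: "gen list" assume "w \<in> {w. length w = length (x # xs)}"
    then obtain g v where "w = g # v" "length v = length xs" by (auto simp: length_Suc_conv)
    then show "w \<in> set (words (x # xs))" using Cons by (cases g) auto
  qed (use Cons in auto)
qed auto

section \<open>Soundness of the tables\<close>

text \<open>By the last assumption an outer arc counts, modulo 2, like a single semi-arc between its
  ends; this is the rule that \<open>walk\<close> applies.\<close>

locale table_relation =
  fixes C :: "half \<Rightarrow> half \<Rightarrow> bool \<Rightarrow> bool" and m :: "(half \<times> half) list" and s :: "bool \<times> bool"
  assumes refl: "C p p True" and sym: "C p q e \<Longrightarrow> C q p e"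
    and trans: "C p q e \<Longrightarrow> C q r e' \<Longrightarrow> C p r (e = e')"
    and turn: "C h (turn s h) True"
    and mate: "C h (mate m h) (\<not> has_cut (snd h) (snd (mate m h)))"
begin

lemma walk_sound: "C r h e \<Longrightarrow> (q, r', e') \<in> set (walk m s n r h e) \<Longrightarrow> C r' q e'"
proof (induction n arbitrary: h e)
  case (Suc n)
  let ?h = "turn s h"
  have 1: "C r ?h e" using trans[OF Suc.prems(1) turn] by simp
  have 2: "C r (mate m ?h) (e \<noteq> has_cut (snd ?h) (snd (mate m ?h)))"
    using trans[OF 1 mate[of ?h]] by simp
  show ?case using Suc.prems 1 Suc.IH[OF 2] by auto
qed simp

lemma build_sound:
  "(\<And>q r e. (q, r, e) \<in> set t \<Longrightarrow> C r q e) \<Longrightarrow> (q, r, e) \<in> set (build m s hs t) \<Longrightarrow> C r q e"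
proof (induction hs arbitrary: t)
  case (Cons h hs)
  have *: "C r q e" if "(q, r, e) \<in> set (walk m s 4 h h True @ t)" for q r e
    using that Cons.prems(1) walk_sound[OF refl] unfolding set_append by blast
  show ?case
  proof (cases "map_of t h = None")
    case True
    then have b: "(q, r, e) \<in> set (build m s hs (walk m s 4 h h True @ t))" using Cons.prems(2) by simp
    show ?thesis by (rule Cons.IH[OF _ b]) (rule *)
  next
    case False
    then have b: "(q, r, e) \<in> set (build m s hs t)"
      using Cons.prems(2) by (simp only: build.simps if_False)
    show ?thesis by (rule Cons.IH[OF _ b]) (rule Cons.prems(1))
  qed
qed simp

lemma related_sound:
  assumes "related (table m s) p q = Some e"
  shows "C p q e"
proof -
  have *: "C r q e" if "map_of (table m s) q = Some (r, e)" for q r e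
    using build_sound[of "[]"] map_of_SomeD[OF that] unfolding table_def by simp
  obtain r e1 e2 where r: "map_of (table m s) p = Some (r, e1)" "map_of (table m s) q = Some (r, e2)"
    "e = (e1 = e2)"
    using assms by (auto simp: related_def split: option.splits if_splits)
  show ?thesis using trans[OF sym[OF *[OF r(1)]] *[OF r(2)]] r(3) by simp
qed

end

text \<open>All matchings, all four states of each, and all labels of the representatives in the
  last state are evaluated, by rewriting with the defining equations.\<close>

lemma check_all: "list_all check (matchings all_halves)"
  by code_simp

section \<open>Semi-arcs of a diagram\<close>

lemma cdet_antisym: "cdet v w = - cdet w v"
  by (simp add: cdet_def)

text \<open>\<open>cdet\<close> is antisymmetric and does not vanish on the two tangents, since the
  strands cross transversally. So it is positive for exactly one order of the strands, which makes
  \<open>rising\<close> well defined.\<close>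

lemma strand_at_facts:
  assumes L: "virtual_link_diagram L" and z: "z \<in> classical L"
  shows "strand_at L z SW \<in> strands L z" "strand_at L z SE \<in> strands L z"
    "strand_at L z SW \<noteq> strand_at L z SE"
    "strand_at L z NE = strand_at L z SW" "strand_at L z NW = strand_at L z SE"
    "strands L z = {strand_at L z SW, strand_at L z SE}"
proof -
  have "classical L \<subseteq> double_points L"
    using L unfolding virtual_link_diagram_def by (elim conjE)
  then have "card (strands L z) = 2" using z by (auto simp: double_points_def)
  then obtain p q where pq: "strands L z = {p, q}" "p \<noteq> q" by (auto simp: card_2_iff)
  have ne: "cdet (tangent L p) (tangent L q) \<noteq> 0"
  proof -
    have "\<forall>p\<in>strands L z. \<forall>q\<in>strands L z. p \<noteq> q \<longrightarrow> cdet (tangent L p) (tangent L q) \<noteq> 0"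
      using L unfolding virtual_link_diagram_def by (elim conjE) simp
    then show ?thesis using pq by simp
  qed
  obtain p q where pq: "strands L z = {p, q}" "p \<noteq> q" "cdet (tangent L p) (tangent L q) > 0"
  proof (cases "cdet (tangent L p) (tangent L q) > 0")
    case False
    then have "cdet (tangent L q) (tangent L p) > 0"
      using ne cdet_antisym[of "tangent L p" "tangent L q"] by linarith
    then show ?thesis using that[of q p] pq by (simp add: insert_commute)
  qed (use that pq in blast)
  have self: "cdet v v = 0" for v by (simp add: cdet_def)
  have r: "rising L z = p"
    unfolding rising_def
  proof (rule the_equality)
    show "p \<in> strands L z \<and> (\<exists>q\<in>strands L z. 0 < cdet (tangent L p) (tangent L q))" using pq by auto
  next
    fix x assume "x \<in> strands L z \<and> (\<exists>q\<in>strands L z. 0 < cdet (tangent L x) (tangent L q))"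
    then show "x = p"
      using pq cdet_antisym[of "tangent L q" "tangent L p"] by (auto simp: self)
  qed
  have o: "(THE x. x \<in> strands L z \<and> x \<noteq> rising L z) = q"
    by (rule the_equality) (use pq r in auto)
  show "strand_at L z SW \<in> strands L z" "strand_at L z SE \<in> strands L z"
    "strand_at L z SW \<noteq> strand_at L z SE"
    "strand_at L z NE = strand_at L z SW" "strand_at L z NW = strand_at L z SE"
    "strands L z = {strand_at L z SW, strand_at L z SE}"
    using pq r o by (auto simp: strand_at_def)
qed

definition passages :: "vdiagram \<Rightarrow> (nat \<times> real) set" where
  "passages L = {(i, t). i < ncomp L \<and> t \<in> classical_params L i}"

lemma passages_iff: "p \<in> passages L \<longleftrightarrow> (\<exists>z\<in>classical L. p \<in> strands L z)"
  by (cases p) (auto simp: passages_def classical_params_def strands_def)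

lemma strands_unique: "p \<in> strands L z \<Longrightarrow> p \<in> strands L z' \<Longrightarrow> z = z'"
  by (auto simp: strands_def)

lemma finite_classical:
  assumes "virtual_link_diagram L"
  shows "finite (classical L)"
proof (rule finite_subset)
  show "classical L \<subseteq> double_points L"
    using assms unfolding virtual_link_diagram_def by (elim conjE)
  show "finite (double_points L)"
    using assms unfolding virtual_link_diagram_def by (elim conjE)
qed

lemma finite_classical_params:
  assumes "virtual_link_diagram L" "i < ncomp L"
  shows "finite (classical_params L i)"
proof -
  have "finite (strands L z)" for z
    using assms(1) unfolding virtual_link_diagram_def by (elim conjE) simp
  then have "finite (\<Union>z\<in>classical L. strands L z)"
    using finite_classical[OF assms(1)] by simp
  moreover have "classical_params L i \<subseteq> snd ` (\<Union>z\<in>classical L. strands L z)"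
    using assms(2) by (force simp: classical_params_def strands_def)
  ultimately show ?thesis using finite_surj by blast
qed

definition cyclic_succ :: "'a::linorder set \<Rightarrow> 'a \<Rightarrow> 'a" where
  "cyclic_succ A t = (if \<exists>s\<in>A. t < s then Min {s \<in> A. t < s} else Min A)"

text \<open>Injectivity suffices, as the set is finite. If s < t, the successor of s lies above s
  and is at most t, whereas that of t is either above t or the minimum, hence at most s.\<close>

lemma cyclic_succ_bij:
  assumes "finite A"
  shows "bij_betw (cyclic_succ A) A A"
proof -
  have mem: "cyclic_succ A t \<in> A" if "t \<in> A" for t
  proof (cases "\<exists>s\<in>A. t < s")
    case True
    then have "Min {s \<in> A. t < s} \<in> {s \<in> A. t < s}" using assms by (intro Min_in) auto
    then show ?thesis using True by (simp add: cyclic_succ_def)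
  next
    case False
    then show ?thesis using Min_in[OF assms] that by (auto simp: cyclic_succ_def)
  qed
  have less: "t < cyclic_succ A t \<and> cyclic_succ A t \<le> s" if "s \<in> A" "t < s" for s t
  proof -
    have fin: "finite {s \<in> A. t < s}" and s: "s \<in> {s \<in> A. t < s}" using assms that by auto
    have "Min {s \<in> A. t < s} \<in> {s \<in> A. t < s}" using Min_in[OF fin] s by blast
    moreover have "Min {s \<in> A. t < s} \<le> s" using Min_le[OF fin s] .
    ultimately show ?thesis using that by (auto simp: cyclic_succ_def)
  qed
  have last: "cyclic_succ A t \<le> s" if "\<not> (\<exists>s\<in>A. t < s)" "s \<in> A" for s t
    using that assms by (auto simp: cyclic_succ_def)
  have "t \<le> s" if st: "s \<in> A" "t \<in> A" "cyclic_succ A s = cyclic_succ A t" for s t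
  proof (rule ccontr)
    assume "\<not> t \<le> s"
    then have "s < t" by simp
    then have 1: "s < cyclic_succ A s" "cyclic_succ A s \<le> t" using less[OF st(2)] by auto
    show False
    proof (cases "\<exists>r\<in>A. t < r")
      case True
      then have "t < cyclic_succ A t" using less by blast
      then show False using 1 st(3) by simp
    next
      case False
      then show False using last[OF False st(1)] 1 st(3) by simp
    qed
  qed
  then have "inj_on (cyclic_succ A) A" by (intro inj_onI) (metis order_antisym)
  moreover have "cyclic_succ A ` A \<subseteq> A" using mem by auto
  ultimately show ?thesis using assms by (simp add: bij_betw_def endo_inj_surj)
qed

lemma next_passage_eq: "next_passage L (i, t) = (i, cyclic_succ (classical_params L i) t)"
  by (simp add: next_passage_def cyclic_succ_def)

lemma next_passage_bij:
  assumes "virtual_link_diagram L"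
  shows "bij_betw (next_passage L) (passages L) (passages L)"
proof (rule bij_betwI')
  fix p q assume "p \<in> passages L" "q \<in> passages L"
  then show "next_passage L p = next_passage L q \<longleftrightarrow> p = q"
    using bij_betw_imp_inj_on[OF cyclic_succ_bij[OF finite_classical_params[OF assms]]]
    by (cases p; cases q) (auto simp: passages_def next_passage_eq inj_on_def)
next
  fix p assume "p \<in> passages L"
  then show "next_passage L p \<in> passages L"
    using bij_betwE[OF cyclic_succ_bij[OF finite_classical_params[OF assms]]]
    by (cases p) (auto simp: passages_def next_passage_eq)
next
  fix q assume q: "q \<in> passages L"
  obtain i t where it: "q = (i, t)" "i < ncomp L" "t \<in> classical_params L i"
    using q by (auto simp: passages_def)
  have "t \<in> cyclic_succ (classical_params L i) ` classical_params L i"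
    using it(3) bij_betw_imp_surj_on[OF cyclic_succ_bij[OF finite_classical_params[OF assms it(2)]]]
    by simp
  then obtain s where "s \<in> classical_params L i" "cyclic_succ (classical_params L i) s = t"
    by (elim imageE) simp
  then show "\<exists>p\<in>passages L. q = next_passage L p"
    using it by (intro bexI[of _ "(i, s)"]) (auto simp: passages_def next_passage_eq)
qed

definition incoming :: "corner \<Rightarrow> bool" where
  "incoming k \<longleftrightarrow> k \<in> {SW, SE}"

lemma semiarcs_gauss_of:
  "((z, k), (z', k')) \<in> semiarcs (gauss_of L) \<longleftrightarrow> z \<in> classical L \<and> z' \<in> classical L \<and>
     \<not> incoming k \<and> incoming k' \<and> next_passage L (strand_at L z k) = strand_at L z' k'"
  by (cases k) (auto simp: gauss_of_def incoming_def)

text \<open>Each passage through a classical crossing has one incoming and one outgoing half-edge;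
  \<open>b\<close> selects which of them is used as its name.\<close>

lemma strand_at_bij:
  assumes "virtual_link_diagram L"
  shows "bij_betw (\<lambda>(z, k). strand_at L z k) (classical L \<times> {k. incoming k = b}) (passages L)"
proof (rule bij_betwI')
  fix x y assume xy: "x \<in> classical L \<times> {k. incoming k = b}" "y \<in> classical L \<times> {k. incoming k = b}"
  obtain z k z' k' where z: "x = (z, k)" "y = (z', k')" by (cases x, cases y)
  note f = strand_at_facts[OF assms, of z] and f' = strand_at_facts[OF assms, of z']
  show "(case x of (z, k) \<Rightarrow> strand_at L z k) = (case y of (z, k) \<Rightarrow> strand_at L z k) \<longleftrightarrow> x = y"
  proof
    assume eq: "(case x of (z, k) \<Rightarrow> strand_at L z k) = (case y of (z, k) \<Rightarrow> strand_at L z k)"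
    have "strand_at L z k \<in> strands L z" "strand_at L z' k' \<in> strands L z'"
      using f f' xy z by (cases k; cases k'; auto)+
    then have zz: "z = z'" using eq z strands_unique by auto
    then have "k = k'"
      using f xy z eq by (cases k; cases k') (auto simp: incoming_def)
    then show "x = y" using z zz by simp
  qed simp
next
  fix x assume "x \<in> classical L \<times> {k. incoming k = b}"
  then obtain z k where "x = (z, k)" "z \<in> classical L" by auto
  then show "(case x of (z, k) \<Rightarrow> strand_at L z k) \<in> passages L"
    using strand_at_facts[OF assms, of z] by (cases k) (auto simp: passages_iff)
next
  fix p assume "p \<in> passages L"
  then obtain z where z: "z \<in> classical L" "p \<in> strands L z" by (auto simp: passages_iff)
  note f = strand_at_facts[OF assms z(1)]
  have "p = strand_at L z SW \<or> p = strand_at L z SE" using z(2) f(6) by auto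
  then have "\<exists>k. incoming k = b \<and> p = strand_at L z k"
    using f(4,5) by (cases b) (auto simp: incoming_def intro: exI[of _ SW] exI[of _ SE] exI[of _ NE] exI[of _ NW])
  then show "\<exists>x\<in>classical L \<times> {k. incoming k = b}. p = (case x of (z, k) \<Rightarrow> strand_at L z k)"
    using z(1) by auto
qed

lemma semiarc_bij:
  assumes "virtual_link_diagram L"
  shows "\<exists>f. bij_betw f (classical L \<times> {k. \<not> incoming k}) (classical L \<times> {k. incoming k}) \<and>
    (\<forall>x y. (x, y) \<in> semiarcs (gauss_of L) \<longleftrightarrow> x \<in> classical L \<times> {k. \<not> incoming k} \<and> y = f x)"
proof -
  let ?O = "classical L \<times> {k. \<not> incoming k}" and ?I = "classical L \<times> {k. incoming k}"
  let ?s = "\<lambda>(z, k). strand_at L z k"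
  let ?f = "inv_into ?I ?s \<circ> (next_passage L \<circ> ?s)"
  have o: "bij_betw ?s ?O (passages L)" using strand_at_bij[OF assms, of False] by simp
  have i: "bij_betw ?s ?I (passages L)" using strand_at_bij[OF assms, of True] by simp
  have n: "bij_betw (next_passage L \<circ> ?s) ?O (passages L)"
    using bij_betw_trans[OF o next_passage_bij[OF assms]] .
  have "bij_betw ?f ?O ?I" using bij_betw_trans[OF n bij_betw_inv_into[OF i]] .
  moreover have "(x, y) \<in> semiarcs (gauss_of L) \<longleftrightarrow> x \<in> ?O \<and> y = ?f x" for x y
  proof -
    have "(x, y) \<in> semiarcs (gauss_of L) \<longleftrightarrow> x \<in> ?O \<and> y \<in> ?I \<and> next_passage L (?s x) = ?s y"
      by (cases x; cases y) (auto simp: semiarcs_gauss_of)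
    also have "\<dots> \<longleftrightarrow> x \<in> ?O \<and> y = ?f x"
    proof (cases "x \<in> ?O")
      case True
      then have m: "next_passage L (?s x) \<in> ?s ` ?I"
        using bij_betwE[OF n] bij_betw_imp_surj_on[OF i] by auto
      have "y \<in> ?I \<and> next_passage L (?s x) = ?s y \<longleftrightarrow> y = inv_into ?I ?s (next_passage L (?s x))"
        using inv_into_f_f[OF bij_betw_imp_inj_on[OF i]] inv_into_into[OF m] f_inv_into_f[OF m] by metis
      then show ?thesis using True by simp
    qed simp
    finally show ?thesis .
  qed
  ultimately show ?thesis by blast
qed

text \<open>The bijection from outgoing to incoming half-edges given by the semi-arcs, joined with
  its inverse, is an involution. It exchanges the two kinds, so it has no fixed points among the
  half-edges.\<close>

lemma matched_gauss_of:
  assumes L: "virtual_link_diagram L"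
  shows "\<exists>arc. matched_gauss (gauss_of L) arc"
proof -
  let ?O = "classical L \<times> {k. \<not> incoming k}" and ?I = "classical L \<times> {k. incoming k}"
  obtain f where f: "bij_betw f ?O ?I"
    and semi: "\<And>x y. (x, y) \<in> semiarcs (gauss_of L) \<longleftrightarrow> x \<in> ?O \<and> y = f x"
    using semiarc_bij[OF L] by blast
  define f' where "f' = inv_into ?O f"
  have fO: "f x \<in> ?I" "f' (f x) = x" if "x \<in> ?O" for x
    using bij_betwE[OF f] bij_betw_inv_into_left[OF f] that by (auto simp: f'_def)
  have fI: "f' y \<in> ?O" "f (f' y) = y" if "y \<in> ?I" for y
    using bij_betwE[OF bij_betw_inv_into[OF f]] bij_betw_inv_into_right[OF f] that by (auto simp: f'_def)
  define g where "g x = (if x \<in> ?O then f x else if x \<in> ?I then f' x else x)" for x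
  have disj: "x \<in> ?I \<Longrightarrow> x \<notin> ?O" for x by auto
  have X: "x \<in> ?O \<or> x \<in> ?I \<longleftrightarrow> fst x \<in> classical L" for x by (cases x) auto
  have g: "g (g x) = x" for x
    using fO[of x] fI[of x] disj[of x] disj[of "f x"] by (auto simp: g_def)
  have gX: "fst (g x) \<in> classical L" "g x \<noteq> x" if "fst x \<in> classical L" for x
  proof -
    have c: "(g x \<in> ?I \<and> x \<in> ?O) \<or> (g x \<in> ?O \<and> x \<in> ?I)"
    proof (cases "x \<in> ?O")
      case True
      then have "g x = f x" by (simp only: g_def if_True)
      then show ?thesis using fO(1)[OF True] True by metis
    next
      case False
      then have I: "x \<in> ?I" using that X by blast
      then have "g x = f' x" using False by (simp only: g_def if_True if_False)
      then show ?thesis using fI(1)[OF I] I by metis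
    qed
    then show "fst (g x) \<in> classical L" using X[of "g x"] by metis
    show "g x \<noteq> x" using c disj by metis
  qed
  have semi_g: "(x, y) \<in> semiarcs (gauss_of L) \<or> (y, x) \<in> semiarcs (gauss_of L) \<longleftrightarrow> g x = y"
    if "fst x \<in> classical L" for x y
  proof (cases "x \<in> ?O")
    case True
    then have "x \<noteq> f y" if "y \<in> ?O" using fO(1)[OF that] disj by metis
    then have "(y, x) \<notin> semiarcs (gauss_of L)" using semi by blast
    moreover have "(x, y) \<in> semiarcs (gauss_of L) \<longleftrightarrow> y = f x" using semi True by simp
    moreover have "g x = f x" using True by (simp only: g_def if_True)
    ultimately show ?thesis by metis
  next
    case False
    then have I: "x \<in> ?I" using X that by blast
    have "(x, y) \<notin> semiarcs (gauss_of L)" using semi False by simp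
    moreover have "(y, x) \<in> semiarcs (gauss_of L) \<longleftrightarrow> y = f' x" using semi fO(2) fI[OF I] by metis
    moreover have "g x = f' x" using False I by (simp only: g_def if_True if_False)
    ultimately show ?thesis by metis
  qed
  define arc where "arc p = (case p of Half c k \<Rightarrow> Half (fst (g (c, k))) (snd (g (c, k))) | Free i \<Rightarrow> Free i)"
    for p :: "complex point"
  have "matched_gauss (gauss_of L) arc"
  proof
    show "finite (crossings (gauss_of L))" using finite_classical[OF L] by (simp add: gauss_of_def)
  next
    fix c c' :: complex and k k' :: corner
    assume "c \<in> crossings (gauss_of L)"
    then have "fst (c, k) \<in> classical L" by (simp add: gauss_of_def)
    from semi_g[OF this, of "(c', k')"]
    show "((c, k), c', k') \<in> semiarcs (gauss_of L) \<or> ((c', k'), c, k) \<in> semiarcs (gauss_of L) \<longleftrightarrow>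
        arc (Half c k) = Half c' k'"
      by (simp add: arc_def prod_eq_iff)
  next
    fix x assume "x \<in> half_edges (gauss_of L)"
    then obtain c k where x: "x = Half c k" "fst (c, k) \<in> classical L"
      by (auto simp: half_edges_def gauss_of_def)
    show "arc x \<in> half_edges (gauss_of L)"
      using gX(1)[OF x(2)] by (simp add: x(1) arc_def half_edges_def gauss_of_def)
    show "arc x \<noteq> x"
      using gX(2)[OF x(2)] by (simp add: x(1) arc_def prod_eq_iff)
  next
    fix x show "arc (arc x) = x"
      by (cases x) (simp_all add: arc_def g)
  qed
  then show ?thesis by (rule exI[of _ arc])
qed

section \<open>Faces\<close>

text \<open>At a negative crossing, exchanging \<open>SW\<close> and \<open>NE\<close> interchanges
  the two ways of joining the corners but respects \<open>toward\<close> and fixes \<open>NW\<close>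
  and \<open>SE\<close>. Thus neither cut loci nor strand labels notice it.\<close>

fun flip :: "bool \<Rightarrow> corner \<Rightarrow> corner" where
  "flip True k = k"
| "flip False SW = NE"
| "flip False NE = SW"
| "flip False SE = SE"
| "flip False NW = NW"

lemma flip_flip [simp]: "flip p (flip p k) = k"
  by (cases p; cases k) auto

lemma flip_NW_SE [simp]: "flip p NW = NW" "flip p SE = SE"
  by (cases p; simp)+

lemma toward_flip [simp]: "toward (flip p k) = toward k"
  by (cases p; cases k) (auto simp: toward_def)

lemma flip_partner: "flip p (partner b k) = partner (p = b) (flip p k)"
  by (cases p; cases b; cases k) auto

lemma set_all_halves [simp]: "set all_halves = UNIV"
proof -
  have "(b, k) \<in> set all_halves" for b k by (cases b; cases k) (auto simp: all_halves_def)
  then show ?thesis by auto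
qed

lemma distinct_all_halves: "distinct all_halves"
  by (simp add: all_halves_def)

lemma set_reps: "set (reps t) = {h. own_rep h (map_of t h)}"
proof -
  have "set (reps_in t hs) = {h \<in> set hs. own_rep h (map_of t h)}" for hs
    by (induction hs) auto
  then show ?thesis by (simp add: reps_def)
qed

lemma distinct_reps: "distinct (reps t)"
proof -
  have "set (reps_in t hs) \<subseteq> set hs" for hs by (induction hs) auto
  then have "distinct hs \<Longrightarrow> distinct (reps_in t hs)" for hs by (induction hs) auto
  then show ?thesis unfolding reps_def using distinct_all_halves by blast
qed

lemma own_rep_iff: "own_rep r x \<longleftrightarrow> (\<exists>e. x = Some (r, e))"
  by (cases "(r, x)" rule: own_rep.cases) auto

lemma closed_inD:
  assumes "closed_in m s t hs" "h \<in> set hs"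
  obtains r e e1 e2 e3 where "map_of t h = Some (r, e)" "map_of t r = Some (r, e1)"
    "map_of t (turn s h) = Some (r, e2)" "map_of t (mate m h) = Some (r, e3)"
  using assms by (induction hs) (auto simp: own_rep_iff split: option.splits)

locale face = khovanov G arc ord mark
  for G :: "'c gauss" and arc ord mark +
  fixes S :: "'c set" and \<tau> \<tau>' :: 'c
  assumes S: "S \<subseteq> crossings G" and \<tau>: "\<tau> \<in> crossings G - S" and \<tau>': "\<tau>' \<in> crossings G - S"
    and neq: "\<tau> \<noteq> \<tau>'"
begin

definition crossing :: "bool \<Rightarrow> 'c" where
  "crossing b = (if b then \<tau>' else \<tau>)"

fun emb :: "half \<Rightarrow> 'c point" where
  "emb (b, k) = Half (crossing b) (flip (positive G (crossing b)) k)"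

fun state :: "bool \<times> bool \<Rightarrow> 'c set" where
  "state (s, s') = S \<union> (if s then {\<tau>} else {}) \<union> (if s' then {\<tau>'} else {})"

abbreviation "face_nodes \<equiv> nodes {\<tau>, \<tau>'}"

lemma crossing_mem: "crossing b \<in> crossings G"
  using \<tau> \<tau>' by (simp add: crossing_def)

lemma state_subset: "state s \<subseteq> crossings G"
  using S \<tau> \<tau>' by (cases s) auto

lemma emb_inj: "emb h = emb h' \<longleftrightarrow> h = h'"
proof
  assume e: "emb h = emb h'"
  obtain b k b' k' where h: "h = (b, k)" "h' = (b', k')" by (cases h, cases h')
  have "b = b'" using e h neq by (auto simp: crossing_def split: if_splits)
  then have "flip (positive G (crossing b)) (flip (positive G (crossing b)) k) =
      flip (positive G (crossing b)) (flip (positive G (crossing b)) k')" using e h by simp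
  then show "h = h'" using h \<open>b = b'\<close> by simp
qed simp

lemma emb_nodes: "x \<in> face_nodes \<longleftrightarrow> (\<exists>h. x = emb h)"
proof
  assume "x \<in> face_nodes"
  then obtain c k where "x = Half c k" "c = crossing False \<or> c = crossing True"
    by (auto simp: nodes_def crossing_def)
  then obtain b where "x = Half (crossing b) k" by blast
  then have "x = emb (b, flip (positive G (crossing b)) k)" by simp
  then show "\<exists>h. x = emb h" ..
next
  assume "\<exists>h. x = emb h"
  then obtain b k where "x = emb (b, k)" by auto
  then show "x \<in> face_nodes" by (auto simp: nodes_def crossing_def)
qed

lemma toward_emb [simp]: "toward_pt (emb h) = toward (snd h)"
  by (cases h) simp

lemma emb_point: "emb h \<in> points G"
  using crossing_mem by (cases h) (simp add: points_def)

lemma emb_turn: "emb (turn s h) = smooth G (state s) (emb h)"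
proof -
  obtain u u' b k where *: "s = (u, u')" "h = (b, k)" by (cases s, cases h)
  show ?thesis using \<tau> \<tau>' neq
    by (cases b) (auto simp: * crossing_def flip_partner vertical_def)
qed

lemma conn_emb_turn: "conn G (state s) (emb h) (emb (turn s h)) True"
  using conn_smoothing[of G "state s"] by (cases h) (simp add: emb_turn)

lemma vertical_state: "c \<notin> {\<tau>, \<tau>'} \<Longrightarrow> vertical G (state s) c = vertical G S c"
  by (cases s) (auto simp: vertical_def)

text \<open>Carried over by \<open>emb\<close>, the mates form a fixed-point-free involution of the
  eight half-edges, which \<open>matchings\<close> must list.\<close>

lemma mate_exists:
  "\<exists>m\<in>set (matchings all_halves). \<forall>h. outer_mate S {\<tau>, \<tau>'} (emb h) (emb (mate m h))"
proof -
  have T: "{\<tau>, \<tau>'} \<subseteq> crossings G" using \<tau> \<tau>' by simp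
  have "\<exists>h'. outer_mate S {\<tau>, \<tau>'} (emb h) (emb h')" for h
  proof -
    have "emb h \<in> face_nodes" using emb_nodes by blast
    then obtain y where y: "outer_mate S {\<tau>, \<tau>'} (emb h) y" using outer_mate_exists[OF T] by blast
    then have "y \<in> face_nodes" unfolding outer_mate_def by (elim conjE)
    then obtain h' where "y = emb h'" using emb_nodes by blast
    then show ?thesis using y by blast
  qed
  then obtain \<mu> where \<mu>: "\<And>h. outer_mate S {\<tau>, \<tau>'} (emb h) (emb (\<mu> h))" by metis
  have "\<mu> h \<noteq> h" for h using \<mu>[of h] unfolding outer_mate_def by auto
  moreover have "\<mu> (\<mu> h) = h" for h
    using outer_mate_unique[OF \<mu>[of "\<mu> h"] outer_mate_sym[OF T \<mu>[of h]]] emb_inj by simp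
  ultimately obtain m where "m \<in> set (matchings all_halves)" "\<forall>h\<in>set all_halves. mate m h = \<mu> h"
    using matchings_complete[OF distinct_all_halves, of \<mu>] by auto
  then have "mate m h = \<mu> h" for h by (cases h) simp
  then show ?thesis using \<open>m \<in> _\<close> \<mu> by metis
qed

context
  fixes m :: "(half \<times> half) list"
  assumes outer: "\<And>h. outer_mate S {\<tau>, \<tau>'} (emb h) (emb (mate m h))"
    and closed: "\<And>s. closed_in m s (table m s) all_halves"
begin

lemma conn_emb_mate: "conn G (state s) (emb h) (emb (mate m h)) (\<not> has_cut (snd h) (snd (mate m h)))"
proof -
  have "conn G (state s) (emb h) (emb (mate m h)) (toward_pt (emb h) \<noteq> toward_pt (emb (mate m h)))"
    using outer[of h] vertical_state unfolding outer_mate_def by blast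
  then show ?thesis by (simp add: has_cut_def)
qed

lemma table_relation: "table_relation (\<lambda>p q e. conn G (state s) (emb p) (emb q) e) m s"
  by unfold_locales
    (erule (1) conn_trans | erule conn_sym | rule conn_refl conn_emb_turn conn_emb_mate)+

lemma related_Some: "related (table m s) p q = Some e \<Longrightarrow> conn G (state s) (emb p) (emb q) e"
  using table_relation.related_sound[OF table_relation] .

text \<open>The invariant is that the trip is on the outer arc of some \<open>h\<close> in the class
  of \<open>r\<close>, expressed by membership in every closed set around \<open>emb h\<close>. At a
  node it can only be at an end of this arc, \<open>h\<close> or \<open>mate m h\<close>, and the
  class is closed under \<open>mate\<close> and \<open>turn\<close>.\<close>

lemma travel_from_emb:
  assumes "travel G (state s) (emb p) n x"
    and p: "map_of (table m s) p = Some (r, e)"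
  shows "\<exists>h e'. map_of (table m s) h = Some (r, e') \<and>
    (\<forall>A. outer_closed S {\<tau>, \<tau>'} A \<longrightarrow> emb h \<in> A \<longrightarrow> x \<in> A)"
  using assms(1)
proof (induction rule: travel.induct)
  case start
  then show ?case using p by blast
next
  case (smoothing n c k)
  then obtain h e' where h: "map_of (table m s) h = Some (r, e')"
    "\<And>A. outer_closed S {\<tau>, \<tau>'} A \<Longrightarrow> emb h \<in> A \<Longrightarrow> Half c k \<in> A" by blast
  show ?case
  proof (cases "c \<in> {\<tau>, \<tau>'}")
    case False
    then have "Half c k \<notin> face_nodes" by (auto simp: nodes_def)
    then have "outer_closed S {\<tau>, \<tau>'} A \<Longrightarrow> emb h \<in> A \<Longrightarrow> smooth G S (Half c k) \<in> A" for A
      using h(2)[of A] unfolding outer_closed_def by blast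
    moreover have "Half c (partner (vertical G (state s) c) k) = smooth G S (Half c k)"
      using vertical_state[OF False] by simp
    ultimately show ?thesis using h(1) by metis
  next
    case True
    then have node: "Half c k \<in> face_nodes" by (auto simp: nodes_def)
    then obtain q where q: "Half c k = emb q" using emb_nodes by blast
    obtain A where A: "outer_closed S {\<tau>, \<tau>'} A" "emb h \<in> A" "A \<inter> face_nodes = {emb h, emb (mate m h)}"
      using outer[of h] unfolding outer_mate_def by blast
    have "emb q \<in> {emb h, emb (mate m h)}"
      using IntI[OF h(2)[OF A(1,2)] node] unfolding A(3) q .
    then have "q = h \<or> q = mate m h" using emb_inj by auto
    then obtain e2 where "map_of (table m s) q = Some (r, e2)"
      using closed_inD[OF closed, of h s] h(1) by fastforce
    then obtain e3 where "map_of (table m s) (turn s q) = Some (r, e3)"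
      using closed_inD[OF closed, of q s] by fastforce
    moreover have "Half c (partner (vertical G (state s) c) k) = emb (turn s q)"
      using emb_turn[of s q] q[symmetric] by simp
    ultimately show ?thesis by metis
  qed
next
  case (semiarc n c k c' k')
  obtain h e' where h: "map_of (table m s) h = Some (r, e')"
    "\<And>A. outer_closed S {\<tau>, \<tau>'} A \<Longrightarrow> emb h \<in> A \<Longrightarrow> Half c k \<in> A" using semiarc(3) by blast
  have "emb p \<in> half_edges G" using crossing_mem by (cases p) (simp add: half_edges_def)
  from conjunct1[OF travel_word_act[OF semiarc(1) this]] have "c \<in> crossings G"
    by (simp add: half_edges_def)
  then have arc: "arc (Half c k) = Half c' k'" using semiarc(2) semiarc_iff by simp
  have "outer_closed S {\<tau>, \<tau>'} A \<Longrightarrow> emb h \<in> A \<Longrightarrow> Half c' k' \<in> A" for A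
    using h(2)[of A] unfolding outer_closed_def arc[symmetric] by blast
  then show ?case using h(1) by blast
qed

text \<open>A trip from \<open>p\<close> to \<open>q\<close> would put \<open>q\<close> at an end of
  an outer arc that starts in the class of \<open>p\<close>; both ends of this arc belong to that
  class.\<close>

lemma related_None:
  assumes "related (table m s) p q = None"
  shows "cycle_at G (state s) (emb p) \<noteq> cycle_at G (state s) (emb q)"
proof
  assume "cycle_at G (state s) (emb p) = cycle_at G (state s) (emb q)"
  then obtain n where n: "travel G (state s) (emb p) n (emb q)"
    by (auto simp: cycle_at_eq_iff conn_def)
  obtain r e where p: "map_of (table m s) p = Some (r, e)"
    using closed_inD[OF closed, of p s] by (metis UNIV_I set_all_halves)
  obtain h e' where h: "map_of (table m s) h = Some (r, e')"
    "\<And>A. outer_closed S {\<tau>, \<tau>'} A \<Longrightarrow> emb h \<in> A \<Longrightarrow> emb q \<in> A"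
    using travel_from_emb[OF n p] by blast
  obtain A where A: "outer_closed S {\<tau>, \<tau>'} A" "emb h \<in> A" "A \<inter> face_nodes = {emb h, emb (mate m h)}"
    using outer[of h] unfolding outer_mate_def by blast
  have "emb q \<in> face_nodes" using emb_nodes by blast
  from IntI[OF h(2)[OF A(1,2)] this] have "emb q \<in> {emb h, emb (mate m h)}" unfolding A(3) .
  then have "q = h \<or> q = mate m h" using emb_inj by auto
  then obtain e2 where "map_of (table m s) q = Some (r, e2)"
    using closed_inD[OF closed, of h s] h(1) by fastforce
  then show False using assms p by (simp add: related_def)
qed

text \<open>Distinct representatives of the table lie on distinct cycles. \<open>R\<close> adds an
  arbitrary point on each cycle that they do not meet.\<close>

lemma transversal_exists:
  obtains R where "transversal (state s) (map emb (reps (table m s)) @ R)"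
proof -
  let ?c = "cycle_at G (state s)" and ?ps = "map emb (reps (table m s))"
  define W where "W = filter (\<lambda>C. C \<notin> ?c ` set ?ps) (ord (state s))"
  define f where "f C = (SOME p. p \<in> points G \<and> ?c p = C)" for C
  have f: "f C \<in> points G \<and> ?c (f C) = C" if "C \<in> set (ord (state s))" for C
  proof -
    have "\<exists>p. p \<in> points G \<and> ?c p = C" using that set_ord[OF state_subset, of s] by (auto simp: cycles_def)
    then show ?thesis unfolding f_def by (rule someI_ex)
  qed
  have W: "set W = cycles G (state s) - ?c ` set ?ps" "distinct W"
    using set_ord[OF state_subset, of s] distinct_ord[OF state_subset, of s] by (auto simp: W_def)
  have fW: "map ?c (map f W) = W"
    unfolding map_map by (rule map_idI) (use f in \<open>simp add: W_def\<close>)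
  have ps: "distinct (map ?c ?ps)"
  proof -
    have "?c (emb h) \<noteq> ?c (emb h')"
      if "h \<in> set (reps (table m s))" "h' \<in> set (reps (table m s))" "h \<noteq> h'" for h h'
    proof (rule related_None)
      show "related (table m s) h h' = None"
        using that by (auto simp: set_reps own_rep_iff related_def)
    qed
    then have "inj_on (?c \<circ> emb) (set (reps (table m s)))" unfolding inj_on_def comp_def by blast
    then show ?thesis using distinct_reps by (simp add: distinct_map)
  qed
  have sub: "?c ` set ?ps \<subseteq> cycles G (state s)" using emb_point by (auto simp: cycles_def)
  have "transversal (state s) (?ps @ map f W)"
    unfolding transversal_def
  proof (intro conjI)
    show "set (?ps @ map f W) \<subseteq> points G" using emb_point f by (auto simp: W_def)
    show "distinct (map ?c (?ps @ map f W))"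
      unfolding map_append fW distinct_append set_map[of ?c ?ps] using ps W by simp
    have cW: "?c ` set (map f W) = set W" unfolding set_map[symmetric] fW ..
    show "?c ` set (?ps @ map f W) = cycles G (state s)"
      unfolding set_append image_Un cW W(1) by (rule Diff_partition[OF sub])
  qed
  then show ?thesis using that by blast
qed

text \<open>The half-edges of the face stand in front, where the evaluation acts; the tail
  \<open>R\<close> is fixed and serves all four states.\<close>

definition face_coord :: "('c point \<times> gen) list \<Rightarrow> bool \<times> bool \<Rightarrow> 'k::comm_ring_1 tensor \<Rightarrow> labelling \<Rightarrow> 'k" where
  "face_coord R s v l = coord (state s) v (map (\<lambda>(h, g). (emb h, g)) l @ R)"

lemma alternating_face_coord: "alternating (table m s) (face_coord R s v)"
  unfolding alternating_def
proof (intro conjI allI impI)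
  fix A x y B
  show "face_coord R s v (A @ x # y # B) = - face_coord R s v (A @ y # x # B)"
    unfolding face_coord_def using coord_swap[OF state_subset] by simp
next
  fix A p h e g B assume "related (table m s) p h = Some e"
  from coord_move[OF state_subset emb_point related_Some[OF this], of v
      "map (\<lambda>(h, g). (emb h, g)) A" g "map (\<lambda>(h, g). (emb h, g)) B @ R"]
  show "face_coord R s v (A @ (p, g) # B) = sgn_of (g = X_V \<longrightarrow> e) * face_coord R s v (A @ (h, g) # B)"
    unfolding face_coord_def by (simp add: sgn_of_def bar_sign_def)
qed

lemma emb_NW_SE: "emb (b, NW) = Half (crossing b) NW" "emb (b, SE) = Half (crossing b) SE"
  by simp_all

lemma surgery_cases:
  assumes s': "state s' = insert (crossing b) (state s)"
  shows "related (table m s) (b, NW) (b, SE) = None \<Longrightarrow> related (table m s') (b, NW) (b, SE) = Some True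
      \<Longrightarrow> merges (state s) (crossing b)"
    and "related (table m s) (b, NW) (b, SE) = Some True \<Longrightarrow> related (table m s') (b, NW) (b, SE) = None
      \<Longrightarrow> splits (state s) (crossing b)"
    and "related (table m s) (b, NW) (b, SE) \<noteq> None \<Longrightarrow> related (table m s') (b, NW) (b, SE) \<noteq> None
      \<Longrightarrow> one_to_one (state s) (crossing b)"
  using related_None[of _ "(b, NW)" "(b, SE)"] related_Some[of _ "(b, NW)" "(b, SE)"]
  unfolding emb_NW_SE merges_def splits_def one_to_one_def s'[symmetric] cycle_at_eq_iff
  by blast+

lemma chain_space_diff:
  assumes s': "state s' = insert (crossing b) (state s)" and a: "admissible (table m s) (table m s') b"
  shows "diff (state s) (crossing b) v \<in> chain_space G (state s')"
proof -
  have "merges (state s) (crossing b) \<or> splits (state s) (crossing b) \<or> one_to_one (state s) (crossing b)"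
    using surgery_cases[OF s'] a unfolding admissible_def by blast
  then show ?thesis unfolding s' using partial_chain_space[OF state_subset crossing_mem] by blast
qed

lemma transpose_differential_face_coord:
  assumes s': "state s' = insert (crossing b) (state s)" and v: "v \<in> chain_space G (state s)"
  shows "transpose_differential (table m s) (table m s') b (face_coord R s v)
    (face_coord R s' (diff (state s) (crossing b) v))"
  unfolding transpose_differential_def face_coord_def s'
proof (intro conjI impI allI)
  fix g l
  assume "related (table m s) (b, NW) (b, SE) = None" "related (table m s') (b, NW) (b, SE) = Some True"
  from coord_partial_merges[OF state_subset crossing_mem v surgery_cases(1)[OF s' this]]
  show "coord (insert (crossing b) (state s)) (diff (state s) (crossing b) v)
      (map (\<lambda>(h, g). (emb h, g)) (((b, NW), g) # l) @ R) = (case g of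
        One_V \<Rightarrow> coord (state s) v (map (\<lambda>(h, g). (emb h, g)) (((b, NW), One_V) # ((b, SE), One_V) # l) @ R)
      | X_V \<Rightarrow> coord (state s) v (map (\<lambda>(h, g). (emb h, g)) (((b, NW), One_V) # ((b, SE), X_V) # l) @ R)
          + coord (state s) v (map (\<lambda>(h, g). (emb h, g)) (((b, NW), X_V) # ((b, SE), One_V) # l) @ R))"
    by (simp split: gen.split)
next
  fix g1 g2 l
  assume "related (table m s) (b, NW) (b, SE) = Some True" "related (table m s') (b, NW) (b, SE) = None"
  from coord_partial_splits[OF state_subset crossing_mem v surgery_cases(2)[OF s' this]]
  show "coord (insert (crossing b) (state s)) (diff (state s) (crossing b) v)
      (map (\<lambda>(h, g). (emb h, g)) (((b, NW), g1) # ((b, SE), g2) # l) @ R) =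
    (case dual_comult g1 g2 of None \<Rightarrow> 0
     | Some g \<Rightarrow> coord (state s) v (map (\<lambda>(h, g). (emb h, g)) (((b, NW), g) # l) @ R))"
    by (simp split: option.split)
next
  fix l
  assume "related (table m s) (b, NW) (b, SE) \<noteq> None" "related (table m s') (b, NW) (b, SE) \<noteq> None"
  from partial_one_to_one[OF surgery_cases(3)[OF s' this], of v]
  show "coord (insert (crossing b) (state s)) (diff (state s) (crossing b) v)
      (map (\<lambda>(h, g). (emb h, g)) l @ R) = 0"
    by (simp add: coord_def)
qed

text \<open>It suffices that all coordinates of the sum of the two sides vanish for one transversal
  of the last state. It is chosen to begin with the representatives of the table, whose labels the
  evaluation has run through.\<close>

lemma anticommuting_face:
  assumes c: "check_tables (table m (False, False)) (table m (True, False)) (table m (False, True))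
      (table m (True, True))" and v: "v \<in> chain_space G S"
  shows "diff (insert \<tau> S) \<tau>' (diff S \<tau> v) = - diff (insert \<tau>' S) \<tau> (diff S \<tau>' v)"
proof -
  let ?s = "(False, False)" and ?s1 = "(True, False)" and ?s2 = "(False, True)" and ?s12 = "(True, True)"
  have st: "state ?s = S" "state ?s1 = insert \<tau> S" "state ?s2 = insert \<tau>' S"
    "state ?s12 = insert \<tau>' (insert \<tau> S)" "crossing False = \<tau>" "crossing True = \<tau>'"
    by (auto simp: crossing_def)
  have e: "state ?s1 = insert (crossing False) (state ?s)" "state ?s2 = insert (crossing True) (state ?s)"
    "state ?s12 = insert (crossing True) (state ?s1)" "state ?s12 = insert (crossing False) (state ?s2)"
    by (auto simp: crossing_def)
  define v1 v2 v12 v21 where "v1 = diff S \<tau> v" and "v2 = diff S \<tau>' v"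
    and "v12 = diff (insert \<tau> S) \<tau>' v1" and "v21 = diff (insert \<tau>' S) \<tau> v2"
  note c' = c[unfolded check_tables_def anticommuting_def]
  have v0: "v \<in> chain_space G (state ?s)" using v st by simp
  have v1: "v1 \<in> chain_space G (state ?s1)" "v2 \<in> chain_space G (state ?s2)"
    using chain_space_diff[OF e(1)] chain_space_diff[OF e(2)] c' st unfolding v1_def v2_def by auto
  have v12: "v12 \<in> chain_space G (state ?s12)" "v21 \<in> chain_space G (state ?s12)"
    using chain_space_diff[OF e(3)] chain_space_diff[OF e(4)] c' st unfolding v12_def v21_def by auto
  obtain R where R: "transversal (state ?s12) (map emb (reps (table m ?s12)) @ R)"
    using transversal_exists .
  have "v12 + v21 = 0"
  proof (rule coord_0_imp_0[OF state_subset _ R])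
    show "v12 + v21 \<in> chain_space G (state ?s12)"
      using v12 homogeneous_add unfolding chain_space_iff[OF state_subset] by blast
  next
    fix gs :: "gen list" assume len: "length gs = length (map emb (reps (table m ?s12)) @ R)"
    let ?n = "length (reps (table m ?s12))"
    define w where "w = take ?n gs"
    \<comment> \<open>The labels outside the table are carried along unchanged through all four
      states.\<close>
    define Q where "Q = zip R (drop ?n gs)"
    have w: "length w = ?n" "w \<in> set (words (reps (table m ?s12)))"
      using len by (auto simp: w_def set_words)
    have zip: "zip (map emb (reps (table m ?s12)) @ R) gs =
        map (\<lambda>(h, g). (emb h, g)) (zip (reps (table m ?s12)) w) @ Q"
      using w(1) by (simp add: zip_append1 w_def Q_def zip_map1 split_def)
    have t: "transpose_differential (table m ?s) (table m ?s1) False (face_coord Q ?s v) (face_coord Q ?s1 v1)"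
      "transpose_differential (table m ?s1) (table m ?s12) True (face_coord Q ?s1 v1) (face_coord Q ?s12 v12)"
      "transpose_differential (table m ?s) (table m ?s2) True (face_coord Q ?s v) (face_coord Q ?s2 v2)"
      "transpose_differential (table m ?s2) (table m ?s12) False (face_coord Q ?s2 v2) (face_coord Q ?s12 v21)"
      using transpose_differential_face_coord[OF e(1) v0] transpose_differential_face_coord[OF e(2) v0]
        transpose_differential_face_coord[OF e(3) v1(1)] transpose_differential_face_coord[OF e(4) v1(2)]
      unfolding v12_def v21_def v1_def v2_def st by simp_all
    have "face_coord Q ?s12 v12 (zip (reps (table m ?s12)) w) + face_coord Q ?s12 v21 (zip (reps (table m ?s12)) w) = 0"
      using anticommuting_on_sound[OF alternating_face_coord alternating_face_coord alternating_face_coord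
          alternating_face_coord alternating_face_coord t _ w(2)] c' by blast
    then show "coord (state ?s12) (v12 + v21) (zip (map emb (reps (table m ?s12)) @ R) gs) = 0"
      unfolding zip coord_add face_coord_def .
  qed
  then show ?thesis unfolding v12_def v21_def v1_def v2_def by (simp add: eq_neg_iff_add_eq_0)
qed

end

theorem faces_anticommute:
  assumes "v \<in> chain_space G S"
  shows "diff (insert \<tau> S) \<tau>' (diff S \<tau> v) = - diff (insert \<tau>' S) \<tau> (diff S \<tau>' v)"
proof -
  obtain m where m: "m \<in> set (matchings all_halves)"
    "\<And>h. outer_mate S {\<tau>, \<tau>'} (emb h) (emb (mate m h))"
    using mate_exists by blast
  have c: "check m" using check_all m(1) unfolding list_all_iff by blast
  have "closed_in m (u, u') (table m (u, u')) all_halves" for u u'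
    using c unfolding check_def by (cases u; cases u') simp_all
  then have "closed_in m s (table m s) all_halves" for s by (cases s) simp
  from anticommuting_face[OF m(2) this conjunct1[OF c[unfolded check_def]] assms]
  show ?thesis .
qed

end

theorem theorem3p1:
  fixes L :: vdiagram
    and ord :: "complex set \<Rightarrow> complex point set list"
    and mark :: "complex set \<Rightarrow> complex point set \<Rightarrow> complex point"
    and S :: "complex set" and \<tau> \<tau>' :: complex
  assumes "virtual_link_diagram L"
    and "is_global_order (gauss_of L) ord"
    and "is_marking (gauss_of L) mark"
    and "S \<subseteq> crossings (gauss_of L)"
    and "\<tau> \<in> crossings (gauss_of L) - S"
    and "\<tau>' \<in> crossings (gauss_of L) - S"
    and "\<tau> \<noteq> \<tau>'"
  shows
   "(\<forall>v \<in> (chain_space (gauss_of L) S :: bit tensor set).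
       partial_differential (gauss_of L) ord mark (insert \<tau> S) \<tau>'
         (partial_differential (gauss_of L) ord mark S \<tau> v)
       = - partial_differential (gauss_of L) ord mark (insert \<tau>' S) \<tau>
           (partial_differential (gauss_of L) ord mark S \<tau>' v))
  \<and> (\<forall>v \<in> (chain_space (gauss_of L) S :: int tensor set).
       partial_differential (gauss_of L) ord mark (insert \<tau> S) \<tau>'
         (partial_differential (gauss_of L) ord mark S \<tau> v)
       = - partial_differential (gauss_of L) ord mark (insert \<tau>' S) \<tau>
           (partial_differential (gauss_of L) ord mark S \<tau>' v))
  \<and> (\<forall>v \<in> (chain_space (gauss_of L) S :: complex tensor set).
       partial_differential (gauss_of L) ord mark (insert \<tau> S) \<tau>'
         (partial_differential (gauss_of L) ord mark S \<tau> v)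
       = - partial_differential (gauss_of L) ord mark (insert \<tau>' S) \<tau>
           (partial_differential (gauss_of L) ord mark S \<tau>' v))"
proof -
  obtain arc where "matched_gauss (gauss_of L) arc" using matched_gauss_of[OF assms(1)] by blast
  then interpret matched_gauss "gauss_of L" arc .
  interpret face "gauss_of L" arc ord mark S \<tau> \<tau>'
    by unfold_locales (rule assms)+
  \<comment> \<open>\<open>faces_anticommute\<close> holds over every commutative ring, so the three
    cases are instances of it.\<close>
  show ?thesis by (intro conjI ballI faces_anticommute)
qed

end
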